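(* Let $\Sigma=\Sigma^{mod}\cup\Sigma^{exp}$, and let $v_S, v_N, S, N$ be the jump matrices and the solutions of the exact and model Riemann--Hilbert problems described in the context. In particular: (1) $v_N(k)=v_S(k,n)$ for $k\in\Sigma^{mod}$ and $v_N(k)=\mathbb I$ for $k\in\Sigma^{exp}\setminus\Sigma^{mod}$; (2) $w_S=v_S-\mathbb I$ satisfies $|w_S(k,n)|=O(e^{-cn|k-\kappa|^{\chi}})$ for $k\in\Sigma^{exp}$ near each $\kappa\in\mathcal K$, with two positive constants $c,\chi$; (3) $|N(z)|=O(|z-\kappa|^{-1/4})$ near each $\kappa\in\mathcal K$. Let $q\in[1,4)$, let $p\in(4/3,\infty]$ with $\frac1p+\frac1q=1$, and suppose that $$\|S_-(\cdot,n)\|_{L^p(\Sigma^{exp})}=O(n^{r}),\qquad n\to\infty,$$ with $r<\frac{1}{q\chi}-\frac{1}{4\chi}$. Let $$s:=\frac{1}{q\chi}-\frac{1}{4\chi}-r>0,\qquad \ell\in\mathbb N_0 .$$ Then, as $n\to\infty$, $$S(z,n)=\Big(\mathbb I+O\big(n^{-s}\,\mathrm{dist}(z,\Sigma^{exp})^{-1}\big)\Big)N(z)$$ for $z\in\mathbb C\setminus\Sigma^{exp}$. Moreover, $$S(z,n)=\Big(\mathbb I+\sum_{i=1}^{\ell}\frac{\theta_i(n)}{z^i}+O(z^{-\ell-1})\Big)N(z)$$ for $z\to\infty$ such that $|1-k/z|\ge\varepsilon>0$ for all $k\in\Sigma^{exp}$, with matrices $\theta_i(n)$ satisfying $$|\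theta_i(n)|_\infty=O(n^{-s}).$$
   Context: Setting. $\Sigma$ is an oriented, sufficiently smooth contour in $\mathbb C$, regular enough that the Cauchy boundary operators $\mathcal C^\Sigma_\pm$ (the nontangential boundary values of $f\mapsto\frac1{2\pi i}\int_\Sigma\frac{f(k)}{k-z}\,dk$) are bounded on $L^{p}(\Sigma)$ for $1<p<\infty$. The subscripts $+$ and $-$ denote the limits to the contour from the left and from the right. The contour is a union $\Sigma=\Sigma^{mod}\cup\Sigma^{exp}$. $|\cdot|$ and $|\cdot|_\infty$ are matrix norms, the latter the maximum norm. $L^p(\Sigma)$ also denotes matrix functions with entries in $L^p(\Sigma)$. $n\in\mathbb N_0$ is a parameter. Exact problem: $S(\cdot,n)$ is a matrix-valued function, analytic in $\mathbb C\setminus\Sigma$, with $S_+(k,n)=S_-(k,n)v_S(k,n)$ for $k\in\Sigma$ and $S(z,n)=\mathbb I+O(z^{-1})$ as $z\to\infty$. Model problem: $N$ is an $n$-independent matrix-valued function, analytic in $\mathbb C\setminus\Sigma^{mod}$, with $N_+(k)=N_-(k)v_N(k)$ for $k\in\Sigma^{mod}$ and $N(z)=\mathbb I+O(z^{-1})$ as $z\to\infty$. Standing assumptions. - $v_N$ is independent of $n$ and uniformly bounded, and $\det v_S\equiv\det v_N\equiv1$, $\det S\equiv\det N\equiv 1$. - $\mathcal K\subset\Sigma^{exp}$ is a finite set. On $\Sigma^{exp}$ the jump matrix $v_S(\cdot,n)$ converges uniformly exponentially fast to the identity matrix as $n\to\infty$, except in the vicinity of the points of $\mathcal K$. - $N$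 is uniformly bounded except in the vicinities of the points of $\mathcal K$. The bounds on $N$ (away from $\mathcal K$ and near each $\kappa\in\mathcal K$) hold also for $N^{-1}$. - The function $R:=SN^{-1}$ satisfies $R_\pm-\mathbb I\in L^{p_0}(\Sigma)$ for some $p_0\in(1,\infty)$, so that $R(z)=\mathbb I+\frac1{2\pi i}\int_\Sigma\frac{R_+(k)-R_-(k)}{k-z}\,dk$.
   Formalization: If Σ^exp is unbounded, the uniform exponential convergence of v_S to the identity away from K is required with weight (1+|k|)^{ℓ+2}; without decay at infinity the claim fails (e.g. Σ^exp=ℝ, N=I, w_S=e^{-n} cut off at scale e^{2n}, giving θ_1 of size e^n). *)

theory Defs
  imports
    "HOL-Analysis.Analysis"
    "HOL-Probability.Essential_Supremum"
    "HOL-Library.Landau_Symbols"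
begin

text \<open>
  An oriented arc is a pair \<open>(I, \<gamma>)\<close> of a closed parameter interval, possibly
  unbounded, and a parametrization, of which only the values on \<open>I\<close> matter.
  Arcs are \<open>C\<^sup>1\<close>, parametrized by arclength, and chord-arc. The chord-arc condition is
  automatic for a simple \<open>C\<^sup>1\<close> arc of finite length; for an unbounded arc it makes the
  trace closed and gives the linear growth of the arclength in discs, which is what
  boundedness of the Cauchy operators requires.
\<close>

type_synonym oriented_arc = "real set \<times> (real \<Rightarrow> complex)"

definition smooth_arc :: "oriented_arc \<Rightarrow> bool" where
  "smooth_arc = (\<lambda>(I, \<gamma>).
     closed I \<and> is_interval I \<and> interior I \<noteq> {} \<and>
     (\<exists>\<gamma>'. continuous_on I \<gamma>' \<and>
       (\<forall>t\<in>I. (\<gamma> has_vector_derivative \<gamma>' t) (at t within I) \<and> norm (\<gamma>' t) = 1)) \<and>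
     (\<exists>c>0. \<forall>t\<in>I. \<forall>u\<in>I. c * \<bar>t - u\<bar> \<le> dist (\<gamma> t) (\<gamma> u)))"

definition arc_trace :: "oriented_arc \<Rightarrow> complex set" where
  "arc_trace = (\<lambda>(I, \<gamma>). \<gamma> ` I)"

definition arc_endpoints :: "oriented_arc \<Rightarrow> complex set" where
  "arc_endpoints = (\<lambda>(I, \<gamma>). \<gamma> ` frontier I)"

text \<open>
  A contour is a finite collection of arcs which meet only at endpoints. Closed curves and
  transversal crossings are obtained by subdivision.
\<close>

definition oriented_contour :: "oriented_arc set \<Rightarrow> bool" where
  "oriented_contour A \<longleftrightarrow> finite A \<and> (\<forall>a\<in>A. smooth_arc a) \<and>
     (\<forall>a\<in>A. \<forall>b\<in>A. a \<noteq> b \<longrightarrow> arc_trace a \<inter> arc_trace b \<subseteq> arc_endpoints a \<inter> arc_endpoints b)"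

definition contour :: "oriented_arc set \<Rightarrow> complex set" where
  "contour A = (\<Union>a\<in>A. arc_trace a)"

definition arclength :: "oriented_arc set \<Rightarrow> complex measure" where
  "arclength A =
     measure_of UNIV (sets borel) (\<lambda>X. \<Sum>(I, \<gamma>)\<in>A. emeasure lborel {t\<in>I. \<gamma> t \<in> X})"

lemma sets_arclength [simp, measurable_cong]: "sets (arclength A) = sets borel"
  unfolding arclength_def by (simp add: sets.sigma_sets_eq[of borel, simplified space_borel])

lemma space_arclength [simp]: "space (arclength A) = UNIV"
  unfolding arclength_def by simp

lemma emeasure_arclength:
  assumes "oriented_contour A" and X: "X \<in> sets borel"
  shows "emeasure (arclength A) X = (\<Sum>(I, \<gamma>)\<in>A. emeasure lborel {t\<in>I. \<gamma> t \<in> X})"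
proof -
  let ?m = "\<lambda>a X. emeasure (distr (restrict_space lborel (fst a)) borel (snd a)) X"
  have eq: "(case a of (I, \<gamma>) \<Rightarrow> emeasure lborel {t\<in>I. \<gamma> t \<in> Y}) = ?m a Y"
    if a: "a \<in> A" and Y: "Y \<in> sets borel" for a Y
  proof -
    obtain I \<gamma> where ag: "a = (I, \<gamma>)" by force
    have sm: "smooth_arc (I, \<gamma>)" using assms(1) a ag by (auto simp: oriented_contour_def)
    have I: "I \<in> sets borel" and c: "continuous_on I \<gamma>"
      using sm by (auto simp: smooth_arc_def continuous_on_eq_continuous_within
          intro: has_vector_derivative_continuous)
    have m: "\<gamma> \<in> borel_measurable (restrict_space lborel I)"
      using borel_measurable_continuous_on_restrict[OF c]
      by (simp cong: measurable_cong_sets sets_restrict_space_cong)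
    have "emeasure (distr (restrict_space lborel I) borel \<gamma>) Y
        = emeasure (restrict_space lborel I) (\<gamma> -` Y \<inter> I)"
      using m Y by (simp add: emeasure_distr space_restrict_space)
    also have "\<dots> = emeasure lborel (\<gamma> -` Y \<inter> I)"
      by (rule emeasure_restrict_space) (use I in auto)
    finally show ?thesis by (simp add: ag vimage_def Int_def conj_commute)
  qed
  define \<mu> where "\<mu> = (\<lambda>X. \<Sum>(I, \<gamma>)\<in>A. emeasure lborel {t\<in>I. \<gamma> t \<in> X})"
  have \<mu>: "\<mu> Y = (\<Sum>a\<in>A. ?m a Y)" if "Y \<in> sets borel" for Y
    unfolding \<mu>_def by (rule sum.cong[OF refl]) (rule eq, use that in auto)
  have "countably_additive (sets borel) \<mu>"
  proof (rule countably_additiveI)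
    fix F :: "nat \<Rightarrow> complex set"
    assume F: "range F \<subseteq> sets borel" "disjoint_family F" "\<Union> (range F) \<in> sets borel"
    have "(\<Sum>i. \<mu> (F i)) = (\<Sum>i. \<Sum>a\<in>A. ?m a (F i))"
      using F by (intro suminf_cong) (auto simp: \<mu>)
    also have "\<dots> = (\<Sum>a\<in>A. \<Sum>i. ?m a (F i))"
      by (rule suminf_sum) simp
    also have "\<dots> = (\<Sum>a\<in>A. ?m a (\<Union> (range F)))"
      using F by (intro sum.cong refl suminf_emeasure) auto
    finally show "(\<Sum>i. \<mu> (F i)) = \<mu> (\<Union> (range F))" using F by (simp add: \<mu>)
  qed
  moreover have "positive (sets borel) \<mu>" by (simp add: positive_def \<mu>_def)
  moreover have "sigma_algebra UNIV (sets (borel :: complex measure))"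
    using sets.sigma_algebra_axioms[of "borel :: complex measure"] by simp
  ultimately show ?thesis
    using emeasure_measure_of_sigma[of UNIV "sets borel" \<mu> X] X
    by (simp add: arclength_def \<mu>_def)
qed

text \<open>
  The unit tangent at \<open>k\<close>. At most one summand is nonzero; at the finitely many
  endpoints of arcs, and off the contour, the value is \<open>0\<close>.
\<close>

definition tangent :: "oriented_arc set \<Rightarrow> complex \<Rightarrow> complex" where
  "tangent A k = (\<Sum>(I, \<gamma>)\<in>A.
     if k \<in> \<gamma> ` interior I then vector_derivative \<gamma> (at (inv_into I \<gamma> k) within I) else 0)"

text \<open>
  Nontangential approach from the left and from the right: \<open>z \<rightarrow> k\<close> off the contour,
  inside the cones around the left, resp. right, normal at \<open>k\<close>, of every aperture.
\<close>

definition nt_left :: "oriented_arc set \<Rightarrow> complex \<Rightarrow> complex filter" where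
  "nt_left A k = (SUP \<delta>\<in>{0<..<1}. at k within
     {z. z \<notin> contour A \<and> \<delta> * norm (z - k) < Im ((z - k) * cnj (tangent A k))})"

definition nt_right :: "oriented_arc set \<Rightarrow> complex \<Rightarrow> complex filter" where
  "nt_right A k = (SUP \<delta>\<in>{0<..<1}. at k within
     {z. z \<notin> contour A \<and> \<delta> * norm (z - k) < - Im ((z - k) * cnj (tangent A k))})"

definition bdry_plus :: "oriented_arc set \<Rightarrow> (complex \<Rightarrow> 'b::t2_space) \<Rightarrow> complex \<Rightarrow> 'b" where
  "bdry_plus A Y k = Lim (nt_left A k) Y"

definition bdry_minus :: "oriented_arc set \<Rightarrow> (complex \<Rightarrow> 'b::t2_space) \<Rightarrow> complex \<Rightarrow> 'b" where
  "bdry_minus A Y k = Lim (nt_right A k) Y"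

definition has_bdry_values :: "oriented_arc set \<Rightarrow> (complex \<Rightarrow> 'b::t2_space) \<Rightarrow> complex \<Rightarrow> bool" where
  "has_bdry_values A Y k \<longleftrightarrow>
     (\<exists>L. (Y \<longlongrightarrow> L) (nt_left A k)) \<and> (\<exists>L. (Y \<longlongrightarrow> L) (nt_right A k))"

text \<open>
  For matrix-valued functions, membership in \<open>L\<^sup>p\<close> as expressed through the norm is
  equivalent to membership of all entries.
\<close>

definition in_Lp :: "ennreal \<Rightarrow> 'a measure \<Rightarrow> ('a \<Rightarrow> 'b::real_normed_vector) \<Rightarrow> bool" where
  "in_Lp p M f \<longleftrightarrow> f \<in> borel_measurable M \<and>
     (if p = \<infinity> then esssup M (\<lambda>x. ennreal (norm (f x))) < \<infinity>
      else integrable M (\<lambda>x. norm (f x) powr enn2real p))"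

definition Lp_norm :: "ennreal \<Rightarrow> 'a measure \<Rightarrow> ('a \<Rightarrow> 'b::real_normed_vector) \<Rightarrow> real" where
  "Lp_norm p M f =
     (if p = \<infinity> then enn2real (esssup M (\<lambda>x. ennreal (norm (f x))))
      else (LINT x|M. norm (f x) powr enn2real p) powr (1 / enn2real p))"

definition cauchy_integral :: "oriented_arc set \<Rightarrow> (complex \<Rightarrow> complex) \<Rightarrow> complex \<Rightarrow> complex" where
  "cauchy_integral A f z =
     1 / (2 * of_real pi * \<i>) * (LINT k|arclength A. f k / (k - z) * tangent A k)"

definition cauchy_integral_mat ::
  "oriented_arc set \<Rightarrow> (complex \<Rightarrow> complex^'m^'m) \<Rightarrow> complex \<Rightarrow> complex^'m^'m" where
  "cauchy_integral_mat A F z = (\<chi> i j. cauchy_integral A (\<lambda>k. F k $ i $ j) z)"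

definition cauchy_operators_bounded :: "oriented_arc set \<Rightarrow> bool" where
  "cauchy_operators_bounded A \<longleftrightarrow> (\<forall>p::real. 1 < p \<longrightarrow> (\<exists>C. \<forall>f.
     in_Lp (ennreal p) (arclength A) f \<longrightarrow>
       (AE k in arclength A. has_bdry_values A (cauchy_integral A f) k) \<and>
       (\<forall>g\<in>{bdry_plus A (cauchy_integral A f), bdry_minus A (cauchy_integral A f)}.
          in_Lp (ennreal p) (arclength A) g \<and>
          Lp_norm (ennreal p) (arclength A) g \<le> C * Lp_norm (ennreal p) (arclength A) f)))"

text \<open>
  Jump conditions are imposed almost everywhere with respect to arclength, with
  nontangential boundary values.
\<close>

definition RH_solution ::
  "oriented_arc set \<Rightarrow> (complex \<Rightarrow> complex^'m^'m) \<Rightarrow> (complex \<Rightarrow> complex^'m^'m) \<Rightarrow> bool" where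
  "RH_solution A v Y \<longleftrightarrow>
     (\<forall>i j. (\<lambda>z. Y z $ i $ j) holomorphic_on - contour A) \<and>
     (AE k in arclength A. has_bdry_values A Y k \<and> bdry_plus A Y k = bdry_minus A Y k ** v k) \<and>
     (\<lambda>z. norm (Y z - mat 1)) \<in> O[inf at_infinity (principal (- contour A))](\<lambda>z. 1 / norm z)"

text \<open>
  Uniform exponential convergence of \<open>w\<close> to zero away from \<open>K\<close>, with the polynomial
  weight \<open>(1 + |k|)\<^sup>m\<close>. On a bounded contour every \<open>m\<close> amounts to \<open>m = 0\<close>, the unweighted
  notion. On an unbounded contour a positive \<open>m\<close> controls the integrals
  \<open>\<integral> |k|\<^sup>l |w n k| |dk|\<close> of the coefficients at infinity, which the unweighted bound does not.
\<close>

definition exp_small_away ::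
  "nat \<Rightarrow> oriented_arc set \<Rightarrow> complex set \<Rightarrow> (nat \<Rightarrow> complex \<Rightarrow> complex^'m^'m) \<Rightarrow> bool" where
  "exp_small_away m A K w \<longleftrightarrow> (\<forall>\<rho>>0. \<exists>C. \<exists>d>0. \<forall>\<^sub>F n in sequentially. AE k in arclength A.
     (\<forall>\<kappa>\<in>K. \<rho> \<le> dist k \<kappa>) \<longrightarrow> (1 + norm k) ^ m * norm (w n k) \<le> C * exp (- d * real n))"

definition max_norm :: "complex^'m^'m \<Rightarrow> real" where
  "max_norm M = Max (range (\<lambda>(i, j). norm (M $ i $ j)))"

definition cscale :: "complex \<Rightarrow> complex^'m^'m \<Rightarrow> complex^'m^'m" where
  "cscale c M = (\<chi> i j. c * M $ i $ j)"

end

theory Submission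
  imports Defs "HOL-Real_Asymp.Real_Asymp"
begin

text \<open>
  On \<open>\<Sigma>\<^sup>m\<^sup>o\<^sup>d\<close> the two problems have the same jump, so \<open>R = S N\<inverse>\<close> jumps only across
  \<open>\<Sigma>\<^sup>e\<^sup>x\<^sup>p - \<Sigma>\<^sup>m\<^sup>o\<^sup>d\<close>, where \<open>N\<close> is continuous and \<open>J = R\<^sub>+ - R\<^sub>- = S\<^sub>- (v\<^sub>S - 1) N\<inverse>\<close>. Hoelder's inequality
  bounds \<open>\<integral> (1 + |k|)\<^sup>l |J| |dk|\<close> by \<open>O(n\<^sup>r)\<close> times the \<open>L\<^sup>q\<close> norm of \<open>(1 + |k|)\<^sup>l (v\<^sub>S - 1) N\<inverse>\<close>.
  Away from \<open>K\<close> the latter is exponentially small. Near \<open>\<kappa>\<close> the chord-arc condition compares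
  \<open>|k - \<kappa>|\<close> with a parameter difference, and rescaling that parameter by \<open>n\<close> to the power \<open>-1/\<chi>\<close> turns
  \<open>exp (- c q n |k - \<kappa>| powr \<chi>) |k - \<kappa>| powr (-q/4)\<close> into a fixed integrable function times the stated
  power of \<open>n\<close>. The Cauchy integral \<open>E\<close> of \<open>J\<close> is the error term: its size off the contour is
  bounded through \<open>|k - z| \<ge> dist(z, \<Sigma>\<^sup>e\<^sup>x\<^sup>p)\<close>, and the geometric expansion of \<open>1/(k - z)\<close> at infinity
  makes the moments of \<open>J\<close> the coefficients \<open>\<theta>\<^sub>i\<close>.
\<close>

subsection \<open>Contours and arclength\<close>

text \<open>The exponent \<open>s\<close> is forced by scaling. Near a point of \<open>K\<close> the
  \<open>q\<close>-th power of the Hoelder factor has the singularity u^(-q/4), integrable because q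
  < 4. Substituting u = n^(-1/chi) v produces n^(-(1 - q/4)/chi), whose \<open>q\<close>-th root has
  exponent -(1/(q chi) - 1/(4 chi)); the factor n^r from the norm of S_- turns this into n^(-s). The
  singularity enters only once because the jump is written through S_-, whose norm is controlled;
  written through R_- it would contain both N and its inverse. The obstacle at the boundary is that
  S and N have limits relative to different contours, while a product of limits needs one common
  filter. Almost every point is interior to exactly one arc; there the tangent does not depend on
  the contour, both cones are nontrivial, and limits relative to \<open>Amod\<close> pass to the
  finer filters of \<open>A\<close>. The weight has exponent l + 2 because l powers serve the
  moments and two more make the exponentially small part integrable along an unbounded
  contour.\<close>

lemma smooth_arcE:
  assumes "smooth_arc (I, \<gamma>)"
  obtains \<gamma>' c where "closed I" "is_interval I" "interior I \<noteq> {}" "continuous_on I \<gamma>"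
    "continuous_on I \<gamma>'" "\<And>t. t \<in> I \<Longrightarrow> (\<gamma> has_vector_derivative \<gamma>' t) (at t within I)"
    "\<And>t. t \<in> I \<Longrightarrow> norm (\<gamma>' t) = 1" "0 < c"
    "\<And>t u. t \<in> I \<Longrightarrow> u \<in> I \<Longrightarrow> c * \<bar>t - u\<bar> \<le> dist (\<gamma> t) (\<gamma> u)"
proof -
  from assms obtain \<gamma>' c where *: "closed I" "is_interval I" "interior I \<noteq> {}"
    "continuous_on I \<gamma>'" "\<And>t. t \<in> I \<Longrightarrow> (\<gamma> has_vector_derivative \<gamma>' t) (at t within I)"
    "\<And>t. t \<in> I \<Longrightarrow> norm (\<gamma>' t) = 1" "0 < c"
    "\<And>t u. t \<in> I \<Longrightarrow> u \<in> I \<Longrightarrow> c * \<bar>t - u\<bar> \<le> dist (\<gamma> t) (\<gamma> u)"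
    unfolding smooth_arc_def by blast
  moreover have "continuous_on I \<gamma>"
    using *(5) by (auto simp: continuous_on_eq_continuous_within
      intro: has_vector_derivative_continuous)
  ultimately show ?thesis using that by metis
qed

lemma smooth_arc_inj_on:
  assumes "smooth_arc (I, \<gamma>)"
  shows "inj_on \<gamma> I"
proof -
  from assms obtain \<gamma>' c where "0 < c"
    "\<And>t u. t \<in> I \<Longrightarrow> u \<in> I \<Longrightarrow> c * \<bar>t - u\<bar> \<le> dist (\<gamma> t) (\<gamma> u)"
    by (rule smooth_arcE) (rule that)
  then have "t = u" if "t \<in> I" "u \<in> I" "\<gamma> t = \<gamma> u" for t u
    using that by (fastforce simp: mult_le_0_iff)
  then show ?thesis by (auto intro: inj_onI)
qed

lemma closed_smooth_arc_image:
  assumes "smooth_arc (I, \<gamma>)" and T: "closed T" "T \<subseteq> I"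
  shows "closed (\<gamma> ` T)"
proof -
  from assms(1) obtain \<gamma>' c where cont: "continuous_on I \<gamma>" and c: "0 < c"
    and le: "\<And>t u. t \<in> I \<Longrightarrow> u \<in> I \<Longrightarrow> c * \<bar>t - u\<bar> \<le> dist (\<gamma> t) (\<gamma> u)"
    by (rule smooth_arcE) (rule that)
  show ?thesis
    unfolding closed_sequential_limits
  proof (intro allI impI, elim conjE)
    fix x z assume "\<forall>n. x n \<in> \<gamma> ` T" and lim: "x \<longlonglongrightarrow> z"
    then obtain u where u: "\<And>n. u n \<in> T" "\<And>n. x n = \<gamma> (u n)"
      unfolding image_iff by metis
    have "Cauchy u"
    proof (rule metric_CauchyI)
      fix e :: real assume "0 < e"
      then have "0 < c * e" using c by simp
      from metric_CauchyD[OF LIMSEQ_imp_Cauchy[OF lim] this]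
      obtain M where M: "\<And>m n. m \<ge> M \<Longrightarrow> n \<ge> M \<Longrightarrow> dist (x m) (x n) < c * e" by blast
      have "dist (u m) (u n) < e" if "m \<ge> M" "n \<ge> M" for m n
      proof -
        have "c * \<bar>u m - u n\<bar> \<le> dist (x m) (x n)"
          using le[of "u m" "u n"] u T by auto
        also have "\<dots> < c * e" using M that by blast
        finally show ?thesis using c by (simp add: dist_real_def)
      qed
      then show "\<exists>M. \<forall>m\<ge>M. \<forall>n\<ge>M. dist (u m) (u n) < e" by blast
    qed
    then obtain t where t: "u \<longlonglongrightarrow> t" by (meson Cauchy_convergent convergentD)
    have tT: "t \<in> T" using T(1) u(1) t closed_sequentially by metis
    have "(\<lambda>n. \<gamma> (u n)) \<longlonglongrightarrow> \<gamma> t"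
      using continuous_on_tendsto_compose[OF cont t] u(1) tT T(2) by (simp add: subset_iff)
    then have "x \<longlonglongrightarrow> \<gamma> t"
      unfolding u(2)[symmetric] .
    then have "z = \<gamma> t" using lim LIMSEQ_unique by blast
    then show "z \<in> \<gamma> ` T" using tT by simp
  qed
qed

lemma oriented_contour_subset: "oriented_contour A \<Longrightarrow> B \<subseteq> A \<Longrightarrow> oriented_contour B"
  unfolding oriented_contour_def by (meson finite_subset subsetD)

lemma oriented_contour_smooth_arc: "oriented_contour A \<Longrightarrow> a \<in> A \<Longrightarrow> smooth_arc a"
  by (simp add: oriented_contour_def)

lemma contour_mono: "B \<subseteq> A \<Longrightarrow> contour B \<subseteq> contour A"
  by (auto simp: contour_def)

lemma closed_arc_trace:
  assumes "smooth_arc a" shows "closed (arc_trace a)"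
proof (cases a)
  case (Pair I \<gamma>)
  with assms have "smooth_arc (I, \<gamma>)" by simp
  moreover from this have "closed I" by (rule smooth_arcE)
  ultimately show ?thesis
    using Pair closed_smooth_arc_image by (auto simp: arc_trace_def)
qed

lemma closed_contour: "oriented_contour A \<Longrightarrow> closed (contour A)"
  unfolding contour_def oriented_contour_def by (auto intro!: closed_UN closed_arc_trace)

lemma closed_arc_endpoints:
  assumes "smooth_arc a" shows "closed (arc_endpoints a)"
proof (cases a)
  case (Pair I \<gamma>)
  with assms have "smooth_arc (I, \<gamma>)" by simp
  moreover from this have "closed I" by (rule smooth_arcE)
  ultimately show ?thesis
    using Pair closed_smooth_arc_image[of I \<gamma> "frontier I"]
    by (auto simp: arc_endpoints_def frontier_subset_closed)
qed

lemma arc_endpoints_subset: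
  assumes "smooth_arc a" shows "arc_endpoints a \<subseteq> arc_trace a"
proof (cases a)
  case (Pair I \<gamma>)
  with assms have "closed I" by (auto elim: smooth_arcE)
  then show ?thesis
    using Pair frontier_subset_closed by (auto simp: arc_endpoints_def arc_trace_def)
qed

section \<open>Null sets and restriction of the arclength measure\<close>

lemma frontier_interval_null:
  fixes I :: "real set"
  assumes "is_interval I" shows "frontier I \<in> null_sets lborel"
proof -
  have "negligible (frontier I)"
    using assms by (simp add: negligible_convex_frontier is_interval_convex)
  then show ?thesis
    by (simp add: negligible_iff_null_sets null_sets_completion_iff)
qed

text \<open>By injectivity the parameters that hit \<open>X\<close> lie in the frontier of an
  interval, which is a null set. This is how overlaps of different arcs are discarded.\<close>

lemma emeasure_arclength_arc_endpoints:
  assumes a: "smooth_arc (I, \<gamma>)" and X: "X \<inter> arc_trace (I, \<gamma>) \<subseteq> arc_endpoints (I, \<gamma>)"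
  shows "emeasure lborel {t\<in>I. \<gamma> t \<in> X} = 0"
proof -
  from a have I: "closed I" "is_interval I" by (auto elim: smooth_arcE)
  have "{t\<in>I. \<gamma> t \<in> X} \<subseteq> frontier I"
  proof clarify
    fix t assume t: "t \<in> I" "\<gamma> t \<in> X"
    then have "\<gamma> t \<in> \<gamma> ` frontier I"
      using X by (auto simp: arc_trace_def arc_endpoints_def)
    then show "t \<in> frontier I"
      using smooth_arc_inj_on[OF a] frontier_subset_closed[OF I(1)] t(1)
      by (metis inj_on_image_mem_iff)
  qed
  then have "emeasure lborel {t\<in>I. \<gamma> t \<in> X} \<le> emeasure lborel (frontier I)"
    by (intro emeasure_mono) auto
  then show ?thesis using frontier_interval_null[OF I(2)] by auto
qed

text \<open>An arc outside \<open>B\<close> meets \<open>contour B\<close> only in its own endpoints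
  and so contributes nothing there. Statements on \<open>Amod\<close> and \<open>Aexp\<close>, whose
  arcs may coincide in part, can thereby all be read as statements on \<open>A\<close>.\<close>

lemma arclength_eq_density:
  assumes A: "oriented_contour A" and B: "B \<subseteq> A"
  shows "arclength B = density (arclength A) (indicator (contour B))"
proof (rule measure_eqI)
  fix X assume "X \<in> sets (arclength B)"
  then have X: "X \<in> sets borel" by simp
  have cB: "contour B \<in> sets borel"
    using closed_contour[OF oriented_contour_subset[OF A B]] by simp
  have fin: "finite A" using A by (simp add: oriented_contour_def)
  have "emeasure (density (arclength A) (indicator (contour B))) X
      = emeasure (arclength A) (contour B \<inter> X)"
    using X cB by (subst emeasure_density) (simp_all add: nn_integral_indicator
        flip: indicator_inter_arith)
  also have "\<dots> = (\<Sum>(I, \<gamma>)\<in>A. emeasure lborel {t\<in>I. \<gamma> t \<in> contour B \<inter> X})"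
    using emeasure_arclength[OF A, of "contour B \<inter> X"] X cB by simp
  also have "\<dots> = (\<Sum>(I, \<gamma>)\<in>B. emeasure lborel {t\<in>I. \<gamma> t \<in> contour B \<inter> X})"
  proof (rule sum.mono_neutral_right[OF fin B], rule ballI)
    fix a assume a: "a \<in> A - B"
    obtain I \<gamma> where ag: "a = (I, \<gamma>)" by force
    have "arc_trace b \<inter> arc_trace a \<subseteq> arc_endpoints a" if "b \<in> B" for b
      using A a B that unfolding oriented_contour_def by (metis DiffE le_inf_iff subsetD)
    then have "(contour B \<inter> X) \<inter> arc_trace (I, \<gamma>) \<subseteq> arc_endpoints (I, \<gamma>)"
      unfolding contour_def ag by blast
    then show "(case a of (I, \<gamma>) \<Rightarrow> emeasure lborel {t\<in>I. \<gamma> t \<in> contour B \<inter> X}) = 0"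
      using emeasure_arclength_arc_endpoints[of I \<gamma> "contour B \<inter> X"]
        oriented_contour_smooth_arc[OF A, of a] a ag by simp
  qed
  also have "\<dots> = (\<Sum>(I, \<gamma>)\<in>B. emeasure lborel {t\<in>I. \<gamma> t \<in> X})"
  proof (rule sum.cong[OF refl], clarify)
    fix I \<gamma> assume "(I, \<gamma>) \<in> B"
    then have "{t\<in>I. \<gamma> t \<in> contour B \<inter> X} = {t\<in>I. \<gamma> t \<in> X}"
      by (force simp: contour_def arc_trace_def)
    then show "emeasure lborel {t\<in>I. \<gamma> t \<in> contour B \<inter> X} = emeasure lborel {t\<in>I. \<gamma> t \<in> X}"
      by simp
  qed
  also have "\<dots> = emeasure (arclength B) X"
    using emeasure_arclength[OF oriented_contour_subset[OF A B] X] by simp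
  finally show "emeasure (arclength B) X
      = emeasure (density (arclength A) (indicator (contour B))) X" ..
qed simp

lemma AE_arclength_subset_iff:
  assumes "oriented_contour A" and "B \<subseteq> A"
  shows "(AE k in arclength B. P k) \<longleftrightarrow> (AE k in arclength A. k \<in> contour B \<longrightarrow> P k)"
proof -
  have "contour B \<in> sets borel"
    using closed_contour[OF oriented_contour_subset[OF assms]] by simp
  then have "(AE k in arclength B. P k)
      \<longleftrightarrow> (AE k in arclength A. 0 < (indicator (contour B) k :: ennreal) \<longrightarrow> P k)"
    unfolding arclength_eq_density[OF assms] by (subst AE_density) auto
  moreover have "0 < (indicator (contour B) k :: ennreal) \<longleftrightarrow> k \<in> contour B" for k
    by (simp add: indicator_def)
  ultimately show ?thesis by simp
qed

lemma nn_integral_arclength_subset: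
  assumes "oriented_contour A" "B \<subseteq> A" "f \<in> borel_measurable borel"
  shows "(\<integral>\<^sup>+k. f k \<partial>arclength B) = (\<integral>\<^sup>+k. f k * indicator (contour B) k \<partial>arclength A)"
proof -
  have "contour B \<in> sets borel"
    using closed_contour[OF oriented_contour_subset[OF assms(1,2)]] by simp
  then show ?thesis using assms(3)
    unfolding arclength_eq_density[OF assms(1,2)]
    by (subst nn_integral_density) (auto simp: mult.commute)
qed

lemma AE_arclength_regular:
  assumes A: "oriented_contour A"
  shows "AE k in arclength A. k \<in> contour A \<and> (\<forall>a\<in>A. k \<notin> arc_endpoints a)"
proof -
  have "AE k in arclength A. k \<in> contour A"
    using AE_arclength_subset_iff[OF A order_refl, of "\<lambda>k. k \<in> contour A"] by simp
  moreover have "AE k in arclength A. k \<notin> arc_endpoints a" if a: "a \<in> A" for a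
  proof (rule AE_not_in)
    have cl: "arc_endpoints a \<in> sets borel"
      using closed_arc_endpoints oriented_contour_smooth_arc[OF A a] by auto
    have tr: "arc_endpoints a \<subseteq> arc_trace a"
      using arc_endpoints_subset oriented_contour_smooth_arc[OF A a] .
    have "(\<Sum>(I, \<gamma>)\<in>A. emeasure lborel {t\<in>I. \<gamma> t \<in> arc_endpoints a}) = 0"
    proof (rule sum.neutral, clarify)
      fix I \<gamma> assume b: "(I, \<gamma>) \<in> A"
      \<comment> \<open>An endpoint of \<open>a\<close> may lie on other arcs, but then it is an
        endpoint of those arcs too, so its parameters there are again null.\<close>
      have "arc_endpoints a \<inter> arc_trace (I, \<gamma>) \<subseteq> arc_endpoints (I, \<gamma>)"
      proof (cases "a = (I, \<gamma>)")
        case False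
        then have "arc_trace a \<inter> arc_trace (I, \<gamma>) \<subseteq> arc_endpoints (I, \<gamma>)"
          using A a b unfolding oriented_contour_def by (metis le_inf_iff)
        then show ?thesis using tr by blast
      qed simp
      then show "emeasure lborel {t\<in>I. \<gamma> t \<in> arc_endpoints a} = 0"
        using emeasure_arclength_arc_endpoints oriented_contour_smooth_arc[OF A b] by blast
    qed
    then show "arc_endpoints a \<in> null_sets (arclength A)"
      using emeasure_arclength[OF A cl] cl by (auto intro!: null_setsI)
  qed
  then have "AE k in arclength A. \<forall>a\<in>A. k \<notin> arc_endpoints a"
    using A by (intro AE_finite_allI) (auto simp: oriented_contour_def)
  ultimately show ?thesis by eventually_elim simp
qed

section \<open>Integration by parametrization of single arcs\<close>

lemma arclength_singleton:
  assumes "smooth_arc (I, \<gamma>)"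
  shows "arclength {(I, \<gamma>)} = distr (restrict_space lborel I) borel \<gamma>"
proof (rule measure_eqI)
  fix X assume "X \<in> sets (arclength {(I, \<gamma>)})"
  then have X: "X \<in> sets borel" by simp
  have I: "I \<in> sets borel" and c: "continuous_on I \<gamma>"
    using assms by (auto elim!: smooth_arcE)
  have m: "\<gamma> \<in> borel_measurable (restrict_space lborel I)"
    using borel_measurable_continuous_on_restrict[OF c]
    by (simp cong: measurable_cong_sets sets_restrict_space_cong)
  have o: "oriented_contour {(I, \<gamma>)}"
    using assms by (simp add: oriented_contour_def)
  have "emeasure (distr (restrict_space lborel I) borel \<gamma>) X
      = emeasure (restrict_space lborel I) (\<gamma> -` X \<inter> I)"
    using m X by (simp add: emeasure_distr space_restrict_space)
  also have "\<dots> = emeasure lborel (\<gamma> -` X \<inter> I)"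
    by (rule emeasure_restrict_space) (use I in auto)
  finally show "emeasure (arclength {(I, \<gamma>)}) X
      = emeasure (distr (restrict_space lborel I) borel \<gamma>) X"
    using emeasure_arclength[OF o X] by (simp add: vimage_def Int_def conj_commute)
qed simp

lemma nn_integral_arclength_singleton:
  assumes "smooth_arc (I, \<gamma>)" and f: "f \<in> borel_measurable borel"
  shows "(\<integral>\<^sup>+k. f k \<partial>arclength {(I, \<gamma>)}) = (\<integral>\<^sup>+t. f (\<gamma> t) * indicator I t \<partial>lborel)"
proof -
  have I: "I \<in> sets borel" and c: "continuous_on I \<gamma>"
    using assms by (auto elim!: smooth_arcE)
  have m: "\<gamma> \<in> borel_measurable (restrict_space lborel I)"
    using borel_measurable_continuous_on_restrict[OF c]
    by (simp cong: measurable_cong_sets sets_restrict_space_cong)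
  show ?thesis
    unfolding arclength_singleton[OF assms(1)] using I f m
    by (simp add: nn_integral_distr nn_integral_restrict_space)
qed

text \<open>Only upper bounds are needed later, so it suffices that the indicator of a union is at
  most the sum of the indicators.\<close>

lemma nn_integral_arclength_le:
  assumes A: "oriented_contour A" and f: "f \<in> borel_measurable borel"
  shows "(\<integral>\<^sup>+k. f k \<partial>arclength A)
    \<le> (\<Sum>(I, \<gamma>)\<in>A. \<integral>\<^sup>+t. f (\<gamma> t) * indicator I t \<partial>lborel)"
proof -
  have fin: "finite A" using A by (simp add: oriented_contour_def)
  have m: "contour {a} \<in> sets borel" if "a \<in> A" for a
    using closed_contour[OF oriented_contour_subset[OF A, of "{a}"]] that by simp
  have "(\<integral>\<^sup>+k. f k \<partial>arclength A) = (\<integral>\<^sup>+k. f k * indicator (contour A) k \<partial>arclength A)"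
    using nn_integral_arclength_subset[OF A order_refl f] .
  also have "\<dots> \<le> (\<integral>\<^sup>+k. (\<Sum>a\<in>A. f k * indicator (contour {a}) k) \<partial>arclength A)"
  proof (rule nn_integral_mono)
    fix k
    show "f k * indicator (contour A) k \<le> (\<Sum>a\<in>A. f k * indicator (contour {a}) k)"
    proof (cases "k \<in> contour A")
      case True
      then obtain a where a: "a \<in> A" "k \<in> arc_trace a" by (auto simp: contour_def)
      have "f k * indicator (contour A) k = f k * indicator (contour {a}) k"
        using True a by (simp add: contour_def)
      also have "\<dots> \<le> (\<Sum>a\<in>A. f k * indicator (contour {a}) k)"
        using fin a by (intro member_le_sum) auto
      finally show ?thesis .
    qed simp
  qed
  also have "\<dots> = (\<Sum>a\<in>A. \<integral>\<^sup>+k. f k * indicator (contour {a}) k \<partial>arclength A)"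
    using f m by (intro nn_integral_sum) auto
  also have "\<dots> = (\<Sum>a\<in>A. \<integral>\<^sup>+k. f k \<partial>arclength {a})"
    using A f by (intro sum.cong refl) (simp add: nn_integral_arclength_subset)
  also have "\<dots> = (\<Sum>(I, \<gamma>)\<in>A. \<integral>\<^sup>+t. f (\<gamma> t) * indicator I t \<partial>lborel)"
    using A f by (intro sum.cong refl)
      (auto simp: nn_integral_arclength_singleton oriented_contour_smooth_arc)
  finally show ?thesis .
qed

subsection \<open>Nontangential limits at regular points\<close>

lemma smooth_arc_vector_derivative:
  assumes "smooth_arc (I, \<gamma>)"
  obtains \<gamma>' where "continuous_on I \<gamma>'"
    "\<And>t. t \<in> I \<Longrightarrow> (\<gamma> has_vector_derivative \<gamma>' t) (at t within I)"
    "\<And>t. t \<in> I \<Longrightarrow> norm (\<gamma>' t) = 1"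
    "\<And>t. t \<in> interior I \<Longrightarrow> vector_derivative \<gamma> (at t within I) = \<gamma>' t"
proof -
  from assms obtain \<gamma>' where *: "continuous_on I \<gamma>'"
    "\<And>t. t \<in> I \<Longrightarrow> (\<gamma> has_vector_derivative \<gamma>' t) (at t within I)"
    "\<And>t. t \<in> I \<Longrightarrow> norm (\<gamma>' t) = 1"
    by (rule smooth_arcE) (rule that)
  have "vector_derivative \<gamma> (at t within I) = \<gamma>' t" if "t \<in> interior I" for t
  proof -
    have "at t within I = at t" using that by (rule at_within_interior)
    moreover have "t \<in> I" using that interior_subset by blast
    ultimately show ?thesis using *(2)[of t] by (simp add: vector_derivative_at)
  qed
  with * show ?thesis using that by blast
qed

text \<open>Arc and parameter are arguments, not just the point, because they survive the passage to
  a subcontour that contains the arc. Lying on a subcontour then becomes membership of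
  \<open>(I, \<gamma>)\<close> in it, and the tangent can be computed from the one arc.\<close>

definition regular_point :: "oriented_arc set \<Rightarrow> real set \<Rightarrow> (real \<Rightarrow> complex) \<Rightarrow> real \<Rightarrow> bool" where
  "regular_point A I \<gamma> t \<longleftrightarrow> oriented_contour A \<and> (I, \<gamma>) \<in> A \<and> t \<in> interior I \<and>
     (\<forall>b\<in>A. b \<noteq> (I, \<gamma>) \<longrightarrow> \<gamma> t \<notin> arc_trace b)"

lemma regular_point_subset:
  "regular_point A I \<gamma> t \<Longrightarrow> B \<subseteq> A \<Longrightarrow> (I, \<gamma>) \<in> B \<Longrightarrow> regular_point B I \<gamma> t"
  unfolding regular_point_def using oriented_contour_subset by blast

text \<open>A point on two different arcs is an endpoint of both, and the endpoints form a null
  set.\<close>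

lemma AE_regular_point:
  assumes A: "oriented_contour A"
  shows "AE k in arclength A. \<exists>I \<gamma> t. regular_point A I \<gamma> t \<and> k = \<gamma> t"
  using AE_arclength_regular[OF A]
proof eventually_elim
  case (elim k)
  then obtain I \<gamma> t where a: "(I, \<gamma>) \<in> A" and t: "t \<in> I" "k = \<gamma> t"
    by (auto simp: contour_def arc_trace_def)
  have "closed I" using oriented_contour_smooth_arc[OF A a] by (auto elim: smooth_arcE)
  moreover have "\<gamma> t \<notin> \<gamma> ` frontier I"
    using elim a t(2) by (force simp: arc_endpoints_def)
  ultimately have ti: "t \<in> interior I"
    using t(1) by (auto simp: frontier_def)
  have "\<gamma> t \<notin> arc_trace b" if b: "b \<in> A" "b \<noteq> (I, \<gamma>)" for b
  proof
    assume "\<gamma> t \<in> arc_trace b"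
    then have "\<gamma> t \<in> arc_trace b \<inter> arc_trace (I, \<gamma>)" using t by (auto simp: arc_trace_def)
    then have "\<gamma> t \<in> arc_endpoints b"
      using A a b unfolding oriented_contour_def by (metis IntD1 subsetD)
    then show False using elim b(1) t(2) by simp
  qed
  then have "regular_point A I \<gamma> t"
    using A a ti by (auto simp: regular_point_def)
  then show ?case using t(2) by blast
qed

text \<open>The right-hand side does not mention \<open>A\<close>. Hence a contour and its
  subcontours have the same tangent, and the same cones, at a common regular point.\<close>

lemma tangent_eq:
  assumes "regular_point A I \<gamma> t"
  shows "tangent A (\<gamma> t) = vector_derivative \<gamma> (at t within I)"
proof -
  from assms have A: "oriented_contour A" and a: "(I, \<gamma>) \<in> A" and t: "t \<in> interior I"
    and other: "\<And>b. b \<in> A \<Longrightarrow> b \<noteq> (I, \<gamma>) \<Longrightarrow> \<gamma> t \<notin> arc_trace b"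
    by (auto simp: regular_point_def)
  define g where "g = (\<lambda>(I, \<gamma>'). if \<gamma> t \<in> \<gamma>' ` interior I
    then vector_derivative \<gamma>' (at (inv_into I \<gamma>' (\<gamma> t)) within I) else (0 :: complex))"
  have fin: "finite A" using A by (simp add: oriented_contour_def)
  have inj: "inj_on \<gamma> I" using smooth_arc_inj_on oriented_contour_smooth_arc[OF A a] by blast
  have tI: "t \<in> I" using t interior_subset by blast
  have "g b = 0" if "b \<in> A - {(I, \<gamma>)}" for b
    using other[of b] that interior_subset
    by (auto simp: g_def arc_trace_def split: prod.splits)
  then have "sum g A = g (I, \<gamma>)"
    using fin a by (simp add: sum.remove)
  also have "\<dots> = vector_derivative \<gamma> (at t within I)"
    using t inj tI by (simp add: g_def)
  finally show ?thesis unfolding tangent_def g_def .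
qed

text \<open>On each arc the tangent is the continuous derivative composed with the Lipschitz inverse
  of the parametrization, hence continuous on the image of the interior. That image is a difference
  of two closed sets, and outside it the summand is 0.\<close>

lemma borel_measurable_tangent:
  assumes A: "oriented_contour A"
  shows "tangent A \<in> borel_measurable borel"
proof -
  have "(\<lambda>k. if k \<in> \<gamma> ` interior I then vector_derivative \<gamma> (at (inv_into I \<gamma> k) within I) else 0)
      \<in> borel_measurable borel" if a: "(I, \<gamma>) \<in> A" for I \<gamma>
  proof -
    have sm: "smooth_arc (I, \<gamma>)" using oriented_contour_smooth_arc[OF A a] .
    then obtain \<gamma>' where \<gamma>': "continuous_on I \<gamma>'"
      "\<And>t. t \<in> interior I \<Longrightarrow> vector_derivative \<gamma> (at t within I) = \<gamma>' t"
      by (rule smooth_arc_vector_derivative) (rule that)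
    from sm have I: "closed I" by (auto elim: smooth_arcE)
    have inj: "inj_on \<gamma> I" using smooth_arc_inj_on[OF sm] .
    have "\<gamma> ` interior I = \<gamma> ` I - \<gamma> ` frontier I"
      using inj_on_image_set_diff[OF inj, of I "frontier I"] frontier_subset_closed[OF I] I
      by (simp add: frontier_def Diff_Diff_Int double_diff interior_subset Int_absorb1)
    moreover have "closed (\<gamma> ` I)" "closed (\<gamma> ` frontier I)"
      using closed_smooth_arc_image[OF sm] I frontier_subset_closed by auto
    ultimately have m: "\<gamma> ` interior I \<in> sets borel" by auto
    have inv: "continuous_on (\<gamma> ` I) (inv_into I \<gamma>)"
    proof -
      from sm obtain c where c: "0 < c"
        "\<And>t u. t \<in> I \<Longrightarrow> u \<in> I \<Longrightarrow> c * \<bar>t - u\<bar> \<le> dist (\<gamma> t) (\<gamma> u)"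
        by (rule smooth_arcE) (rule that)
      have "(1 / c)-lipschitz_on (\<gamma> ` I) (inv_into I \<gamma>)"
      proof (rule lipschitz_onI)
        fix x y assume "x \<in> \<gamma> ` I" "y \<in> \<gamma> ` I"
        then obtain t u where tu: "t \<in> I" "x = \<gamma> t" "u \<in> I" "y = \<gamma> u" by blast
        then show "dist (inv_into I \<gamma> x) (inv_into I \<gamma> y) \<le> 1 / c * dist x y"
          using c(1) c(2)[of t u] inj by (simp add: dist_real_def pos_le_divide_eq mult.commute)
      qed (use c(1) in simp)
      then show ?thesis by (rule lipschitz_on_continuous_on)
    qed
    have "continuous_on (\<gamma> ` I) (\<lambda>k. \<gamma>' (inv_into I \<gamma> k))"
      by (rule continuous_on_compose2[OF \<gamma>'(1) inv]) (auto intro: inv_into_into)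
    then have "continuous_on (\<gamma> ` interior I) (\<lambda>k. \<gamma>' (inv_into I \<gamma> k))"
      by (rule continuous_on_subset) (simp add: image_mono interior_subset)
    moreover have "\<gamma>' (inv_into I \<gamma> k) = vector_derivative \<gamma> (at (inv_into I \<gamma> k) within I)"
      if k: "k \<in> \<gamma> ` interior I" for k
    proof -
      obtain t where t: "t \<in> interior I" "k = \<gamma> t" using k by blast
      moreover have "t \<in> I" using t(1) interior_subset by blast
      ultimately have "inv_into I \<gamma> k = t" using inj by simp
      then show ?thesis using \<gamma>'(2)[OF t(1)] by simp
    qed
    ultimately have c:
      "continuous_on (\<gamma> ` interior I) (\<lambda>k. vector_derivative \<gamma> (at (inv_into I \<gamma> k) within I))"
      by (rule continuous_on_eq)
    then show ?thesis
      by (rule borel_measurable_continuous_on_if[OF m _ continuous_on_const])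
  qed
  then show ?thesis
    unfolding tangent_def by (intro borel_measurable_sum) (auto split: prod.split)
qed

lemma regular_point_has_tangent:
  assumes "regular_point A I \<gamma> t"
  shows "(\<gamma> has_vector_derivative tangent A (\<gamma> t)) (at t)" and "norm (tangent A (\<gamma> t)) = 1"
proof -
  from assms have sm: "smooth_arc (I, \<gamma>)" and t: "t \<in> interior I"
    by (auto simp: regular_point_def oriented_contour_smooth_arc)
  from sm obtain \<gamma>' where \<gamma>':
    "\<And>t. t \<in> I \<Longrightarrow> (\<gamma> has_vector_derivative \<gamma>' t) (at t within I)"
    "\<And>t. t \<in> I \<Longrightarrow> norm (\<gamma>' t) = 1"
    "\<And>t. t \<in> interior I \<Longrightarrow> vector_derivative \<gamma> (at t within I) = \<gamma>' t"
    by (rule smooth_arc_vector_derivative) (rule that)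
  have "t \<in> I" using t interior_subset by blast
  moreover have "tangent A (\<gamma> t) = \<gamma>' t"
    using tangent_eq[OF assms] \<gamma>'(3)[OF t] by simp
  moreover have "at t within I = at t"
    using t by (rule at_within_interior)
  ultimately show "(\<gamma> has_vector_derivative tangent A (\<gamma> t)) (at t)" and "norm (tangent A (\<gamma> t)) = 1"
    using \<gamma>'(1,2)[of t] by metis+
qed

lemma AE_norm_tangent:
  assumes A: "oriented_contour A"
  shows "AE k in arclength A. norm (tangent A k) = 1"
  using AE_regular_point[OF A] by eventually_elim (use regular_point_has_tangent(2) in blast)

text \<open>The other arcs are closed and miss the point, hence a neighbourhood of it. If the normal
  point at height \<epsilon> were \<open>\<gamma> u\<close> on the same arc, chord-arc would give c
  |u - t| \<le> |\<epsilon>|, and differentiability would place \<open>\<gamma> u\<close> within c/2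
  |u - t| \<le> |\<epsilon>|/2 of the tangent line, whereas its height over that line is
  |\<epsilon>|.\<close>

lemma eventually_normal_not_in_contour:
  assumes "regular_point A I \<gamma> t"
  shows "\<forall>\<^sub>F \<epsilon> in at (0::real). \<gamma> t + of_real \<epsilon> * (\<i> * tangent A (\<gamma> t)) \<notin> contour A"
proof -
  let ?\<tau> = "tangent A (\<gamma> t)" and ?z = "\<lambda>\<epsilon>::real. \<gamma> t + of_real \<epsilon> * (\<i> * tangent A (\<gamma> t))"
  from assms have A: "oriented_contour A" and a: "(I, \<gamma>) \<in> A" and t: "t \<in> interior I"
    and other: "\<And>b. b \<in> A \<Longrightarrow> b \<noteq> (I, \<gamma>) \<Longrightarrow> \<gamma> t \<notin> arc_trace b"
    by (auto simp: regular_point_def)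
  have sm: "smooth_arc (I, \<gamma>)" using oriented_contour_smooth_arc[OF A a] .
  have lim: "(?z \<longlongrightarrow> \<gamma> t) (at 0)" by (auto intro!: tendsto_eq_intros)
  have 1: "\<forall>\<^sub>F \<epsilon> in at 0. ?z \<epsilon> \<notin> arc_trace b" if b: "b \<in> A" "b \<noteq> (I, \<gamma>)" for b
  proof -
    have "open (- arc_trace b)"
      using closed_arc_trace oriented_contour_smooth_arc[OF A b(1)] by blast
    then show ?thesis using topological_tendstoD[OF lim] other[OF b] by fastforce
  qed
  have 2: "\<forall>\<^sub>F \<epsilon> in at 0. ?z \<epsilon> \<notin> arc_trace (I, \<gamma>)"
  proof -
    from sm obtain c where c: "0 < c"
      "\<And>t u. t \<in> I \<Longrightarrow> u \<in> I \<Longrightarrow> c * \<bar>t - u\<bar> \<le> dist (\<gamma> t) (\<gamma> u)"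
      by (rule smooth_arcE) (rule that)
    have tI: "t \<in> I" using t interior_subset by blast
    have "(\<gamma> has_derivative (\<lambda>h. h *\<^sub>R ?\<tau>)) (at t)"
      using regular_point_has_tangent(1)[OF assms] by (simp add: has_vector_derivative_def)
    from this[unfolded has_derivative_at_alt] c(1)
    obtain d where d: "0 < d" "\<And>u. norm (u - t) < d \<Longrightarrow>
        norm (\<gamma> u - \<gamma> t - (u - t) *\<^sub>R ?\<tau>) \<le> c / 2 * norm (u - t)"
      by (meson half_gt_zero)
    have "\<forall>\<^sub>F \<epsilon> in at (0::real). \<bar>\<epsilon>\<bar> < c * d \<and> \<epsilon> \<noteq> 0"
      unfolding eventually_at using c(1) d(1) by (intro exI[of _ "c * d"]) (simp add: dist_real_def)
    then show ?thesis
    proof eventually_elim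
      case (elim \<epsilon>)
      show ?case
      proof
        assume "?z \<epsilon> \<in> arc_trace (I, \<gamma>)"
        then obtain u where u: "u \<in> I" "?z \<epsilon> = \<gamma> u" by (auto simp: arc_trace_def)
        have nt: "norm ?\<tau> = 1" using regular_point_has_tangent(2)[OF assms] .
        have "dist (\<gamma> u) (\<gamma> t) = \<bar>\<epsilon>\<bar>"
          unfolding u(2)[symmetric] dist_norm by (simp add: norm_mult nt)
        then have le: "c * \<bar>u - t\<bar> \<le> \<bar>\<epsilon>\<bar>" using c(2)[OF u(1) tI] by simp
        then have "c * \<bar>u - t\<bar> < c * d" using elim by linarith
        then have "\<bar>u - t\<bar> < d" using c(1) by simp
        then have "norm (\<gamma> u - \<gamma> t - (u - t) *\<^sub>R ?\<tau>) \<le> c / 2 * \<bar>u - t\<bar>"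
          using d(2)[of u] by simp
        \<comment> \<open>In the frame of the tangent the deviation has tangential component t - u
          and normal component \<epsilon>; the latter alone contradicts the bound.\<close>
        also have "\<gamma> u - \<gamma> t - (u - t) *\<^sub>R ?\<tau> = Complex (t - u) \<epsilon> * ?\<tau>"
          unfolding u(2)[symmetric] by (simp add: complex_eq_iff algebra_simps)
        finally have "norm (Complex (t - u) \<epsilon>) \<le> c / 2 * \<bar>u - t\<bar>"
          by (simp add: norm_mult nt)
        moreover have "\<bar>\<epsilon>\<bar> \<le> norm (Complex (t - u) \<epsilon>)"
          using abs_Im_le_cmod[of "Complex (t - u) \<epsilon>"] by simp
        ultimately show False using le elim by linarith
      qed
    qed
  qed
  have "\<forall>\<^sub>F \<epsilon> in at 0. \<forall>b\<in>A. ?z \<epsilon> \<notin> arc_trace b"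
    using A 1 2 by (intro eventually_ball_finite) (auto simp: oriented_contour_def)
  then show ?thesis by eventually_elim (auto simp: contour_def)
qed

text \<open>\<open>Lim\<close> determines a boundary value only along a nontrivial filter. Points on
  the normal lie in every cone because \<delta> < 1; the sign \<open>s\<close> treats the left and
  the right side at once.\<close>

lemma islimpt_cone:
  assumes "regular_point A I \<gamma> t" and \<delta>: "0 < \<delta>" "\<delta> < 1" and s: "s = 1 \<or> s = -1"
  shows "\<gamma> t islimpt {z. z \<notin> contour A \<and>
    \<delta> * norm (z - \<gamma> t) < s * Im ((z - \<gamma> t) * cnj (tangent A (\<gamma> t)))}"
  unfolding islimpt_approachable
proof (intro allI impI)
  fix e :: real assume "0 < e"
  let ?\<tau> = "tangent A (\<gamma> t)"
  have nt: "norm ?\<tau> = 1" using regular_point_has_tangent(2)[OF assms(1)] .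
  have "\<forall>\<^sub>F \<epsilon> in at (0::real). \<bar>\<epsilon>\<bar> < e \<and> \<gamma> t + of_real \<epsilon> * (\<i> * ?\<tau>) \<notin> contour A"
    using eventually_normal_not_in_contour[OF assms(1)] \<open>0 < e\<close>
    by (intro eventually_conj) (auto simp: eventually_at dist_real_def)
  then obtain d where d: "0 < d" "\<And>\<epsilon>. \<epsilon> \<noteq> 0 \<Longrightarrow> \<bar>\<epsilon>\<bar> < d \<Longrightarrow>
      \<bar>\<epsilon>\<bar> < e \<and> \<gamma> t + of_real \<epsilon> * (\<i> * ?\<tau>) \<notin> contour A"
    unfolding eventually_at by (auto simp: dist_real_def)
  \<comment> \<open>Half of \<open>d\<close> keeps the point within reach of \<open>d(2)\<close>.
    Its signed height times \<open>s\<close> equals its distance from \<open>\<gamma> t\<close>,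
    which is what the cone condition needs.\<close>
  define z where "z = \<gamma> t + of_real (s * d / 2) * (\<i> * ?\<tau>)"
  have z: "z \<notin> contour A" "\<bar>s * d / 2\<bar> < e"
    using d(2)[of "s * d / 2"] d(1) s unfolding z_def by auto
  have zk: "z - \<gamma> t = of_real (s * d / 2) * (\<i> * ?\<tau>)" by (simp add: z_def)
  have norm_z: "norm (z - \<gamma> t) = d / 2"
    unfolding zk using s d(1) nt by (auto simp: norm_mult)
  have Im_z: "Im ((z - \<gamma> t) * cnj ?\<tau>) = s * d / 2"
  proof -
    have "(z - \<gamma> t) * cnj ?\<tau> = of_real (s * d / 2) * \<i> * (?\<tau> * cnj ?\<tau>)"
      unfolding zk by (simp only: mult.assoc)
    also have "?\<tau> * cnj ?\<tau> = 1" using nt by (simp add: complex_norm_square[symmetric])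
    also have "Im (of_real (s * d / 2) * \<i> * 1) = s * d / 2" by simp
    finally show ?thesis .
  qed
  have cone: "\<delta> * norm (z - \<gamma> t) < s * Im ((z - \<gamma> t) * cnj ?\<tau>)"
    unfolding norm_z Im_z using s \<delta> d(1) by auto
  have near: "z \<noteq> \<gamma> t" "dist z (\<gamma> t) < e"
    using norm_z z(2) s d(1) by (auto simp: dist_norm)
  show "\<exists>x'\<in>{z. z \<notin> contour A \<and> \<delta> * norm (z - \<gamma> t) < s * Im ((z - \<gamma> t) * cnj ?\<tau>)}.
      x' \<noteq> \<gamma> t \<and> dist x' (\<gamma> t) < e"
    by (rule bexI[of _ z], rule conjI[OF near], rule CollectI, rule conjI[OF z(1) cone])
qed

lemma neq_bot_mono: "F \<le> G \<Longrightarrow> F \<noteq> bot \<Longrightarrow> G \<noteq> (bot :: 'a filter)"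
  by (auto simp: le_bot)

text \<open>The filter is a supremum over all apertures, so one nontrivial cone suffices; the
  aperture 1/2 is arbitrary.\<close>

lemma nt_left_neq_bot:
  assumes "regular_point A I \<gamma> t" shows "nt_left A (\<gamma> t) \<noteq> bot"
proof -
  have "at (\<gamma> t) within {z. z \<notin> contour A \<and>
      1/2 * norm (z - \<gamma> t) < Im ((z - \<gamma> t) * cnj (tangent A (\<gamma> t)))} \<le> nt_left A (\<gamma> t)"
    unfolding nt_left_def by (rule SUP_upper) simp
  moreover have "at (\<gamma> t) within {z. z \<notin> contour A \<and>
      1/2 * norm (z - \<gamma> t) < Im ((z - \<gamma> t) * cnj (tangent A (\<gamma> t)))} \<noteq> bot"
    using islimpt_cone[OF assms, of "1/2" 1] by (simp add: trivial_limit_within)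
  ultimately show ?thesis by (rule neq_bot_mono)
qed

lemma nt_right_neq_bot:
  assumes "regular_point A I \<gamma> t" shows "nt_right A (\<gamma> t) \<noteq> bot"
proof -
  have "at (\<gamma> t) within {z. z \<notin> contour A \<and>
      1/2 * norm (z - \<gamma> t) < - Im ((z - \<gamma> t) * cnj (tangent A (\<gamma> t)))} \<le> nt_right A (\<gamma> t)"
    unfolding nt_right_def by (rule SUP_upper) simp
  moreover have "at (\<gamma> t) within {z. z \<notin> contour A \<and>
      1/2 * norm (z - \<gamma> t) < - Im ((z - \<gamma> t) * cnj (tangent A (\<gamma> t)))} \<noteq> bot"
    using islimpt_cone[OF assms, of "1/2" "-1"] by (simp add: trivial_limit_within)
  ultimately show ?thesis by (rule neq_bot_mono)
qed

lemma nt_left_le_at: "nt_left A k \<le> at k"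
  and nt_right_le_at: "nt_right A k \<le> at k"
  unfolding nt_left_def nt_right_def by (auto intro!: SUP_least at_le)

lemma eventually_nt_left: "\<forall>\<^sub>F z in nt_left A k. z \<notin> contour A"
  and eventually_nt_right: "\<forall>\<^sub>F z in nt_right A k. z \<notin> contour A"
  unfolding nt_left_def nt_right_def by (auto simp: eventually_Sup eventually_at_filter)

text \<open>Removing the larger contour shrinks the approach regions, so limits relative to
  \<open>B\<close> are inherited by \<open>A\<close>, and not conversely.\<close>

lemma nt_left_subset:
  assumes "B \<subseteq> A" "tangent A k = tangent B k"
  shows "nt_left A k \<le> nt_left B k"
  unfolding nt_left_def assms(2)
proof (rule SUP_subset_mono[OF order_refl], rule at_le, rule Collect_mono, rule impI, elim conjE, rule conjI)
  show "z \<notin> contour B" if "z \<notin> contour A" for z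
    using that contour_mono[OF assms(1)] by blast
qed

lemma nt_right_subset:
  assumes "B \<subseteq> A" "tangent A k = tangent B k"
  shows "nt_right A k \<le> nt_right B k"
  unfolding nt_right_def assms(2)
proof (rule SUP_subset_mono[OF order_refl], rule at_le, rule Collect_mono, rule impI, elim conjE, rule conjI)
  show "z \<notin> contour B" if "z \<notin> contour A" for z
    using that contour_mono[OF assms(1)] by blast
qed

lemma bdry_plus_eqI:
  assumes "regular_point A I \<gamma> t" "(Y \<longlongrightarrow> L) (nt_left A (\<gamma> t))"
  shows "bdry_plus A Y (\<gamma> t) = L"
  unfolding bdry_plus_def using assms nt_left_neq_bot by (blast intro: tendsto_Lim)

lemma bdry_minus_eqI:
  assumes "regular_point A I \<gamma> t" "(Y \<longlongrightarrow> L) (nt_right A (\<gamma> t))"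
  shows "bdry_minus A Y (\<gamma> t) = L"
  unfolding bdry_minus_def using assms nt_right_neq_bot by (blast intro: tendsto_Lim)

lemma has_bdry_values_tendsto:
  assumes "regular_point A I \<gamma> t" "has_bdry_values A Y (\<gamma> t)"
  shows "(Y \<longlongrightarrow> bdry_plus A Y (\<gamma> t)) (nt_left A (\<gamma> t))"
    and "(Y \<longlongrightarrow> bdry_minus A Y (\<gamma> t)) (nt_right A (\<gamma> t))"
  using assms bdry_plus_eqI bdry_minus_eqI unfolding has_bdry_values_def by metis+

text \<open>The model solution has its limits relative to \<open>Amod\<close>, the exact one
  relative to \<open>A\<close>. Here both are brought to the filters of \<open>A\<close>, where they
  can be multiplied.\<close>

lemma has_bdry_values_tendsto_subset:
  assumes reg: "regular_point A I \<gamma> t" and B: "B \<subseteq> A" "(I, \<gamma>) \<in> B"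
    and Y: "has_bdry_values B Y (\<gamma> t)"
  shows "(Y \<longlongrightarrow> bdry_plus B Y (\<gamma> t)) (nt_left A (\<gamma> t))"
    and "(Y \<longlongrightarrow> bdry_minus B Y (\<gamma> t)) (nt_right A (\<gamma> t))"
proof -
  have regB: "regular_point B I \<gamma> t" using regular_point_subset[OF reg B] .
  have "tangent A (\<gamma> t) = tangent B (\<gamma> t)" using tangent_eq[OF reg] tangent_eq[OF regB] by simp
  then show "(Y \<longlongrightarrow> bdry_plus B Y (\<gamma> t)) (nt_left A (\<gamma> t))"
    and "(Y \<longlongrightarrow> bdry_minus B Y (\<gamma> t)) (nt_right A (\<gamma> t))"
    using has_bdry_values_tendsto[OF regB Y] nt_left_subset nt_right_subset B(1) tendsto_mono
    by metis+
qed

subsection \<open>Matrix-valued boundary values\<close>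

lemma bounded_bilinear_matrix_mult:
  "bounded_bilinear ((**) :: complex^'n^'m \<Rightarrow> complex^'p^'n \<Rightarrow> complex^'p^'m)"
proof -
  have "bilinear ((**) :: complex^'n^'m \<Rightarrow> complex^'p^'n \<Rightarrow> complex^'p^'m)"
    unfolding bilinear_def
    by (auto intro!: linearI simp: vec_eq_iff matrix_matrix_mult_def scaleR_sum_right
        sum.distrib distrib_left distrib_right)
  then show ?thesis by (simp add: bilinear_conv_bounded_bilinear)
qed

lemmas tendsto_matrix_mult = bounded_bilinear.tendsto[OF bounded_bilinear_matrix_mult]

lemmas matrix_diff_ldistrib = bounded_bilinear.diff_right[OF bounded_bilinear_matrix_mult]
lemmas matrix_diff_rdistrib = bounded_bilinear.diff_left[OF bounded_bilinear_matrix_mult]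

lemma norm_matrix_mult_le:
  obtains \<mu> where "0 < \<mu>"
    "\<And>(P :: complex^'n^'m) (Q :: complex^'p^'n). norm (P ** Q) \<le> \<mu> * norm P * norm Q"
proof -
  obtain \<mu> where "0 < \<mu>"
    "\<And>(P :: complex^'n^'m) (Q :: complex^'p^'n). norm (P ** Q) \<le> norm P * norm Q * \<mu>"
    using bounded_bilinear.pos_bounded[OF bounded_bilinear_matrix_mult] by metis
  then show ?thesis using that[of \<mu>] by (simp add: mult.commute mult.left_commute)
qed

lemma tendsto_det:
  fixes f :: "'a \<Rightarrow> complex^'m^'m"
  assumes "(f \<longlongrightarrow> L) F"
  shows "((\<lambda>x. det (f x)) \<longlongrightarrow> det L) F"
  unfolding det_def
  by (intro tendsto_sum tendsto_mult tendsto_const tendsto_prod tendsto_vec_nth assms)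

lemma
  fixes P :: "complex^'m^'m"
  assumes "det P = 1"
  shows matrix_inv_left_det1: "matrix_inv P ** P = mat 1"
    and matrix_inv_right_det1: "P ** matrix_inv P = mat 1"
proof -
  have "\<exists>Q. P ** Q = mat 1 \<and> Q ** P = mat 1"
    using assms invertible_det_nz[of P] by (simp add: invertible_def)
  then have "P ** matrix_inv P = mat 1 \<and> matrix_inv P ** P = mat 1"
    unfolding matrix_inv_def by (rule someI_ex)
  then show "matrix_inv P ** P = mat 1" "P ** matrix_inv P = mat 1" by blast+
qed

text \<open>The determinant passes to the limit, so L is invertible. Convergence of the inverses
  follows from the identity N^(-1) - L^(-1) = N^(-1) (L - N) L^(-1), in which the first factor stays
  bounded.\<close>

lemma tendsto_matrix_inv_det1:
  fixes N :: "'a \<Rightarrow> complex^'m^'m"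
  assumes F: "F \<noteq> bot" and N: "(N \<longlongrightarrow> L) F" and det: "\<forall>\<^sub>F z in F. det (N z) = 1"
    and bdd: "\<forall>\<^sub>F z in F. norm (matrix_inv (N z)) \<le> B"
  shows "det L = 1" and "((\<lambda>z. matrix_inv (N z)) \<longlongrightarrow> matrix_inv L) F"
proof -
  have "((\<lambda>z. 1) \<longlongrightarrow> det L) F"
    using tendsto_det[OF N] det by (auto elim: Lim_transform_eventually)
  then show L: "det L = 1" using F tendsto_unique tendsto_const by metis
  obtain \<mu> where \<mu>: "0 < \<mu>"
    "\<And>(P :: complex^'m^'m) (Q :: complex^'m^'m). norm (P ** Q) \<le> \<mu> * norm P * norm Q"
    by (rule norm_matrix_mult_le) (rule that)
  have "\<forall>\<^sub>F z in F. norm (matrix_inv (N z) - matrix_inv L)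
      \<le> \<mu> * (\<mu> * B * norm (L - N z)) * norm (matrix_inv L)"
    using det bdd
  proof eventually_elim
    case (elim z)
    have "matrix_inv (N z) - matrix_inv L
        = matrix_inv (N z) ** (L - N z) ** matrix_inv L"
      by (simp add: matrix_diff_ldistrib matrix_diff_rdistrib
          matrix_inv_left_det1[OF elim(1)] matrix_inv_right_det1[OF L]
          flip: matrix_mul_assoc)
    also have "norm \<dots> \<le> \<mu> * (\<mu> * norm (matrix_inv (N z)) * norm (L - N z)) * norm (matrix_inv L)"
      using \<mu>(2)[of "matrix_inv (N z) ** (L - N z)" "matrix_inv L"]
        \<mu>(2)[of "matrix_inv (N z)" "L - N z"] \<mu>(1)
      by (meson mult_left_mono mult_right_mono norm_ge_zero order.trans less_imp_le)
    also have "\<dots> \<le> \<mu> * (\<mu> * B * norm (L - N z)) * norm (matrix_inv L)"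
      using \<mu>(1) elim(2) by (intro mult_left_mono mult_right_mono) auto
    finally show ?case .
  qed
  moreover have "((\<lambda>z. \<mu> * (\<mu> * B * norm (L - N z)) * norm (matrix_inv L))
      \<longlongrightarrow> \<mu> * (\<mu> * B * norm (L - L)) * norm (matrix_inv L)) F"
    by (intro tendsto_intros N)
  then have "((\<lambda>z. \<mu> * (\<mu> * B * norm (L - N z)) * norm (matrix_inv L)) \<longlongrightarrow> 0) F"
    by simp
  ultimately have "((\<lambda>z. matrix_inv (N z) - matrix_inv L) \<longlongrightarrow> 0) F"
    by (rule Lim_null_comparison)
  then show "((\<lambda>z. matrix_inv (N z)) \<longlongrightarrow> matrix_inv L) F"
    by (subst Lim_null)
qed

text \<open>The one-sided limits of N enter as arbitrary matrices \<open>Lp\<close> and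
  \<open>Lm\<close>, so that the result covers both the model contour, where they differ by a jump,
  and the points where N is continuous and they coincide.\<close>

lemma bdry_quotient:
  fixes S N :: "complex \<Rightarrow> complex^'m^'m"
  assumes reg: "regular_point A I \<gamma> t" and S: "has_bdry_values A S (\<gamma> t)"
    and B: "B \<subseteq> A"
    and lim: "(N \<longlongrightarrow> Lp) (nt_left A (\<gamma> t))" "(N \<longlongrightarrow> Lm) (nt_right A (\<gamma> t))"
    and det: "\<forall>z. z \<notin> contour B \<longrightarrow> det (N z) = 1"
    and bdd: "\<forall>\<^sub>F z in at (\<gamma> t). z \<notin> contour B \<longrightarrow> norm (matrix_inv (N z)) \<le> b"
  shows "det Lp = 1" "det Lm = 1"
    "bdry_plus A (\<lambda>z. S z ** matrix_inv (N z)) (\<gamma> t) = bdry_plus A S (\<gamma> t) ** matrix_inv Lp"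
    "bdry_minus A (\<lambda>z. S z ** matrix_inv (N z)) (\<gamma> t) = bdry_minus A S (\<gamma> t) ** matrix_inv Lm"
proof -
  have *: "\<forall>\<^sub>F z in nt_left A (\<gamma> t). z \<notin> contour B" "\<forall>\<^sub>F z in nt_right A (\<gamma> t). z \<notin> contour B"
    using eventually_nt_left[of A "\<gamma> t"] eventually_nt_right[of A "\<gamma> t"] contour_mono[OF B]
    by (auto elim!: eventually_mono)
  have **: "\<forall>\<^sub>F z in nt_left A (\<gamma> t). norm (matrix_inv (N z)) \<le> b"
    "\<forall>\<^sub>F z in nt_right A (\<gamma> t). norm (matrix_inv (N z)) \<le> b"
    using eventually_mp[OF filter_leD[OF nt_left_le_at bdd] *(1)]
      eventually_mp[OF filter_leD[OF nt_right_le_at bdd] *(2)] .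
  have det': "\<forall>\<^sub>F z in nt_left A (\<gamma> t). det (N z) = 1"
    "\<forall>\<^sub>F z in nt_right A (\<gamma> t). det (N z) = 1"
    using * det by (auto elim!: eventually_mono)
  note l = tendsto_matrix_inv_det1[OF nt_left_neq_bot[OF reg] lim(1) det'(1) **(1)]
  note r = tendsto_matrix_inv_det1[OF nt_right_neq_bot[OF reg] lim(2) det'(2) **(2)]
  show "det Lp = 1" "det Lm = 1" using l(1) r(1) .
  show "bdry_plus A (\<lambda>z. S z ** matrix_inv (N z)) (\<gamma> t) = bdry_plus A S (\<gamma> t) ** matrix_inv Lp"
    by (rule bdry_plus_eqI[OF reg tendsto_matrix_mult[OF has_bdry_values_tendsto(1)[OF reg S] l(2)]])
  show "bdry_minus A (\<lambda>z. S z ** matrix_inv (N z)) (\<gamma> t) = bdry_minus A S (\<gamma> t) ** matrix_inv Lm"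
    by (rule bdry_minus_eqI[OF reg tendsto_matrix_mult[OF has_bdry_values_tendsto(2)[OF reg S] r(2)]])
qed

text \<open>With P = N_+ and Q = N_-, the relation P = Q v gives v P^(-1) = Q^(-1). Hence S_+ P^(-1)
  = S_- v P^(-1) = S_- Q^(-1): equal jumps cancel.\<close>

lemma quotient_jump_model:
  fixes S N :: "complex \<Rightarrow> complex^'m^'m"
  assumes reg: "regular_point A I \<gamma> t" and S: "has_bdry_values A S (\<gamma> t)"
    and B: "B \<subseteq> A" "(I, \<gamma>) \<in> B" and N: "has_bdry_values B N (\<gamma> t)"
    and det: "\<forall>z. z \<notin> contour B \<longrightarrow> det (N z) = 1"
    and bdd: "\<forall>\<^sub>F z in at (\<gamma> t). z \<notin> contour B \<longrightarrow> norm (matrix_inv (N z)) \<le> b"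
    and jump: "bdry_plus A S (\<gamma> t) = bdry_minus A S (\<gamma> t) ** v"
      "bdry_plus B N (\<gamma> t) = bdry_minus B N (\<gamma> t) ** v"
  shows "bdry_plus A (\<lambda>z. S z ** matrix_inv (N z)) (\<gamma> t)
    = bdry_minus A (\<lambda>z. S z ** matrix_inv (N z)) (\<gamma> t)"
proof -
  note q = bdry_quotient[OF reg S B(1) has_bdry_values_tendsto_subset[OF reg B N] det bdd]
  define P Q where "P = bdry_plus B N (\<gamma> t)" and "Q = bdry_minus B N (\<gamma> t)"
  have "v ** matrix_inv P = (matrix_inv Q ** Q) ** v ** matrix_inv P"
    using matrix_inv_left_det1[of Q] q(2) by (simp add: Q_def)
  also have "\<dots> = matrix_inv Q ** ((Q ** v) ** matrix_inv P)"
    by (simp add: matrix_mul_assoc)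
  also have "(Q ** v) ** matrix_inv P = mat 1"
    using matrix_inv_right_det1[of P] q(1) jump(2) by (simp add: P_def Q_def)
  finally have "v ** matrix_inv P = matrix_inv Q" by simp
  then show ?thesis
    unfolding q(3,4) jump(1) P_def Q_def by (simp flip: matrix_mul_assoc)
qed

text \<open>Replacing S_+ by S_- v leaves S_- as the only boundary value in the jump, and it is the
  one with a controlled norm.\<close>

lemma quotient_jump_continuous:
  fixes S N :: "complex \<Rightarrow> complex^'m^'m"
  assumes reg: "regular_point A I \<gamma> t" and S: "has_bdry_values A S (\<gamma> t)"
    and B: "B \<subseteq> A" and N: "isCont N (\<gamma> t)"
    and det: "\<forall>z. z \<notin> contour B \<longrightarrow> det (N z) = 1"
    and bdd: "\<forall>\<^sub>F z in at (\<gamma> t). z \<notin> contour B \<longrightarrow> norm (matrix_inv (N z)) \<le> b"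
    and jump: "bdry_plus A S (\<gamma> t) = bdry_minus A S (\<gamma> t) ** v"
  shows "bdry_plus A (\<lambda>z. S z ** matrix_inv (N z)) (\<gamma> t)
      - bdry_minus A (\<lambda>z. S z ** matrix_inv (N z)) (\<gamma> t)
    = bdry_minus A S (\<gamma> t) ** (v - mat 1) ** matrix_inv (N (\<gamma> t))"
proof -
  note lim = tendsto_mono[OF nt_left_le_at N[unfolded isCont_def]]
    tendsto_mono[OF nt_right_le_at N[unfolded isCont_def]]
  note q = bdry_quotient[OF reg S B lim det bdd]
  show ?thesis unfolding q(3,4) jump
    by (simp add: matrix_diff_ldistrib matrix_diff_rdistrib)
qed

text \<open>On the part of the model contour away from \<open>Aexp\<close> the matrices S and N are
  given only through their one-sided limits, while the error factor is continuous there. The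
  factorization then holds for each side separately.\<close>

lemma bdry_product:
  fixes S N E :: "complex \<Rightarrow> complex^'m^'m"
  assumes reg: "regular_point A I \<gamma> t"
    and B: "B \<subseteq> A" "(I, \<gamma>) \<in> B" and N: "has_bdry_values B N (\<gamma> t)"
    and E: "isCont E (\<gamma> t)" and S: "\<And>z. z \<notin> contour A \<Longrightarrow> S z = E z ** N z"
  shows "bdry_plus A S (\<gamma> t) = E (\<gamma> t) ** bdry_plus B N (\<gamma> t)"
    and "bdry_minus A S (\<gamma> t) = E (\<gamma> t) ** bdry_minus B N (\<gamma> t)"
proof -
  note limE = tendsto_mono[OF nt_left_le_at E[unfolded isCont_def]]
    tendsto_mono[OF nt_right_le_at E[unfolded isCont_def]]
  note limN = has_bdry_values_tendsto_subset[OF reg B N]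
  have "\<forall>\<^sub>F z in nt_left A (\<gamma> t). E z ** N z = S z" "\<forall>\<^sub>F z in nt_right A (\<gamma> t). E z ** N z = S z"
    using eventually_nt_left[of A "\<gamma> t"] eventually_nt_right[of A "\<gamma> t"] S
    by (auto elim!: eventually_mono)
  then show "bdry_plus A S (\<gamma> t) = E (\<gamma> t) ** bdry_plus B N (\<gamma> t)"
    and "bdry_minus A S (\<gamma> t) = E (\<gamma> t) ** bdry_minus B N (\<gamma> t)"
    using tendsto_matrix_mult[OF limE(1) limN(1)] tendsto_matrix_mult[OF limE(2) limN(2)]
    by (auto intro!: bdry_plus_eqI[OF reg] bdry_minus_eqI[OF reg] elim: Lim_transform_eventually)
qed

subsection \<open>Integrals along a contour\<close>

lemma nn_integral_even_finite:
  fixes h :: "real \<Rightarrow> real"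
  assumes \<alpha>: "\<alpha> < 1" and C: "0 \<le> C"
    and near: "\<And>v. 0 < v \<Longrightarrow> v \<le> 1 \<Longrightarrow> h v \<le> C * v powr - \<alpha>"
    and far: "\<And>v. 1 \<le> v \<Longrightarrow> h v \<le> C * v powr - 2"
  shows "(\<integral>\<^sup>+v. ennreal (h \<bar>v\<bar>) \<partial>lborel) < \<infinity>"
proof -
  define g where "g v = ennreal (v powr - \<alpha>) * indicator {0..1} v
    + ennreal (v powr - 2) * indicator {1..} v" for v :: real
  have m: "g \<in> borel_measurable borel" unfolding g_def by measurable
  have "(\<integral>\<^sup>+v. ennreal (v powr - \<alpha>) * indicator {0..1} v \<partial>lborel) < \<infinity>"
    using nn_integral_has_integral_lebesgue'[OF _ has_integral_powr_from_0[of "- \<alpha>" 1]] \<alpha> by simp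
  moreover have "(\<integral>\<^sup>+v. ennreal (v powr - 2) * indicator {1..} v \<partial>lborel) < \<infinity>"
    using nn_integral_has_integral_lebesgue'[OF _ has_integral_powr_to_inf[of "- 2" 1]] by simp
  ultimately have g: "(\<integral>\<^sup>+v. g v \<partial>lborel) < \<infinity>"
    unfolding g_def by (subst nn_integral_add) auto
  have g': "(\<integral>\<^sup>+v. g (- v) \<partial>lborel) = (\<integral>\<^sup>+v. g v \<partial>lborel)"
    using nn_integral_real_affine[OF m, of "- 1" 0] by simp
  have "AE v in lborel. v \<noteq> (0::real)" by (rule AE_lborel_singleton)
  \<comment> \<open>The majorant \<open>g\<close> lives on the half line v \<ge> 0, so the reflected
    copy is added for negative v. The origin is left out because the bound \<open>near\<close>
    starts at v > 0.\<close>
  then have "AE v in lborel. ennreal (h \<bar>v\<bar>) \<le> ennreal C * (g v + g (- v))"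
  proof eventually_elim
    case (elim v)
    have *: "ennreal (h u) \<le> ennreal C * g u" if "0 < u" for u
    proof (cases "u \<le> 1")
      case True
      have "ennreal (h u) \<le> ennreal (C * u powr - \<alpha>)" using near[OF that True] by (rule ennreal_leI)
      also have "\<dots> \<le> ennreal C * g u"
        using that True C by (auto simp: g_def ennreal_mult intro!: mult_left_mono)
      finally show ?thesis .
    next
      case False
      then have "ennreal (h u) \<le> ennreal (C * u powr - 2)" using far[of u] by (intro ennreal_leI) simp
      also have "\<dots> \<le> ennreal C * g u"
        using that False C by (auto simp: g_def ennreal_mult intro!: mult_left_mono)
      finally show ?thesis .
    qed
    have "ennreal (h \<bar>v\<bar>) \<le> ennreal C * g \<bar>v\<bar>" using *[of "\<bar>v\<bar>"] elim by simp
    also have "\<dots> \<le> ennreal C * (g v + g (- v))"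
      by (cases "0 \<le> v") (auto intro!: mult_left_mono)
    finally show ?case .
  qed
  then have "(\<integral>\<^sup>+v. ennreal (h \<bar>v\<bar>) \<partial>lborel) \<le> (\<integral>\<^sup>+v. ennreal C * (g v + g (- v)) \<partial>lborel)"
    by (rule nn_integral_mono_AE)
  also have "\<dots> = ennreal C * ((\<integral>\<^sup>+v. g v \<partial>lborel) + (\<integral>\<^sup>+v. g (- v) \<partial>lborel))"
    using m by (subst nn_integral_cmult, simp, subst nn_integral_add) auto
  also have "\<dots> < \<infinity>" unfolding g' using g by (simp add: ennreal_mult_less_top)
  finally show ?thesis .
qed

lemma power_over_fact_le_exp:
  fixes x :: real
  assumes "0 \<le> x" shows "x ^ m / fact m \<le> exp x"
proof -
  have "(\<Sum>n\<in>{m}. x ^ n /\<^sub>R fact n) \<le> (\<Sum>n. x ^ n /\<^sub>R fact n)"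
    using assms by (intro sum_le_suminf summable_exp_generic) auto
  then show ?thesis by (simp add: exp_def divide_inverse mult.commute)
qed

lemma nn_integral_exp_powr_finite:
  fixes \<alpha> b \<theta> :: real
  assumes \<alpha>: "0 \<le> \<alpha>" "\<alpha> < 1" and b: "0 < b" and \<theta>: "0 < \<theta>"
  shows "(\<integral>\<^sup>+v. ennreal (exp (- b * \<bar>v\<bar> powr \<theta>) * \<bar>v\<bar> powr - \<alpha>) \<partial>lborel) < \<infinity>"
proof -
  \<comment> \<open>With \<theta> m \<ge> 2 the m-th term of the series for exp(b v^\<theta>)
    already dominates v^2 on v \<ge> 1, up to the constant m!/b^m; the summand 1 in \<open>C\<close>
    serves the bound near 0.\<close>
  obtain m :: nat where m: "2 / \<theta> \<le> real m" using real_arch_simple by blast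
  define C where "C = 1 + fact m / b ^ m"
  have C: "1 \<le> C" using b by (simp add: C_def)
  show ?thesis
  proof (rule nn_integral_even_finite[OF \<alpha>(2), of C])
    show "0 \<le> C" using C by simp
    fix v :: real
    { assume v: "0 < v" "v \<le> 1"
      have "exp (- b * v powr \<theta>) * v powr - \<alpha> \<le> 1 * v powr - \<alpha>"
        using b v by (intro mult_right_mono) auto
      also have "\<dots> \<le> C * v powr - \<alpha>" using C by (intro mult_right_mono) auto
      finally show "exp (- b * v powr \<theta>) * v powr - \<alpha> \<le> C * v powr - \<alpha>" . }
    { assume v: "1 \<le> v"
      have y: "0 < b * v powr \<theta>" using b v by simp
      have "v powr 2 \<le> v powr (\<theta> * real m)"
        using v m \<theta> by (intro powr_mono) (auto simp: field_simps)
      also have "\<dots> = (v powr \<theta>) ^ m" using v by (simp add: powr_powr flip: powr_realpow)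
      finally have "b ^ m * v powr 2 / fact m \<le> (b * v powr \<theta>) ^ m / fact m"
        using b by (simp add: power_mult_distrib divide_right_mono mult_left_mono)
      also have "\<dots> \<le> exp (b * v powr \<theta>)"
        using power_over_fact_le_exp[of "b * v powr \<theta>" m] y by simp
      finally have "exp (- b * v powr \<theta>) \<le> fact m / b ^ m * v powr - 2"
        using b v by (simp add: exp_minus powr_minus field_simps)
      also have "\<dots> \<le> C * v powr - 2" by (intro mult_right_mono) (auto simp: C_def)
      finally have "exp (- b * v powr \<theta>) * v powr - \<alpha> \<le> C * v powr - 2 * 1"
        using v \<alpha> C by (intro mult_mono) (auto simp: powr_minus inverse_le_1_iff ge_one_powr_ge_zero)
      then show "exp (- b * v powr \<theta>) * v powr - \<alpha> \<le> C * v powr - 2" by simp }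
  qed
qed

text \<open>The substitution t = t0 + (y/c) v with y = x^(-1/\<theta>) turns x (c |t - t0|)^\<theta>
  into |v|^\<theta>. The singular factor contributes x^(\<alpha>/\<theta>) and the Jacobian
  x^(-1/\<theta>)/c, which together give the exponent -(1 - \<alpha>)/\<theta>.\<close>

lemma nn_integral_exp_powr_scale:
  fixes \<alpha> b \<theta> c x t0 :: real
  assumes x: "0 < x" and c: "0 < c" and \<theta>: "0 < \<theta>"
  shows "(\<integral>\<^sup>+t. ennreal (exp (- b * x * (c * \<bar>t - t0\<bar>) powr \<theta>) * (c * \<bar>t - t0\<bar>) powr - \<alpha>) \<partial>lborel)
    = ennreal (x powr - ((1 - \<alpha>) / \<theta>) / c)
      * (\<integral>\<^sup>+v. ennreal (exp (- b * \<bar>v\<bar> powr \<theta>) * \<bar>v\<bar> powr - \<alpha>) \<partial>lborel)"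
proof -
  let ?f = "\<lambda>t. ennreal (exp (- b * x * (c * \<bar>t - t0\<bar>) powr \<theta>) * (c * \<bar>t - t0\<bar>) powr - \<alpha>)"
  define y where "y = x powr - (1 / \<theta>)"
  have y: "0 < y" using x by (simp add: y_def)
  have "?f (t0 + y / c * v) = ennreal (x powr (\<alpha> / \<theta>))
      * ennreal (exp (- b * \<bar>v\<bar> powr \<theta>) * \<bar>v\<bar> powr - \<alpha>)" for v
  proof -
    have cv: "c * \<bar>t0 + y / c * v - t0\<bar> = y * \<bar>v\<bar>" using c y by (simp add: abs_mult)
    have "y powr \<theta> = x powr (- 1)" using \<theta> by (simp add: y_def powr_powr)
    also have "\<dots> = inverse x" using x by (simp add: powr_minus)
    finally have 1: "x * (y * \<bar>v\<bar>) powr \<theta> = \<bar>v\<bar> powr \<theta>"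
      using x y by (simp add: powr_mult)
    have "(y * \<bar>v\<bar>) powr - \<alpha> = x powr (\<alpha> / \<theta>) * \<bar>v\<bar> powr - \<alpha>"
      using x y by (simp add: powr_mult y_def powr_powr)
    then show ?thesis unfolding cv mult.assoc 1
      by (simp add: mult.left_commute flip: ennreal_mult)
  qed
  moreover have "(\<integral>\<^sup>+t. ?f t \<partial>lborel) = ennreal \<bar>y / c\<bar> * (\<integral>\<^sup>+v. ?f (t0 + y / c * v) \<partial>lborel)"
    using c y by (intro nn_integral_real_affine) auto
  ultimately have "(\<integral>\<^sup>+t. ?f t \<partial>lborel) = ennreal \<bar>y / c\<bar> * (ennreal (x powr (\<alpha> / \<theta>))
      * (\<integral>\<^sup>+v. ennreal (exp (- b * \<bar>v\<bar> powr \<theta>) * \<bar>v\<bar> powr - \<alpha>) \<partial>lborel))"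
    by (simp add: nn_integral_cmult)
  moreover have "\<bar>y / c\<bar> * x powr (\<alpha> / \<theta>) = x powr - ((1 - \<alpha>) / \<theta>) / c"
    using x c y by (simp add: y_def powr_add[symmetric] diff_divide_distrib)
  ultimately show ?thesis
    using c y by (simp add: mult.assoc[symmetric] ennreal_mult'[symmetric])
qed

text \<open>The point \<kappa> need not lie on this arc, so t0 is the parameter of a nearest point.
  Since |\<gamma> t0 - \<kappa>| \<le> |\<gamma> t - \<kappa>|, the triangle inequality costs a
  factor 2 in the chord-arc constant. With \<kappa> = 0 the same bound gives linear growth along
  unbounded arcs.\<close>

lemma chord_arc_from_point:
  assumes sm: "smooth_arc (I, \<gamma>)"
  obtains t0 c where "0 < c" "\<And>t. t \<in> I \<Longrightarrow> c * \<bar>t - t0\<bar> \<le> norm (\<gamma> t - \<kappa>)"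
proof -
  from sm obtain c where c: "0 < c"
    "\<And>t u. t \<in> I \<Longrightarrow> u \<in> I \<Longrightarrow> c * \<bar>t - u\<bar> \<le> dist (\<gamma> t) (\<gamma> u)"
    by (rule smooth_arcE) (rule that)
  from sm have "interior I \<noteq> {}" by (rule smooth_arcE)
  then have "arc_trace (I, \<gamma>) \<noteq> {}" using interior_subset by (auto simp: arc_trace_def)
  then obtain z where z: "z \<in> arc_trace (I, \<gamma>)"
    "\<And>y. y \<in> arc_trace (I, \<gamma>) \<Longrightarrow> dist \<kappa> z \<le> dist \<kappa> y"
    using distance_attains_inf[OF closed_arc_trace[OF sm], of \<kappa>] by auto
  from z(1) obtain t0 where "t0 \<in> I" "z = \<gamma> t0" by (auto simp: arc_trace_def)
  with z(2) have t0: "t0 \<in> I" "\<And>t. t \<in> I \<Longrightarrow> dist \<kappa> (\<gamma> t0) \<le> dist \<kappa> (\<gamma> t)"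
    by (simp_all add: arc_trace_def)
  show ?thesis
  proof (rule that[of "c / 2" t0])
    show "0 < c / 2" using c(1) by simp
    show "c / 2 * \<bar>t - t0\<bar> \<le> norm (\<gamma> t - \<kappa>)" if "t \<in> I" for t
      using c(2)[OF that t0(1)] t0(2)[OF that] dist_triangle[of "\<gamma> t" "\<gamma> t0" \<kappa>]
      by (simp add: dist_norm norm_minus_commute)
  qed
qed

lemma nn_integral_arclength_exp_powr_le:
  fixes \<alpha> b \<theta> :: real
  assumes A: "oriented_contour A" and \<alpha>: "0 \<le> \<alpha>" "\<alpha> < 1" and b: "0 < b" and \<theta>: "0 < \<theta>"
  obtains D where "0 \<le> D" "\<And>x::real. 0 < x \<Longrightarrow>
    (\<integral>\<^sup>+k. ennreal (exp (- b * x * norm (k - \<kappa>) powr \<theta>) * norm (k - \<kappa>) powr - \<alpha>) \<partial>arclength A)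
      \<le> ennreal (D * x powr - ((1 - \<alpha>) / \<theta>))"
proof -
  let ?\<phi> = "\<lambda>x u::real. exp (- b * x * u powr \<theta>) * u powr - \<alpha>"
  obtain M where M: "0 \<le> M" "(\<integral>\<^sup>+v. ennreal (exp (- b * \<bar>v\<bar> powr \<theta>) * \<bar>v\<bar> powr - \<alpha>) \<partial>lborel) = ennreal M"
    using nn_integral_exp_powr_finite[OF \<alpha> b \<theta>] by (auto simp: less_top_ennreal)
  have "\<exists>d. 0 \<le> d \<and> (\<forall>x>0. (case a of (I, \<gamma>) \<Rightarrow>
      \<integral>\<^sup>+t. ennreal (?\<phi> x (norm (\<gamma> t - \<kappa>))) * indicator I t \<partial>lborel) \<le> ennreal (d * x powr - ((1 - \<alpha>) / \<theta>)))"
    if a: "a \<in> A" for a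
  proof -
    obtain I \<gamma> where ag: "a = (I, \<gamma>)" by force
    have "smooth_arc (I, \<gamma>)" using oriented_contour_smooth_arc[OF A a] ag by simp
    then obtain t0 c where c: "0 < c" "\<And>t. t \<in> I \<Longrightarrow> c * \<bar>t - t0\<bar> \<le> norm (\<gamma> t - \<kappa>)"
      by (rule chord_arc_from_point) (rule that)
    have "(\<integral>\<^sup>+t. ennreal (?\<phi> x (norm (\<gamma> t - \<kappa>))) * indicator I t \<partial>lborel)
        \<le> ennreal (M / c * x powr - ((1 - \<alpha>) / \<theta>))" if x: "0 < x" for x
    proof -
      \<comment> \<open>At t = t0 the comparison can fail, because 0 raised by \<open>powr\<close>
        to any exponent is 0 and the right-hand integrand vanishes there.\<close>
      have "AE t in lborel. t \<noteq> t0" by (rule AE_lborel_singleton)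
      then have "(\<integral>\<^sup>+t. ennreal (?\<phi> x (norm (\<gamma> t - \<kappa>))) * indicator I t \<partial>lborel)
          \<le> (\<integral>\<^sup>+t. ennreal (?\<phi> x (c * \<bar>t - t0\<bar>)) \<partial>lborel)"
      proof (intro nn_integral_mono_AE, eventually_elim)
        case (elim t)
        have "?\<phi> x (norm (\<gamma> t - \<kappa>)) \<le> ?\<phi> x (c * \<bar>t - t0\<bar>)" if "t \<in> I"
        proof (intro mult_mono)
          have pos: "0 < c * \<bar>t - t0\<bar>" using c(1) elim by simp
          show "exp (- b * x * norm (\<gamma> t - \<kappa>) powr \<theta>) \<le> exp (- b * x * (c * \<bar>t - t0\<bar>) powr \<theta>)"
            using b x c(2)[OF that] pos \<theta> by (simp add: mult_left_mono powr_mono2)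
          show "norm (\<gamma> t - \<kappa>) powr - \<alpha> \<le> (c * \<bar>t - t0\<bar>) powr - \<alpha>"
            using c(2)[OF that] pos \<alpha> by (intro powr_mono2') auto
        qed auto
        then show ?case by (auto simp: indicator_def intro!: ennreal_leI)
      qed
      also have "\<dots> = ennreal (x powr - ((1 - \<alpha>) / \<theta>) / c) * ennreal M"
        unfolding nn_integral_exp_powr_scale[OF x c(1) \<theta>] M(2) ..
      also have "\<dots> = ennreal (M / c * x powr - ((1 - \<alpha>) / \<theta>))"
        using M(1) c(1) by (simp flip: ennreal_mult add: mult.commute)
      finally show ?thesis .
    qed
    then show ?thesis
      using M(1) c(1) ag by (intro exI[of _ "M / c"]) auto
  qed
  then have "\<forall>a\<in>A. \<exists>d. 0 \<le> d \<and> (\<forall>x>0. (case a of (I, \<gamma>) \<Rightarrow>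
      \<integral>\<^sup>+t. ennreal (?\<phi> x (norm (\<gamma> t - \<kappa>))) * indicator I t \<partial>lborel) \<le> ennreal (d * x powr - ((1 - \<alpha>) / \<theta>)))"
    by blast
  from bchoice[OF this] obtain d where d: "\<forall>a\<in>A. 0 \<le> d a \<and> (\<forall>x>0. (case a of (I, \<gamma>) \<Rightarrow>
      \<integral>\<^sup>+t. ennreal (?\<phi> x (norm (\<gamma> t - \<kappa>))) * indicator I t \<partial>lborel) \<le> ennreal (d a * x powr - ((1 - \<alpha>) / \<theta>)))"
    by blast
  show ?thesis
  proof (rule that[of "sum d A"])
    show "0 \<le> sum d A" using d by (intro sum_nonneg) blast
    fix x :: real assume x: "0 < x"
    have "(\<integral>\<^sup>+k. ennreal (?\<phi> x (norm (k - \<kappa>))) \<partial>arclength A)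
        \<le> (\<Sum>(I, \<gamma>)\<in>A. \<integral>\<^sup>+t. ennreal (?\<phi> x (norm (\<gamma> t - \<kappa>))) * indicator I t \<partial>lborel)"
      by (rule nn_integral_arclength_le[OF A]) measurable
    also have "\<dots> \<le> (\<Sum>a\<in>A. ennreal (d a * x powr - ((1 - \<alpha>) / \<theta>)))"
      by (rule sum_mono) (use d x in fastforce)
    also have "\<dots> = ennreal (sum d A * x powr - ((1 - \<alpha>) / \<theta>))"
      using d by (simp add: sum_distrib_right)
    finally show "(\<integral>\<^sup>+k. ennreal (?\<phi> x (norm (k - \<kappa>))) \<partial>arclength A)
      \<le> ennreal (sum d A * x powr - ((1 - \<alpha>) / \<theta>))" .
  qed
qed

text \<open>Chord-arc makes |\<gamma> t| grow at least linearly in the parameter, so each arc is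
  compared with the integral of (1 + |v|)^(-2) over the real line.\<close>

lemma nn_integral_arclength_inverse_square_finite:
  assumes A: "oriented_contour A"
  shows "(\<integral>\<^sup>+k. ennreal ((1 + norm k) powr - 2) \<partial>arclength A) < \<infinity>"
proof -
  have "(\<integral>\<^sup>+t. ennreal ((1 + norm (\<gamma> t)) powr - 2) * indicator I t \<partial>lborel) < \<infinity>"
    if a: "(I, \<gamma>) \<in> A" for I \<gamma>
  proof -
    have "smooth_arc (I, \<gamma>)" using oriented_contour_smooth_arc[OF A a] .
    then obtain t0 c where c: "0 < c" "\<And>t. t \<in> I \<Longrightarrow> c * \<bar>t - t0\<bar> \<le> norm (\<gamma> t - 0)"
      by (rule chord_arc_from_point) (rule that)
    have "(\<integral>\<^sup>+t. ennreal ((1 + norm (\<gamma> t)) powr - 2) * indicator I t \<partial>lborel)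
        \<le> (\<integral>\<^sup>+t. ennreal ((1 + c * \<bar>t - t0\<bar>) powr - 2) \<partial>lborel)"
    proof (rule nn_integral_mono)
      fix t
      show "ennreal ((1 + norm (\<gamma> t)) powr - 2) * indicator I t \<le> ennreal ((1 + c * \<bar>t - t0\<bar>) powr - 2)"
        using c(1) c(2)[of t] by (cases "t \<in> I") (auto intro!: ennreal_leI powr_mono2' add_pos_nonneg)
    qed
    also have "\<dots> = ennreal \<bar>1 / c\<bar> * (\<integral>\<^sup>+v. ennreal ((1 + c * \<bar>t0 + 1 / c * v - t0\<bar>) powr - 2) \<partial>lborel)"
      using c(1) by (intro nn_integral_real_affine) auto
    also have "(\<lambda>v. (1 + c * \<bar>t0 + 1 / c * v - t0\<bar>) powr - 2) = (\<lambda>v. (1 + \<bar>v\<bar>) powr - 2)"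
      using c(1) by (simp add: abs_mult)
    also have "ennreal \<bar>1 / c\<bar> * (\<integral>\<^sup>+v. ennreal ((1 + \<bar>v\<bar>) powr - 2) \<partial>lborel) < \<infinity>"
    proof -
      have "(\<integral>\<^sup>+v. ennreal ((1 + \<bar>v\<bar>) powr - 2) \<partial>lborel) < \<infinity>"
        by (rule nn_integral_even_finite[of 0 1]) (auto intro: powr_mono2' simp: powr_minus inverse_le_1_iff ge_one_powr_ge_zero)
      then show ?thesis by (simp add: ennreal_mult_less_top)
    qed
    finally show ?thesis .
  qed
  then have "(\<Sum>(I, \<gamma>)\<in>A. \<integral>\<^sup>+t. ennreal ((1 + norm (\<gamma> t)) powr - 2) * indicator I t \<partial>lborel) < \<infinity>"
    using A by (auto simp: oriented_contour_def ennreal_sum_less_top split: prod.split)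
  then show ?thesis
    using nn_integral_arclength_le[OF A, of "\<lambda>k. ennreal ((1 + norm k) powr - 2)"]
    by (simp add: le_less_trans)
qed

subsection \<open>Hoelder estimates\<close>

text \<open>Conjugacy is stated in \<open>ennreal\<close>, where 1/\<infinity> = 0 and 1/0 =
  \<infinity>. The latter rules out p = 0, after which the equation can be read over the
  reals.\<close>

lemma conjugate_exponent_cases:
  fixes p :: ennreal and q :: real
  assumes q: "1 \<le> q" and pq: "1 / p + 1 / ennreal q = 1"
  obtains "p = \<infinity>" "q = 1"
  | P where "p = ennreal P" "1 < P" "1 < q" "1 / P + 1 / q = 1"
proof (cases p)
  case top
  then have "ennreal (1 / q) = ennreal 1"
    using pq q by (simp add: divide_ennreal[symmetric])
  then have "q = 1" using q by (subst (asm) ennreal_inj) auto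
  then show ?thesis using top that(1) by simp
next
  case (real P)
  have "P \<noteq> 0"
  proof
    assume "P = 0"
    then have "1 / p = top" using real by (simp add: ennreal_divide_zero)
    then show False using pq by simp
  qed
  then have P: "0 < P" using real by simp
  then have "ennreal (1 / P + 1 / q) = ennreal 1"
    using pq real q by (simp add: divide_ennreal[symmetric])
  then have eq: "1 / P + 1 / q = 1"
    using P q by (subst (asm) ennreal_inj) auto
  moreover have "0 < 1 / P" "0 < 1 / q" using P q by auto
  ultimately have "1 / P < 1" "1 / q < 1" by linarith+
  then have "1 < P" "1 < q" using P q by (auto simp: field_simps)
  then show ?thesis using that(2) real eq by blast
qed

text \<open>Young's inequality is applied to the quotients by the positive bounds \<open>a\<close>
  and \<open>b\<close> instead of the norms themselves, which avoids a separate treatment of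
  vanishing norms.\<close>

lemma nn_integral_Hoelder_le:
  fixes f :: "'a \<Rightarrow> 'b::{real_normed_vector, second_countable_topology}" and h :: "'a \<Rightarrow> real"
  assumes q: "1 \<le> q" and pq: "1 / p + 1 / ennreal q = 1"
    and f: "in_Lp p M f" "Lp_norm p M f \<le> a" "0 < a"
    and h: "h \<in> borel_measurable M" "\<And>x. 0 \<le> h x"
      "(\<integral>\<^sup>+x. ennreal (h x powr q) \<partial>M) \<le> ennreal (b powr q)" "0 < b"
  shows "(\<integral>\<^sup>+x. ennreal (norm (f x) * h x) \<partial>M) \<le> ennreal (a * b)"
  using q pq
proof (cases rule: conjugate_exponent_cases)
  case 1
  define e where "e = esssup M (\<lambda>x. ennreal (norm (f x)))"
  have e: "e < \<infinity>" "enn2real e \<le> a"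
    using f 1 by (simp_all add: in_Lp_def Lp_norm_def e_def)
  then have "e \<le> ennreal a" by (metis ennreal_enn2real ennreal_leI infinity_ennreal_def)
  moreover have "AE x in M. ennreal (norm (f x)) \<le> e" unfolding e_def by (rule esssup_AE)
  ultimately have "AE x in M. norm (f x) \<le> a"
    using f(3) by (auto elim!: eventually_mono dest: order_trans)
  then have "(\<integral>\<^sup>+x. ennreal (norm (f x) * h x) \<partial>M) \<le> (\<integral>\<^sup>+x. ennreal a * ennreal (h x) \<partial>M)"
    using h(2) f(3)
    by (intro nn_integral_mono_AE) (auto elim!: eventually_mono intro!: ennreal_leI mult_right_mono
        simp flip: ennreal_mult')
  also have "\<dots> = ennreal a * (\<integral>\<^sup>+x. ennreal (h x) \<partial>M)"
    using h(1) by (intro nn_integral_cmult) auto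
  also have "\<dots> \<le> ennreal a * ennreal b"
    using h(2-4) 1 by (intro mult_left_mono) auto
  finally show ?thesis using f(3) by (simp flip: ennreal_mult')
next
  case (2 P)
  define L where "L = (LINT x|M. norm (f x) powr P)"
  have P: "enn2real p = P" "p \<noteq> \<infinity>" using 2 by simp_all
  have int: "integrable M (\<lambda>x. norm (f x) powr P)" and fm: "f \<in> borel_measurable M"
    using f(1) P by (simp_all add: in_Lp_def)
  have "0 \<le> L" unfolding L_def by simp
  moreover have "L powr (1 / P) \<le> a" using f(2) P by (simp add: Lp_norm_def L_def)
  ultimately have "L \<le> a powr P"
    using powr_mono2[of P "L powr (1 / P)" a] 2 by (simp add: powr_powr)
  have nn: "(\<integral>\<^sup>+x. ennreal (norm (f x) powr P) \<partial>M) = ennreal L"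
    using nn_integral_eq_integral[OF int] by (simp add: L_def)
  have "(\<integral>\<^sup>+x. ennreal (norm (f x) * h x) \<partial>M)
      \<le> (\<integral>\<^sup>+x. ennreal (a * b / (P * a powr P)) * ennreal (norm (f x) powr P)
            + ennreal (a * b / (q * b powr q)) * ennreal (h x powr q) \<partial>M)"
  proof (rule nn_integral_mono)
    fix x
    have "(norm (f x) / a) * (h x / b) \<le> (norm (f x) / a) powr P / P + (h x / b) powr q / q"
      using 2 f(3) h(2)[of x] h(4) by (intro Youngs_inequality) auto
    also have "\<dots> = norm (f x) powr P / (P * a powr P) + h x powr q / (q * b powr q)"
      using f(3) h(2)[of x] h(4) by (simp add: powr_divide mult.commute)
    finally have "a * b * ((norm (f x) / a) * (h x / b))
        \<le> a * b * (norm (f x) powr P / (P * a powr P) + h x powr q / (q * b powr q))"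
      using f(3) h(4) by (intro mult_left_mono) auto
    then have "norm (f x) * h x \<le> a * b / (P * a powr P) * norm (f x) powr P
        + a * b / (q * b powr q) * h x powr q"
      using f(3) h(4) by (simp add: distrib_left)
    then show "ennreal (norm (f x) * h x) \<le> ennreal (a * b / (P * a powr P)) * ennreal (norm (f x) powr P)
        + ennreal (a * b / (q * b powr q)) * ennreal (h x powr q)"
      using f(3) h(4) 2 by (simp add: ennreal_leI flip: ennreal_mult' ennreal_plus)
  qed
  also have "\<dots> = ennreal (a * b / (P * a powr P)) * ennreal L
      + ennreal (a * b / (q * b powr q)) * (\<integral>\<^sup>+x. ennreal (h x powr q) \<partial>M)"
    using fm h(1) by (subst nn_integral_add) (auto simp: nn_integral_cmult nn)
  also have "\<dots> \<le> ennreal (a * b / (P * a powr P)) * ennreal (a powr P)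
      + ennreal (a * b / (q * b powr q)) * ennreal (b powr q)"
    using h(3) \<open>L \<le> a powr P\<close> by (intro add_mono mult_left_mono ennreal_leI) auto
  also have "\<dots> = ennreal (a * b / P + a * b / q)"
    using f(3) h(4) 2 by (simp flip: ennreal_mult' ennreal_plus)
  also have "a * b / P + a * b / q = a * b * (1 / P + 1 / q)" by (simp add: distrib_left)
  finally show ?thesis using 2 by simp
qed

lemma Hoelder_rate:
  fixes f :: "nat \<Rightarrow> 'a \<Rightarrow> 'b::{real_normed_vector, second_countable_topology}"
    and h :: "nat \<Rightarrow> 'a \<Rightarrow> real"
  assumes q: "1 \<le> q" and pq: "1 / p + 1 / ennreal q = 1"
    and f: "\<forall>\<^sub>F n in sequentially. in_Lp p M (f n)" "(\<lambda>n. Lp_norm p M (f n)) \<in> O(\<lambda>n. real n powr r)"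
    and h: "\<And>n. h n \<in> borel_measurable M" "\<And>n x. 0 \<le> h n x"
      "\<forall>\<^sub>F n in sequentially. (\<integral>\<^sup>+x. ennreal (h n x powr q) \<partial>M) \<le> ennreal (D * real n powr - (q * \<sigma>))"
  shows "\<exists>C\<ge>0. \<forall>\<^sub>F n in sequentially. (\<integral>\<^sup>+x. ennreal (norm (f n x) * h n x) \<partial>M)
    \<le> ennreal (C * real n powr (r - \<sigma>))"
proof -
  obtain a where a: "0 < a"
    "\<forall>\<^sub>F n in sequentially. norm (Lp_norm p M (f n)) \<le> a * norm (real n powr r)"
    using landau_o.bigE[OF f(2)] by blast
  \<comment> \<open>The constant D carries no sign condition; |D| + 1 dominates it and keeps
    \<open>d\<close> strictly positive, as the Hoelder estimate requires.\<close>
  define d where "d = (\<bar>D\<bar> + 1) powr (1 / q)"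
  have d: "0 < d" "d powr q = \<bar>D\<bar> + 1" using q by (auto simp: d_def powr_powr)
  have "\<forall>\<^sub>F n in sequentially. (\<integral>\<^sup>+x. ennreal (norm (f n x) * h n x) \<partial>M)
    \<le> ennreal (a * d * real n powr (r - \<sigma>))"
    using f(1) a(2) h(3) eventually_gt_at_top[of 0]
  proof eventually_elim
    case (elim n)
    have n: "0 < real n" using elim(4) by simp
    have "(\<integral>\<^sup>+x. ennreal (norm (f n x) * h n x) \<partial>M) \<le> ennreal ((a * real n powr r) * (d * real n powr - \<sigma>))"
    proof (rule nn_integral_Hoelder_le[OF q pq elim(1)])
      show "Lp_norm p M (f n) \<le> a * real n powr r" using elim(2) by simp
      have "(d * real n powr - \<sigma>) powr q = (\<bar>D\<bar> + 1) * real n powr - (q * \<sigma>)"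
        using n d by (simp add: powr_mult powr_powr mult.commute)
      moreover have "D * real n powr - (q * \<sigma>) \<le> (\<bar>D\<bar> + 1) * real n powr - (q * \<sigma>)"
        by (intro mult_right_mono) auto
      ultimately show "(\<integral>\<^sup>+x. ennreal (h n x powr q) \<partial>M) \<le> ennreal ((d * real n powr - \<sigma>) powr q)"
        using elim(3) by (metis ennreal_leI order_trans)
    qed (use a(1) d n h in auto)
    also have "(a * real n powr r) * (d * real n powr - \<sigma>) = a * d * real n powr (r - \<sigma>)"
      using n by (simp add: powr_diff powr_minus field_simps)
    finally show ?case .
  qed
  then show ?thesis using a(1) d(1) by (intro exI[of _ "a * d"]) auto
qed

section \<open>From pointwise smallness to the decay rate\<close>

lemma AE_arclength_not_in_finite:
  assumes A: "oriented_contour A" and K: "finite K"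
  shows "AE k in arclength A. k \<notin> K"
proof -
  have "AE k in arclength A. k \<noteq> \<kappa>" for \<kappa>
  proof -
    have "emeasure lborel {t\<in>I. \<gamma> t \<in> {\<kappa>}} = 0" if a: "(I, \<gamma>) \<in> A" for I \<gamma>
    proof -
      have inj: "inj_on \<gamma> I" using smooth_arc_inj_on oriented_contour_smooth_arc[OF A a] by blast
      have "finite {t\<in>I. \<gamma> t \<in> {\<kappa>}}"
        using finite_vimage_IntI[OF _ inj, of "{\<kappa>}"] by (simp add: vimage_def Int_def conj_commute)
      then show ?thesis using emeasure_lborel_countable countable_finite by blast
    qed
    then have "(\<Sum>(I, \<gamma>)\<in>A. emeasure lborel {t\<in>I. \<gamma> t \<in> {\<kappa>}}) = 0"
      by (intro sum.neutral) auto
    then have "{\<kappa>} \<in> null_sets (arclength A)"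
      using emeasure_arclength[OF A, of "{\<kappa>}"] by (auto intro!: null_setsI)
    then show ?thesis using AE_not_in by fastforce
  qed
  then have "AE k in arclength A. \<forall>\<kappa>\<in>K. k \<noteq> \<kappa>"
    using K by (intro AE_finite_allI) auto
  then show ?thesis by eventually_elim blast
qed

lemma exp_small_away_bounded:
  assumes A: "oriented_contour A" and bdd: "bounded (contour A)" and w: "exp_small_away 0 A K w"
  shows "exp_small_away m A K w"
  unfolding exp_small_away_def
proof (intro allI impI)
  fix \<rho> :: real assume "0 < \<rho>"
  then obtain C d where d: "0 < d" and Cd: "\<forall>\<^sub>F n in sequentially. AE k in arclength A.
     (\<forall>\<kappa>\<in>K. \<rho> \<le> dist k \<kappa>) \<longrightarrow> (1 + norm k) ^ 0 * norm (w n k) \<le> C * exp (- d * real n)"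
    using w unfolding exp_small_away_def by blast
  obtain b where b: "\<And>k. k \<in> contour A \<Longrightarrow> norm k \<le> b"
    using bdd unfolding bounded_iff by blast
  have "\<forall>\<^sub>F n in sequentially. AE k in arclength A. (\<forall>\<kappa>\<in>K. \<rho> \<le> dist k \<kappa>)
      \<longrightarrow> (1 + norm k) ^ m * norm (w n k) \<le> (1 + b) ^ m * C * exp (- d * real n)"
    using Cd
  proof eventually_elim
    case (elim n)
    from elim AE_arclength_regular[OF A] show ?case
    proof eventually_elim
      case (elim k)
      show ?case
      proof
        assume "\<forall>\<kappa>\<in>K. \<rho> \<le> dist k \<kappa>"
        then have "norm (w n k) \<le> C * exp (- d * real n)" using elim by simp
        moreover have "(1 + norm k) ^ m \<le> (1 + b) ^ m"
          using elim b by (intro power_mono) auto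
        \<comment> \<open>The bound \<open>b\<close> could be negative if the contour were empty;
          its sign is read off from the point k of the contour.\<close>
        moreover have "0 \<le> (1 + b) ^ m"
          using elim b[of k] norm_ge_zero[of k] by (intro zero_le_power) linarith
        ultimately have "(1 + norm k) ^ m * norm (w n k) \<le> (1 + b) ^ m * (C * exp (- d * real n))"
          by (intro mult_mono) auto
        then show "(1 + norm k) ^ m * norm (w n k) \<le> (1 + b) ^ m * C * exp (- d * real n)"
          by (simp only: mult.assoc)
      qed
    qed
  qed
  then show "\<exists>C. \<exists>d>0. \<forall>\<^sub>F n in sequentially. AE k in arclength A. (\<forall>\<kappa>\<in>K. \<rho> \<le> dist k \<kappa>)
      \<longrightarrow> (1 + norm k) ^ m * norm (w n k) \<le> C * exp (- d * real n)"
    using d by blast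
qed

text \<open>The bounds near and away from \<open>K\<close> are merged into one sum valid almost
  everywhere off \<open>G\<close>, so that each summand can later be integrated over the whole
  contour without cutting it up.\<close>

lemma weighted_product_bound:
  fixes w :: "nat \<Rightarrow> complex \<Rightarrow> complex^'m^'m" and Y :: "complex \<Rightarrow> complex^'m^'m"
  assumes A: "oriented_contour A" and K: "finite K"
    and far: "exp_small_away (l + 2) A K w"
    and near: "\<And>\<kappa>. \<kappa> \<in> K \<Longrightarrow> \<exists>C. \<exists>\<rho>>0. \<forall>\<^sub>F n in sequentially. AE k in arclength A.
      dist k \<kappa> < \<rho> \<longrightarrow> norm (w n k) \<le> C * exp (- c * real n * norm (k - \<kappa>) powr \<theta>)"
    and Y_far: "\<And>\<rho>. 0 < \<rho> \<Longrightarrow> \<exists>B. \<forall>z. z \<notin> G \<longrightarrow> (\<forall>\<kappa>\<in>K. \<rho> \<le> dist z \<kappa>) \<longrightarrow> norm (Y z) \<le> B"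
    and Y_near: "\<And>\<kappa>. \<kappa> \<in> K \<Longrightarrow> \<exists>C. \<exists>\<rho>>0. \<forall>z. z \<notin> G \<longrightarrow> z \<noteq> \<kappa> \<longrightarrow> dist z \<kappa> < \<rho> \<longrightarrow>
      norm (Y z) \<le> C * norm (z - \<kappa>) powr (-1/4)"
  obtains C d where "0 \<le> C" "0 < d" "\<forall>\<^sub>F n in sequentially. AE k in arclength A. k \<notin> G \<longrightarrow>
      (1 + norm k) ^ l * (norm (w n k) * norm (Y k))
      \<le> C * ((\<Sum>\<kappa>\<in>K. exp (- c * real n * norm (k - \<kappa>) powr \<theta>) * norm (k - \<kappa>) powr (-1/4))
        + exp (- d * real n) * (1 + norm k) powr - 2)"
proof -
  define Q1 where "Q1 \<kappa> C \<rho> \<longleftrightarrow> (\<forall>\<^sub>F n in sequentially. AE k in arclength A.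
      dist k \<kappa> < \<rho> \<longrightarrow> norm (w n k) \<le> C * exp (- c * real n * norm (k - \<kappa>) powr \<theta>))" for \<kappa> C \<rho>
  define Q2 where "Q2 \<kappa> C \<rho> \<longleftrightarrow> (\<forall>z. z \<notin> G \<longrightarrow> z \<noteq> \<kappa> \<longrightarrow> dist z \<kappa> < \<rho> \<longrightarrow>
      norm (Y z) \<le> C * norm (z - \<kappa>) powr (-1/4))" for \<kappa> C \<rho>
  have "\<forall>\<kappa>\<in>K. \<exists>C. \<exists>\<rho>>0. Q1 \<kappa> C \<rho>" unfolding Q1_def using near by (rule ballI)
  from bchoice[OF this] obtain C1 where "\<forall>\<kappa>\<in>K. \<exists>\<rho>>0. Q1 \<kappa> (C1 \<kappa>) \<rho>" ..
  from bchoice[OF this] obtain \<rho>1 where 1: "\<forall>\<kappa>\<in>K. 0 < \<rho>1 \<kappa> \<and> Q1 \<kappa> (C1 \<kappa>) (\<rho>1 \<kappa>)" ..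
  have "\<forall>\<kappa>\<in>K. \<exists>C. \<exists>\<rho>>0. Q2 \<kappa> C \<rho>" unfolding Q2_def using Y_near by (rule ballI)
  from bchoice[OF this] obtain C2 where "\<forall>\<kappa>\<in>K. \<exists>\<rho>>0. Q2 \<kappa> (C2 \<kappa>) \<rho>" ..
  from bchoice[OF this] obtain \<rho>2 where 2: "\<forall>\<kappa>\<in>K. 0 < \<rho>2 \<kappa> \<and> Q2 \<kappa> (C2 \<kappa>) (\<rho>2 \<kappa>)" ..
  \<comment> \<open>A common radius exists because \<open>K\<close> is finite. Including 1 in the
    minimum gives |k| \<le> |\<kappa>| + 1 near \<kappa>, so the weight there is at most (2 +
    |\<kappa>|)^l.\<close>
  define \<rho> where "\<rho> = Min (insert 1 (\<rho>1 ` K \<union> \<rho>2 ` K))"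
  have \<rho>: "0 < \<rho>" "\<rho> \<le> 1" "\<And>\<kappa>. \<kappa> \<in> K \<Longrightarrow> \<rho> \<le> \<rho>1 \<kappa>" "\<And>\<kappa>. \<kappa> \<in> K \<Longrightarrow> \<rho> \<le> \<rho>2 \<kappa>"
    using K 1 2 by (auto simp: \<rho>_def)
  obtain C3 d where d: "0 < d" and 3: "\<forall>\<^sub>F n in sequentially. AE k in arclength A.
     (\<forall>\<kappa>\<in>K. \<rho> \<le> dist k \<kappa>) \<longrightarrow> (1 + norm k) ^ (l + 2) * norm (w n k) \<le> C3 * exp (- d * real n)"
    using far \<rho>(1) unfolding exp_small_away_def by blast
  obtain B where B: "\<And>z. z \<notin> G \<Longrightarrow> (\<forall>\<kappa>\<in>K. \<rho> \<le> dist z \<kappa>) \<Longrightarrow> norm (Y z) \<le> B"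
    using Y_far[OF \<rho>(1)] by blast
  define C where "C = (\<Sum>\<kappa>\<in>K. (2 + norm \<kappa>) ^ l * (\<bar>C1 \<kappa>\<bar> * \<bar>C2 \<kappa>\<bar>)) + \<bar>C3\<bar> * \<bar>B\<bar>"
  have C: "0 \<le> C" unfolding C_def by (intro add_nonneg_nonneg sum_nonneg) auto
  let ?h = "\<lambda>n \<kappa> k. exp (- c * real n * norm (k - \<kappa>) powr \<theta>) * norm (k - \<kappa>) powr (-1/4)"
  have "\<forall>\<^sub>F n in sequentially. \<forall>\<kappa>\<in>K. AE k in arclength A.
      dist k \<kappa> < \<rho>1 \<kappa> \<longrightarrow> norm (w n k) \<le> C1 \<kappa> * exp (- c * real n * norm (k - \<kappa>) powr \<theta>)"
    using K 1 by (intro eventually_ball_finite) (simp_all add: Q1_def)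
  then have "\<forall>\<^sub>F n in sequentially. AE k in arclength A. k \<notin> G \<longrightarrow>
      (1 + norm k) ^ l * (norm (w n k) * norm (Y k))
      \<le> C * ((\<Sum>\<kappa>\<in>K. ?h n \<kappa> k) + exp (- d * real n) * (1 + norm k) powr - 2)"
    using 3
  proof eventually_elim
    case (elim n)
    have "AE k in arclength A. \<forall>\<kappa>\<in>K. dist k \<kappa> < \<rho>1 \<kappa> \<longrightarrow>
        norm (w n k) \<le> C1 \<kappa> * exp (- c * real n * norm (k - \<kappa>) powr \<theta>)"
      using K elim(1) by (intro AE_finite_allI) auto
    with elim(2) AE_arclength_not_in_finite[OF A K] show ?case
    proof eventually_elim
      case (elim k)
      let ?P = "(1 + norm k) ^ l * (norm (w n k) * norm (Y k))"
      let ?e = "exp (- d * real n) * (1 + norm k) powr - 2"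
      have sum0: "0 \<le> (\<Sum>\<kappa>\<in>K. ?h n \<kappa> k)" by (intro sum_nonneg) auto
      show ?case
      proof
        assume k: "k \<notin> G"
        show "?P \<le> C * ((\<Sum>\<kappa>\<in>K. ?h n \<kappa> k) + ?e)"
        proof (cases "\<forall>\<kappa>\<in>K. \<rho> \<le> dist k \<kappa>")
          case True
          \<comment> \<open>Away from \<open>K\<close> the two spare powers of the weight are
            converted into the integrable factor (1 + |k|)^(-2).\<close>
          have "(1 + norm k)\<^sup>2 * (1 + norm k) powr - 2 = 1"
            using add_pos_nonneg[OF zero_less_one norm_ge_zero[of k]]
            by (simp add: powr_minus del: norm_ge_zero)
          then have "(1 + norm k) ^ l * norm (w n k) = (1 + norm k) ^ (l + 2) * norm (w n k) * (1 + norm k) powr - 2"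
            by (simp add: power_add power2_eq_square mult.assoc mult.left_commute)
          also have "\<dots> \<le> C3 * exp (- d * real n) * (1 + norm k) powr - 2"
            using elim(1) True by (intro mult_right_mono) auto
          also have "\<dots> \<le> \<bar>C3\<bar> * exp (- d * real n) * (1 + norm k) powr - 2"
            by (intro mult_right_mono) auto
          finally have "((1 + norm k) ^ l * norm (w n k)) * norm (Y k)
              \<le> (\<bar>C3\<bar> * exp (- d * real n) * (1 + norm k) powr - 2) * \<bar>B\<bar>"
            by (rule mult_mono) (use B[OF k True] in auto)
          then have "?P \<le> \<bar>C3\<bar> * \<bar>B\<bar> * ?e" by (simp add: mult_ac)
          also have "\<dots> \<le> C * ?e"
            unfolding C_def by (intro mult_right_mono) (auto intro!: sum_nonneg)
          also have "\<dots> \<le> C * ((\<Sum>\<kappa>\<in>K. ?h n \<kappa> k) + ?e)"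
            using C sum0 by (intro mult_left_mono) auto
          finally show ?thesis .
        next
          case False
          then obtain \<kappa> where \<kappa>: "\<kappa> \<in> K" "dist k \<kappa> < \<rho>" by force
          have ne: "k \<noteq> \<kappa>" using elim(2) \<kappa>(1) by blast
          have "norm k \<le> norm \<kappa> + dist k \<kappa>" using norm_triangle_sub[of k \<kappa>] by (simp add: dist_norm)
          then have "(1 + norm k) ^ l \<le> (2 + norm \<kappa>) ^ l"
            using \<kappa>(2) \<rho>(2) by (intro power_mono) auto
          moreover have "norm (w n k) \<le> \<bar>C1 \<kappa>\<bar> * exp (- c * real n * norm (k - \<kappa>) powr \<theta>)"
          proof -
            have "norm (w n k) \<le> C1 \<kappa> * exp (- c * real n * norm (k - \<kappa>) powr \<theta>)"
              using bspec[OF elim(3) \<kappa>(1)] \<kappa>(2) \<rho>(3)[OF \<kappa>(1)] by simp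
            also have "\<dots> \<le> \<bar>C1 \<kappa>\<bar> * exp (- c * real n * norm (k - \<kappa>) powr \<theta>)"
              by (intro mult_right_mono) auto
            finally show ?thesis .
          qed
          moreover have "norm (Y k) \<le> \<bar>C2 \<kappa>\<bar> * norm (k - \<kappa>) powr (-1/4)"
          proof -
            have "norm (Y k) \<le> C2 \<kappa> * norm (k - \<kappa>) powr (-1/4)"
              using bspec[OF 2 \<kappa>(1)] k ne \<kappa>(2) \<rho>(4)[OF \<kappa>(1)] by (simp add: Q2_def)
            also have "\<dots> \<le> \<bar>C2 \<kappa>\<bar> * norm (k - \<kappa>) powr (-1/4)"
              by (intro mult_right_mono) auto
            finally show ?thesis .
          qed
          ultimately have "?P \<le> (2 + norm \<kappa>) ^ l * ((\<bar>C1 \<kappa>\<bar> * exp (- c * real n * norm (k - \<kappa>) powr \<theta>))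
              * (\<bar>C2 \<kappa>\<bar> * norm (k - \<kappa>) powr (-1/4)))"
            by (intro mult_mono) auto
          then have "?P \<le> (2 + norm \<kappa>) ^ l * (\<bar>C1 \<kappa>\<bar> * \<bar>C2 \<kappa>\<bar>) * ?h n \<kappa> k"
            by (simp only: mult_ac)
          also have "\<dots> \<le> C * (\<Sum>\<kappa>\<in>K. ?h n \<kappa> k)"
          proof (intro mult_mono)
            have "(2 + norm \<kappa>) ^ l * (\<bar>C1 \<kappa>\<bar> * \<bar>C2 \<kappa>\<bar>) \<le> (\<Sum>\<kappa>\<in>K. (2 + norm \<kappa>) ^ l * (\<bar>C1 \<kappa>\<bar> * \<bar>C2 \<kappa>\<bar>))"
              using \<kappa>(1) K
              by (intro member_le_sum[where f = "\<lambda>\<kappa>. (2 + norm \<kappa>) ^ l * (\<bar>C1 \<kappa>\<bar> * \<bar>C2 \<kappa>\<bar>)"]) auto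
            then show "(2 + norm \<kappa>) ^ l * (\<bar>C1 \<kappa>\<bar> * \<bar>C2 \<kappa>\<bar>) \<le> C"
              unfolding C_def by (simp add: add_increasing2)
            show "?h n \<kappa> k \<le> (\<Sum>\<kappa>\<in>K. ?h n \<kappa> k)"
              using \<kappa>(1) K by (intro member_le_sum[where f = "\<lambda>\<kappa>. ?h n \<kappa> k"]) auto
          qed (use C in auto)
          also have "\<dots> \<le> C * ((\<Sum>\<kappa>\<in>K. ?h n \<kappa> k) + ?e)"
            using C by (intro mult_left_mono) auto
          finally show ?thesis .
        qed
      qed
    qed
  qed
  with C d show ?thesis using that by blast
qed

lemma powr_times_exp_tendsto_0:
  fixes a b :: real
  assumes b: "0 < b"
  shows "(\<lambda>n. real n powr a * exp (- b * real n)) \<longlonglongrightarrow> 0"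
proof -
  have *: "((\<lambda>x::real. x powr a * exp (- x)) \<longlongrightarrow> 0) at_top" by real_asymp
  have "filterlim (\<lambda>n. b * real n) at_top sequentially"
    by (rule filterlim_tendsto_pos_mult_at_top[OF tendsto_const b filterlim_real_sequentially])
  from tendsto_mult_right_zero[OF filterlim_compose[OF * this], of "b powr - a"]
  have "(\<lambda>n. b powr - a * ((b * real n) powr a * exp (- (b * real n)))) \<longlonglongrightarrow> 0" .
  moreover have "b powr - a * ((b * real n) powr a * exp (- (b * real n)))
      = real n powr a * exp (- b * real n)" for n
    using b by (simp add: powr_mult powr_minus field_simps)
  ultimately show ?thesis by simp
qed

text \<open>Hoelder's inequality is applied to each summand separately: the ones attached to
  \<open>K\<close> decay at the scaling rate, and the exponentially small one decays faster than any
  power of n.\<close>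

lemma weighted_integral_rate:
  fixes f :: "nat \<Rightarrow> complex \<Rightarrow> 'b::{real_normed_vector, second_countable_topology}"
    and g :: "nat \<Rightarrow> complex \<Rightarrow> real"
  assumes A: "oriented_contour A" and K: "finite K"
    and q: "1 \<le> q" "q < 4" and pq: "1 / p + 1 / ennreal q = 1"
    and f: "\<forall>\<^sub>F n in sequentially. in_Lp p (arclength A) (f n)"
      "(\<lambda>n. Lp_norm p (arclength A) (f n)) \<in> O(\<lambda>n. real n powr r)"
    and c: "0 < c" and \<theta>: "0 < \<theta>" and d: "0 < d" and C: "0 \<le> C"
    and g: "\<forall>\<^sub>F n in sequentially. AE k in arclength A. g n k \<le> C * (norm (f n k) *
      ((\<Sum>\<kappa>\<in>K. exp (- c * real n * norm (k - \<kappa>) powr \<theta>) * norm (k - \<kappa>) powr (-1/4))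
        + exp (- d * real n) * (1 + norm k) powr - 2))"
  shows "\<exists>C\<ge>0. \<forall>\<^sub>F n in sequentially. (\<integral>\<^sup>+k. ennreal (g n k) \<partial>arclength A)
    \<le> ennreal (C * real n powr (r - (1 / (q * \<theta>) - 1 / (4 * \<theta>))))"
proof -
  define \<sigma> where "\<sigma> = 1 / (q * \<theta>) - 1 / (4 * \<theta>)"
  define h where "h \<kappa> n k = exp (- c * real n * norm (k - \<kappa>) powr \<theta>) * norm (k - \<kappa>) powr (-1/4)"
    for \<kappa> :: complex and n :: nat and k :: complex
  define e where "e n k = exp (- d * real n) * (1 + norm k) powr - 2" for n :: nat and k :: complex
  have hm: "h \<kappa> n \<in> borel_measurable (arclength A)" for \<kappa> n
    unfolding h_def by measurable
  have em: "e n \<in> borel_measurable (arclength A)" for n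
    unfolding e_def by measurable
  have "\<exists>C\<ge>0. \<forall>\<^sub>F n in sequentially. (\<integral>\<^sup>+k. ennreal (norm (f n k) * h \<kappa> n k) \<partial>arclength A)
      \<le> ennreal (C * real n powr (r - \<sigma>))" for \<kappa>
  proof -
    obtain D where D: "\<And>x::real. 0 < x \<Longrightarrow>
        (\<integral>\<^sup>+k. ennreal (exp (- (c * q) * x * norm (k - \<kappa>) powr \<theta>) * norm (k - \<kappa>) powr - (q / 4)) \<partial>arclength A)
        \<le> ennreal (D * x powr - ((1 - q / 4) / \<theta>))"
      by (rule nn_integral_arclength_exp_powr_le[OF A _ _ _ \<theta>, of "q / 4" "c * q" \<kappa>])
        (use q c in \<open>auto intro: that\<close>)
    have hq: "h \<kappa> n k powr q
        = exp (- (c * q) * real n * norm (k - \<kappa>) powr \<theta>) * norm (k - \<kappa>) powr - (q / 4)" for n k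
      by (simp add: h_def powr_mult powr_powr exp_powr_real mult_ac)
    \<comment> \<open>This identity matches the scaling exponent for \<alpha> = q/4 with the
      \<open>q\<close>-th power of the desired rate; it is the source of the formula for
      \<open>s\<close>.\<close>
    have "q * \<sigma> = (1 - q / 4) / \<theta>" using q \<theta> by (simp add: \<sigma>_def field_simps)
    then have "(\<integral>\<^sup>+k. ennreal (h \<kappa> n k powr q) \<partial>arclength A) \<le> ennreal (D * real n powr - (q * \<sigma>))"
      if "0 < n" for n
      unfolding hq using D[of "real n"] that by simp
    then have "\<forall>\<^sub>F n in sequentially.
        (\<integral>\<^sup>+k. ennreal (h \<kappa> n k powr q) \<partial>arclength A) \<le> ennreal (D * real n powr - (q * \<sigma>))"
      using eventually_gt_at_top[of 0] by (rule eventually_mono[rotated])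
    then show ?thesis
      by (intro Hoelder_rate[OF q(1) pq f hm]) (simp add: h_def)
  qed
  then have "\<forall>\<kappa>. \<exists>C\<ge>0. \<forall>\<^sub>F n in sequentially. (\<integral>\<^sup>+k. ennreal (norm (f n k) * h \<kappa> n k) \<partial>arclength A)
      \<le> ennreal (C * real n powr (r - \<sigma>))" ..
  from choice[OF this] obtain C1 where C1: "\<forall>\<kappa>. 0 \<le> C1 \<kappa> \<and>
      (\<forall>\<^sub>F n in sequentially. (\<integral>\<^sup>+k. ennreal (norm (f n k) * h \<kappa> n k) \<partial>arclength A)
        \<le> ennreal (C1 \<kappa> * real n powr (r - \<sigma>)))" ..
  then have C1_nonneg: "\<And>\<kappa>. 0 \<le> C1 \<kappa>" by blast
  have "\<exists>C\<ge>0. \<forall>\<^sub>F n in sequentially. (\<integral>\<^sup>+k. ennreal (norm (f n k) * e n k) \<partial>arclength A)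
      \<le> ennreal (C * real n powr (r - \<sigma>))"
  proof -
    obtain M where M: "0 \<le> M" "(\<integral>\<^sup>+k. ennreal ((1 + norm k) powr - 2) \<partial>arclength A) = ennreal M"
      using nn_integral_arclength_inverse_square_finite[OF A] by (auto simp: less_top_ennreal)
    have dq: "0 < d * q" using d q by simp
    have "((\<lambda>n. real n powr (q * \<sigma>) * exp (- (d * q) * real n)) \<longlongrightarrow> 0) sequentially"
      using powr_times_exp_tendsto_0[OF dq] .
    then have "\<forall>\<^sub>F n in sequentially. real n powr (q * \<sigma>) * exp (- (d * q) * real n) < 1"
      by (rule order_tendstoD) simp
    then have "\<forall>\<^sub>F n in sequentially.
        (\<integral>\<^sup>+k. ennreal (e n k powr q) \<partial>arclength A) \<le> ennreal (M * real n powr - (q * \<sigma>))"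
      using eventually_gt_at_top[of 0]
    proof eventually_elim
      case (elim n)
      have "e n k powr q \<le> exp (- (d * q) * real n) * (1 + norm k) powr - 2" for k
      proof -
        have "e n k powr q = exp (- (d * q) * real n) * (1 + norm k) powr (- 2 * q)"
          by (simp add: e_def powr_mult powr_powr exp_powr_real mult_ac)
        \<comment> \<open>The base is at least 1 and q \<ge> 1, so raising to the power q only helps
          the decay.\<close>
        also have "\<dots> \<le> exp (- (d * q) * real n) * (1 + norm k) powr - 2"
          using q by (intro mult_left_mono powr_mono) auto
        finally show ?thesis .
      qed
      then have "(\<integral>\<^sup>+k. ennreal (e n k powr q) \<partial>arclength A)
          \<le> (\<integral>\<^sup>+k. ennreal (exp (- (d * q) * real n)) * ennreal ((1 + norm k) powr - 2) \<partial>arclength A)"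
        by (intro nn_integral_mono) (simp add: ennreal_leI flip: ennreal_mult')
      also have "\<dots> = ennreal (exp (- (d * q) * real n) * M)"
        using M by (subst nn_integral_cmult) (simp_all add: ennreal_mult')
      also have "\<dots> \<le> ennreal (M * real n powr - (q * \<sigma>))"
      proof (rule ennreal_leI)
        have "exp (- (d * q) * real n) \<le> real n powr - (q * \<sigma>)"
          using elim by (simp add: powr_minus field_simps)
        then show "exp (- (d * q) * real n) * M \<le> M * real n powr - (q * \<sigma>)"
          using M(1) by (simp add: mult.commute mult_left_mono)
      qed
      finally show ?case .
    qed
    then show ?thesis
      by (intro Hoelder_rate[OF q(1) pq f em]) (simp add: e_def)
  qed
  then obtain C2 where C2: "0 \<le> C2"
    "\<forall>\<^sub>F n in sequentially. (\<integral>\<^sup>+k. ennreal (norm (f n k) * e n k) \<partial>arclength A)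
      \<le> ennreal (C2 * real n powr (r - \<sigma>))" by blast
  have "\<forall>\<^sub>F n in sequentially. \<forall>\<kappa>\<in>K. (\<integral>\<^sup>+k. ennreal (norm (f n k) * h \<kappa> n k) \<partial>arclength A)
      \<le> ennreal (C1 \<kappa> * real n powr (r - \<sigma>))"
    using K C1 by (intro eventually_ball_finite) simp_all
  with g f(1) C2(2)
  have "\<forall>\<^sub>F n in sequentially. (\<integral>\<^sup>+k. ennreal (g n k) \<partial>arclength A)
      \<le> ennreal (C * (sum C1 K + C2) * real n powr (r - \<sigma>))"
  proof eventually_elim
    case (elim n)
    have [measurable]: "f n \<in> borel_measurable (arclength A)" using elim(2) by (simp add: in_Lp_def)
    note [measurable] = hm em
    have nn: "0 \<le> h \<kappa> n k" "0 \<le> e n k" for \<kappa> k by (simp_all add: h_def e_def)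
    have "(\<integral>\<^sup>+k. ennreal (g n k) \<partial>arclength A)
        \<le> (\<integral>\<^sup>+k. ennreal C * ((\<Sum>\<kappa>\<in>K. ennreal (norm (f n k) * h \<kappa> n k)) + ennreal (norm (f n k) * e n k)) \<partial>arclength A)"
    proof (rule nn_integral_mono_AE)
      from elim(1) show "AE k in arclength A. ennreal (g n k) \<le> ennreal C *
          ((\<Sum>\<kappa>\<in>K. ennreal (norm (f n k) * h \<kappa> n k)) + ennreal (norm (f n k) * e n k))"
      proof eventually_elim
        case (elim k)
        have "g n k \<le> C * ((\<Sum>\<kappa>\<in>K. norm (f n k) * h \<kappa> n k) + norm (f n k) * e n k)"
          using elim by (simp add: h_def e_def distrib_left sum_distrib_left)
        then show ?case
          using C nn by (simp add: ennreal_leI sum_nonneg flip: ennreal_mult' ennreal_plus)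
      qed
    qed
    also have "\<dots> = ennreal C * ((\<Sum>\<kappa>\<in>K. \<integral>\<^sup>+k. ennreal (norm (f n k) * h \<kappa> n k) \<partial>arclength A)
        + (\<integral>\<^sup>+k. ennreal (norm (f n k) * e n k) \<partial>arclength A))"
      by (simp add: nn_integral_cmult nn_integral_add nn_integral_sum)
    also have "\<dots> \<le> ennreal C * ((\<Sum>\<kappa>\<in>K. ennreal (C1 \<kappa> * real n powr (r - \<sigma>)))
        + ennreal (C2 * real n powr (r - \<sigma>)))"
      using elim(3,4) by (intro mult_left_mono add_mono sum_mono) auto
    also have "\<dots> = ennreal (C * (sum C1 K + C2) * real n powr (r - \<sigma>))"
      using C C1_nonneg C2(1)
      by (simp add: sum_nonneg sum_distrib_right distrib_right mult.assoc flip: ennreal_mult' ennreal_plus)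
    finally show ?case .
  qed
  moreover have "0 \<le> C * (sum C1 K + C2)"
    using C C1_nonneg C2(1) by (simp add: sum_nonneg)
  ultimately show ?thesis unfolding \<sigma>_def by blast
qed

subsection \<open>Cauchy integrals of densities supported on a closed set\<close>

lemma
  assumes A: "oriented_contour A" and F: "integrable (arclength A) F" and g: "g \<in> borel_measurable borel"
    and le: "AE k in arclength A. norm (g k) \<le> b * F k"
  shows integrable_mult_tangent: "integrable (arclength A) (\<lambda>k. g k * tangent A k)"
    and norm_integral_mult_tangent_le:
      "norm (LINT k|arclength A. g k * tangent A k) \<le> b * (LINT k|arclength A. F k)"
proof -
  have m: "(\<lambda>k. g k * tangent A k) \<in> borel_measurable (arclength A)"
    using g borel_measurable_tangent[OF A] by simp
  have *: "AE k in arclength A. norm (g k * tangent A k) \<le> b * F k"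
    using le AE_norm_tangent[OF A] by eventually_elim (simp add: norm_mult)
  show int: "integrable (arclength A) (\<lambda>k. g k * tangent A k)"
  proof (rule Bochner_Integration.integrable_bound[OF _ m])
    show "integrable (arclength A) (\<lambda>k. b * F k)" using F by simp
    show "AE k in arclength A. norm (g k * tangent A k) \<le> norm (b * F k)"
      using * by eventually_elim simp
  qed
  have "norm (LINT k|arclength A. g k * tangent A k) \<le> (LINT k|arclength A. norm (g k * tangent A k))"
    by (rule integral_norm_bound)
  also have "\<dots> \<le> (LINT k|arclength A. b * F k)"
    using int F * by (intro integral_mono_AE) auto
  finally show "norm (LINT k|arclength A. g k * tangent A k) \<le> b * (LINT k|arclength A. F k)" by simp
qed

lemma norm_cauchy_constant: "norm (1 / (2 * of_real pi * \<i>) :: complex) \<le> 1"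
  using pi_ge_two by (simp add: norm_divide norm_mult)

text \<open>Only the support \<Gamma> has to be avoided, not the whole contour, so the integral
  makes sense on the rest of the contour as well. If \<Gamma> is empty, the density vanishes almost
  everywhere and the quotient by \<open>infdist z \<Gamma> = 0\<close> is 0, which is
  consistent.\<close>

lemma norm_cauchy_integral_le:
  assumes A: "oriented_contour A" and \<Gamma>: "closed \<Gamma>" and F: "integrable (arclength A) F"
    and f: "f \<in> borel_measurable borel" "\<And>k. norm (f k) \<le> F k"
      "AE k in arclength A. k \<notin> \<Gamma> \<longrightarrow> f k = 0"
    and z: "z \<notin> \<Gamma>"
  shows "integrable (arclength A) (\<lambda>k. f k / (k - z) * tangent A k)"
    and "norm (cauchy_integral A f z) \<le> (LINT k|arclength A. F k) / infdist z \<Gamma>"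
proof -
  have le: "AE k in arclength A. norm (f k / (k - z)) \<le> 1 / infdist z \<Gamma> * F k"
    using f(3)
  proof eventually_elim
    case (elim k)
    show ?case
    proof (cases "k \<in> \<Gamma>")
      case True
      then have "0 < infdist z \<Gamma>" using \<Gamma> z infdist_pos_not_in_closed by blast
      moreover have "infdist z \<Gamma> \<le> norm (k - z)"
        using infdist_le[OF True, of z] by (simp add: dist_norm norm_minus_commute)
      ultimately have "norm (f k) / norm (k - z) \<le> F k / infdist z \<Gamma>"
        using f(2)[of k] order_trans[OF norm_ge_zero f(2)] by (intro frac_le) auto
      then show ?thesis by (simp add: norm_divide)
    next
      case False
      moreover have "0 \<le> F k" using order_trans[OF norm_ge_zero f(2)] .
      ultimately show ?thesis using elim by (simp add: infdist_nonneg)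
    qed
  qed
  have m: "(\<lambda>k. f k / (k - z)) \<in> borel_measurable borel" using f(1) by measurable
  show "integrable (arclength A) (\<lambda>k. f k / (k - z) * tangent A k)"
    by (rule integrable_mult_tangent[OF A F m le])
  have "norm (cauchy_integral A f z) \<le> 1 * norm (LINT k|arclength A. f k / (k - z) * tangent A k)"
    unfolding cauchy_integral_def norm_mult by (intro mult_right_mono norm_cauchy_constant norm_ge_zero)
  also have "\<dots> \<le> 1 / infdist z \<Gamma> * (LINT k|arclength A. F k)"
    using norm_integral_mult_tangent_le[OF A F m le] by simp
  finally show "norm (cauchy_integral A f z) \<le> (LINT k|arclength A. F k) / infdist z \<Gamma>" by simp
qed

text \<open>From 1/(k - u) - 1/(k - z) = (u - z)/((k - u)(k - z)), the increment is u - z times the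
  Cauchy integral at u of f(k)/(k - z). The size estimate applies to that density and stays bounded
  as u tends to z.\<close>

lemma isCont_cauchy_integral:
  assumes A: "oriented_contour A" and \<Gamma>: "closed \<Gamma>" and F: "integrable (arclength A) F"
    and f: "f \<in> borel_measurable borel" "\<And>k. norm (f k) \<le> F k"
      "AE k in arclength A. k \<notin> \<Gamma> \<longrightarrow> f k = 0"
    and z: "z \<notin> \<Gamma>"
  shows "isCont (cauchy_integral A f) z"
proof -
  note int = norm_cauchy_integral_le(1)[OF A \<Gamma> F f]
  have m: "(\<lambda>k. f k / (k - z)) \<in> borel_measurable borel" using f(1) by measurable
  let ?B = "\<lambda>u. norm (u - z) * ((LINT k|arclength A. 1 / infdist z \<Gamma> * F k) / infdist u \<Gamma>)"
  have F': "integrable (arclength A) (\<lambda>k. 1 / infdist z \<Gamma> * F k)" using F by simp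
  \<comment> \<open>Cutting off outside \<Gamma> makes the majorant valid at every k, as the size
    estimate demands, and not only almost everywhere.\<close>
  define f' where "f' k = (if k \<in> \<Gamma> then f k / (k - z) else 0)" for k
  have f'_m: "f' \<in> borel_measurable borel"
    unfolding f'_def using m \<Gamma> by (intro measurable_If_set) auto
  have f'_le: "norm (f' k) \<le> 1 / infdist z \<Gamma> * F k" for k
  proof (cases "k \<in> \<Gamma>")
    case True
    then have "0 < infdist z \<Gamma>" using \<Gamma> z infdist_pos_not_in_closed by blast
    moreover have "infdist z \<Gamma> \<le> norm (k - z)"
      using infdist_le[OF True, of z] by (simp add: dist_norm norm_minus_commute)
    ultimately have "norm (f k) / norm (k - z) \<le> F k / infdist z \<Gamma>"
      using f(2)[of k] order_trans[OF norm_ge_zero f(2)] by (intro frac_le) auto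
    then show ?thesis using True by (simp add: f'_def norm_divide)
  next
    case False
    moreover have "0 \<le> F k" using order_trans[OF norm_ge_zero f(2)] .
    ultimately show ?thesis by (simp add: f'_def infdist_nonneg)
  qed
  have diff: "cauchy_integral A f u - cauchy_integral A f z = (u - z) * cauchy_integral A f' u"
    if u: "u \<notin> \<Gamma>" for u
  proof -
    have "(LINT k|arclength A. f k / (k - u) * tangent A k) - (LINT k|arclength A. f k / (k - z) * tangent A k)
        = (LINT k|arclength A. f k / (k - u) * tangent A k - f k / (k - z) * tangent A k)"
      by (rule Bochner_Integration.integral_diff[OF int[OF u] int[OF z], symmetric])
    also have "\<dots> = (LINT k|arclength A. (u - z) * (f' k / (k - u) * tangent A k))"
    proof (rule integral_cong_AE)
      from f(3) show "AE k in arclength A. f k / (k - u) * tangent A k - f k / (k - z) * tangent A k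
          = (u - z) * (f' k / (k - u) * tangent A k)"
      proof eventually_elim
        case (elim k)
        show ?case
        proof (cases "k \<in> \<Gamma>")
          case True
          then have "k - u \<noteq> 0" "k - z \<noteq> 0" using u z by auto
          then show ?thesis using True by (simp add: f'_def field_simps)
        qed (use elim in \<open>simp add: f'_def\<close>)
      qed
    qed (use f(1) f'_m borel_measurable_tangent[OF A] in simp_all)
    also have "\<dots> = (u - z) * (LINT k|arclength A. f' k / (k - u) * tangent A k)"
      by (rule integral_mult_right_zero)
    finally show ?thesis
      unfolding cauchy_integral_def right_diff_distrib[symmetric] by (simp only: mult.left_commute)
  qed
  have "((\<lambda>u. cauchy_integral A f u - cauchy_integral A f z) \<longlongrightarrow> 0) (at z)"
  proof (rule Lim_null_comparison)
    have "\<forall>\<^sub>F u in at z. u \<notin> \<Gamma>"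
      using \<Gamma> z by (intro topological_tendstoD[OF tendsto_ident_at, of "- \<Gamma>", simplified]) auto
    then show "\<forall>\<^sub>F u in at z. norm (cauchy_integral A f u - cauchy_integral A f z) \<le> ?B u"
    proof eventually_elim
      case (elim u)
      have "norm (cauchy_integral A f' u) \<le> (LINT k|arclength A. 1 / infdist z \<Gamma> * F k) / infdist u \<Gamma>"
        by (rule norm_cauchy_integral_le(2)[OF A \<Gamma> F' f'_m f'_le _ elim]) (simp add: f'_def)
      then show ?case unfolding diff[OF elim] norm_mult by (intro mult_left_mono) auto
    qed
    show "(?B \<longlongrightarrow> 0) (at z)"
    proof (cases "\<Gamma> = {}")
      case False
      then have "infdist z \<Gamma> \<noteq> 0" using \<Gamma> z infdist_pos_not_in_closed by (metis less_irrefl)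
      then show ?thesis by (auto intro!: tendsto_eq_intros)
    qed (simp add: infdist_def)
  qed
  then show ?thesis unfolding isCont_def by (subst Lim_null)
qed

section \<open>Expansion of the Cauchy integral at infinity\<close>

lemma inverse_diff_expansion:
  fixes k z :: complex
  assumes "z \<noteq> 0" "k \<noteq> z"
  shows "1 / (k - z) + (\<Sum>i=1..l. k ^ (i - 1) / z ^ i) = k ^ l / (z ^ l * (k - z))"
proof (induction l)
  case 0
  then show ?case by simp
next
  case (Suc l)
  have "1 / (k - z) + (\<Sum>i=1..Suc l. k ^ (i - 1) / z ^ i)
      = k ^ l / (z ^ l * (k - z)) + k ^ l / z ^ Suc l"
    using Suc by simp
  also have "\<dots> = k ^ Suc l / (z ^ Suc l * (k - z))"
    using assms by (simp add: divide_simps) (simp add: algebra_simps)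
  finally show ?case .
qed

text \<open>The coefficient of z^(-i) in the Cauchy integral. The sign and the exponent i - 1 come
  from 1/(k - z) = - (1/z + k/z^2 + ...).\<close>

definition cauchy_moment :: "oriented_arc set \<Rightarrow> (complex \<Rightarrow> complex) \<Rightarrow> nat \<Rightarrow> complex" where
  "cauchy_moment A f i =
     - (1 / (2 * of_real pi * \<i>) * (LINT k|arclength A. k ^ (i - 1) * f k * tangent A k))"

lemma
  assumes A: "oriented_contour A" and F: "integrable (arclength A) F"
    and f: "f \<in> borel_measurable borel" "\<And>k. (1 + norm k) ^ l * norm (f k) \<le> F k"
    and j: "j \<le> l"
  shows integrable_moment: "integrable (arclength A) (\<lambda>k. k ^ j * f k * tangent A k)"
    and norm_moment_le: "norm (LINT k|arclength A. k ^ j * f k * tangent A k) \<le> (LINT k|arclength A. F k)"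
proof -
  have "norm (k ^ j * f k) \<le> 1 * F k" for k
  proof -
    have "norm k ^ j \<le> (1 + norm k) ^ j" by (intro power_mono) auto
    also have "\<dots> \<le> (1 + norm k) ^ l" using j by (intro power_increasing) auto
    finally have "norm (k ^ j * f k) \<le> (1 + norm k) ^ l * norm (f k)"
      by (simp add: norm_mult norm_power mult_right_mono)
    then show ?thesis using f(2)[of k] by simp
  qed
  then have le: "AE k in arclength A. norm (k ^ j * f k) \<le> 1 * F k" by simp
  have m: "(\<lambda>k. k ^ j * f k) \<in> borel_measurable borel" using f(1) by measurable
  show "integrable (arclength A) (\<lambda>k. k ^ j * f k * tangent A k)"
    by (rule integrable_mult_tangent[OF A F m le])
  show "norm (LINT k|arclength A. k ^ j * f k * tangent A k) \<le> (LINT k|arclength A. F k)"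
    using norm_integral_mult_tangent_le[OF A F m le] by simp
qed

lemma norm_cauchy_moment_le:
  assumes A: "oriented_contour A" and F: "integrable (arclength A) F"
    and f: "f \<in> borel_measurable borel" "\<And>k. (1 + norm k) ^ l * norm (f k) \<le> F k"
    and i: "i \<in> {1..l}"
  shows "norm (cauchy_moment A f i) \<le> (LINT k|arclength A. F k)"
proof -
  have "norm (cauchy_moment A f i) \<le> 1 * norm (LINT k|arclength A. k ^ (i - 1) * f k * tangent A k)"
    unfolding cauchy_moment_def norm_minus_cancel norm_mult
    by (intro mult_right_mono norm_cauchy_constant norm_ge_zero)
  also have "\<dots> \<le> (LINT k|arclength A. F k)"
    using norm_moment_le[OF A F f, of "i - 1"] i by (simp add: le_diff_conv)
  finally show ?thesis .
qed

text \<open>After l terms of the geometric series the exact remainder has density k^l f(k)/(z^l (k -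
  z)). The hypothesis on \<epsilon> says |k - z| \<ge> \<epsilon> |z|, which supplies the last power
  of 1/|z| and also keeps z off \<Gamma>.\<close>

lemma cauchy_integral_expansion:
  assumes A: "oriented_contour A" and \<Gamma>: "closed \<Gamma>" and F: "integrable (arclength A) F"
    and f: "f \<in> borel_measurable borel" "\<And>k. (1 + norm k) ^ l * norm (f k) \<le> F k"
      "AE k in arclength A. k \<notin> \<Gamma> \<longrightarrow> f k = 0"
    and z: "z \<noteq> 0" and \<epsilon>: "0 < \<epsilon>" "\<And>k. k \<in> \<Gamma> \<Longrightarrow> \<epsilon> \<le> norm (1 - k / z)"
  shows "norm (cauchy_integral A f z - (\<Sum>i=1..l. 1 / z ^ i * cauchy_moment A f i))
    \<le> (LINT k|arclength A. F k) / \<epsilon> / norm z ^ (l + 1)"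
proof -
  have zk: "\<epsilon> * norm z \<le> norm (k - z)" if "k \<in> \<Gamma>" for k
  proof -
    have "\<epsilon> * norm z \<le> norm (1 - k / z) * norm z" using \<epsilon>(2)[OF that] by (intro mult_right_mono) auto
    also have "\<dots> = norm (z - k)" using z by (simp add: norm_mult[symmetric] left_diff_distrib)
    finally show ?thesis by (simp add: norm_minus_commute)
  qed
  have z\<Gamma>: "z \<notin> \<Gamma>" using \<epsilon> z by force
  have F0: "norm (f k) \<le> F k" for k
  proof -
    have "1 * norm (f k) \<le> (1 + norm k) ^ l * norm (f k)"
      by (intro mult_right_mono one_le_power) auto
    then show ?thesis using f(2)[of k] by simp
  qed
  define g where "g k = (if k \<in> \<Gamma> then k ^ l / (z ^ l * (k - z)) * f k else 0)" for k
  have gm: "g \<in> borel_measurable borel"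
    unfolding g_def using f(1) \<Gamma> by (intro measurable_If_set) auto
  have g_le: "norm (g k) \<le> 1 / (\<epsilon> * norm z ^ (l + 1)) * F k" for k
  proof (cases "k \<in> \<Gamma>")
    case True
    have pos: "0 < \<epsilon> * norm z" using \<epsilon> z by simp
    have "norm k ^ l \<le> (1 + norm k) ^ l" by (intro power_mono) auto
    then have "norm k ^ l * norm (f k) \<le> F k"
      using f(2)[of k] mult_right_mono[of "norm k ^ l" "(1 + norm k) ^ l" "norm (f k)"] by simp
    then have "norm k ^ l * norm (f k) / (norm z ^ l * norm (k - z)) \<le> F k / (norm z ^ l * (\<epsilon> * norm z))"
      using pos \<epsilon>(1) zk[OF True] z order_trans[OF norm_ge_zero F0]
      by (intro frac_le mult_left_mono mult_pos_pos) auto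
    then show ?thesis using True
      by (simp add: g_def norm_mult norm_divide norm_power mult_ac)
  next
    case False
    moreover have "0 \<le> F k" using order_trans[OF norm_ge_zero F0] .
    ultimately show ?thesis using \<epsilon> by (simp add: g_def)
  qed
  note int0 = norm_cauchy_integral_le(1)[OF A \<Gamma> F f(1) F0 f(3) z\<Gamma>]
  note intm = integrable_moment[OF A F f(1,2)]
  have int_sum: "integrable (arclength A) (\<lambda>k. \<Sum>i=1..l. 1 / z ^ i * (k ^ (i - 1) * f k * tangent A k))"
    by (intro Bochner_Integration.integrable_sum integrable_mult_right intm) auto
  have "(LINT k|arclength A. f k / (k - z) * tangent A k)
        + (\<Sum>i=1..l. 1 / z ^ i * (LINT k|arclength A. k ^ (i - 1) * f k * tangent A k))
      = (LINT k|arclength A. f k / (k - z) * tangent A k)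
        + (LINT k|arclength A. (\<Sum>i=1..l. 1 / z ^ i * (k ^ (i - 1) * f k * tangent A k)))"
    using intm by (subst Bochner_Integration.integral_sum)
      (auto intro!: integrable_mult_right sum.cong simp del: times_divide_eq_left times_divide_eq_right
        simp: integral_mult_right_zero)
  also have "\<dots> = (LINT k|arclength A. f k / (k - z) * tangent A k
        + (\<Sum>i=1..l. 1 / z ^ i * (k ^ (i - 1) * f k * tangent A k)))"
    by (rule Bochner_Integration.integral_add[OF int0 int_sum, symmetric])
  also have "\<dots> = (LINT k|arclength A. g k * tangent A k)"
  proof (rule integral_cong_AE)
    from f(3) show "AE k in arclength A. f k / (k - z) * tangent A k
        + (\<Sum>i=1..l. 1 / z ^ i * (k ^ (i - 1) * f k * tangent A k)) = g k * tangent A k"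
    proof eventually_elim
      case (elim k)
      show ?case
      proof (cases "k \<in> \<Gamma>")
        case True
        then have "k \<noteq> z" using z\<Gamma> by auto
        from inverse_diff_expansion[OF z this, of l]
        have "g k * tangent A k = (1 / (k - z) + (\<Sum>i=1..l. k ^ (i - 1) / z ^ i)) * (f k * tangent A k)"
          using True by (simp add: g_def mult.assoc)
        then show ?thesis
          by (simp add: distrib_right sum_distrib_right mult.assoc)
      qed (use elim in \<open>simp add: g_def\<close>)
    qed
    show "(\<lambda>k. f k / (k - z) * tangent A k
        + (\<Sum>i=1..l. 1 / z ^ i * (k ^ (i - 1) * f k * tangent A k))) \<in> borel_measurable (arclength A)"
      using int0 int_sum by (intro borel_measurable_add borel_measurable_integrable)
    show "(\<lambda>k. g k * tangent A k) \<in> borel_measurable (arclength A)"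
      using gm borel_measurable_tangent[OF A] by simp
  qed
  finally have eq: "(LINT k|arclength A. f k / (k - z) * tangent A k)
        + (\<Sum>i=1..l. 1 / z ^ i * (LINT k|arclength A. k ^ (i - 1) * f k * tangent A k))
      = (LINT k|arclength A. g k * tangent A k)" .
  have "cauchy_integral A f z - (\<Sum>i=1..l. 1 / z ^ i * cauchy_moment A f i)
      = 1 / (2 * of_real pi * \<i>) * ((LINT k|arclength A. f k / (k - z) * tangent A k)
        + (\<Sum>i=1..l. 1 / z ^ i * (LINT k|arclength A. k ^ (i - 1) * f k * tangent A k)))"
    unfolding cauchy_integral_def cauchy_moment_def
    by (simp only: distrib_left sum_distrib_left mult_minus_right sum_negf diff_minus_eq_add
        mult.left_commute)
  also have "norm \<dots> \<le> 1 * norm (LINT k|arclength A. g k * tangent A k)"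
    unfolding eq norm_mult by (intro mult_right_mono norm_cauchy_constant norm_ge_zero)
  also have "\<dots> \<le> 1 / (\<epsilon> * norm z ^ (l + 1)) * (LINT k|arclength A. F k)"
    unfolding mult_1 by (rule norm_integral_mult_tangent_le[OF A F gm AE_I2[OF g_le]])
  finally show ?thesis by (simp add: mult_ac)
qed

section \<open>Passage from entries to matrices\<close>

lemma norm_matrix_le:
  fixes M :: "complex^'m^'m"
  assumes "\<And>i j. norm (M $ i $ j) \<le> b"
  shows "norm M \<le> real CARD('m) * (real CARD('m) * b)"
proof -
  have "norm M \<le> (\<Sum>i\<in>UNIV. norm (M $ i))"
    unfolding norm_vec_def by (rule L2_set_le_sum) simp
  also have "\<dots> \<le> (\<Sum>i\<in>(UNIV::'m set). \<Sum>j\<in>UNIV. norm (M $ i $ j))"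
    unfolding norm_vec_def[of "M $ _"] by (intro sum_mono L2_set_le_sum) simp
  also have "\<dots> \<le> (\<Sum>i\<in>(UNIV::'m set). \<Sum>j\<in>(UNIV::'m set). b)"
    by (intro sum_mono assms)
  finally show ?thesis by simp
qed

lemma max_norm_le:
  fixes M :: "complex^'m^'m"
  assumes "\<And>i j. norm (M $ i $ j) \<le> b"
  shows "max_norm M \<le> b"
  unfolding max_norm_def by (rule Max.boundedI) (use assms in auto)

lemma max_norm_nonneg: "0 \<le> max_norm (M :: complex^'m^'m)"
proof -
  have "norm (M $ undefined $ undefined) \<le> max_norm M"
    unfolding max_norm_def by (rule Max_ge) (auto intro: range_eqI[of _ _ "(undefined, undefined)"])
  then show ?thesis using norm_ge_zero order_trans by blast
qed

lemma norm_entry_le: "norm (M $ i $ j) \<le> norm (M :: complex^'m^'m)"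
  by (rule order_trans[OF Finite_Cartesian_Product.norm_nth_le Finite_Cartesian_Product.norm_nth_le])

lemma borel_measurable_entry:
  fixes J :: "complex \<Rightarrow> complex^'m^'m"
  assumes "J \<in> borel_measurable M"
  shows "(\<lambda>k. J k $ i $ j) \<in> borel_measurable M"
proof -
  have "continuous_on UNIV (\<lambda>X :: complex^'m^'m. X $ i $ j)" by (intro continuous_intros)
  then have "(\<lambda>X :: complex^'m^'m. X $ i $ j) \<in> borel_measurable borel"
    by (rule borel_measurable_continuous_onI)
  then show ?thesis using assms by (rule measurable_compose[rotated])
qed

text \<open>The weighted norm of the whole matrix majorizes every entry, so a single integral
  controls all scalar estimates; the factors \<open>CARD('m)\<close> come from summing over the
  entries.\<close>

lemma
  fixes J :: "complex \<Rightarrow> complex^'m^'m"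
  assumes A: "oriented_contour A" and \<Gamma>: "closed \<Gamma>"
    and J: "J \<in> borel_measurable borel" "AE k in arclength A. k \<notin> \<Gamma> \<longrightarrow> J k = 0"
    and F: "integrable (arclength A) (\<lambda>k. (1 + norm k) ^ l * norm (J k))"
  defines "F \<equiv> LINT k|arclength A. (1 + norm k) ^ l * norm (J k)"
    and "\<theta> \<equiv> \<lambda>i. \<chi> a b. cauchy_moment A (\<lambda>k. J k $ a $ b) i"
  shows norm_cauchy_integral_mat_le:
      "z \<notin> \<Gamma> \<Longrightarrow> norm (cauchy_integral_mat A J z) \<le> real CARD('m) * (real CARD('m) * (F / infdist z \<Gamma>))"
    and isCont_cauchy_integral_mat: "z \<notin> \<Gamma> \<Longrightarrow> isCont (cauchy_integral_mat A J) z"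
    and max_norm_cauchy_moment_le: "i \<in> {1..l} \<Longrightarrow> max_norm (\<theta> i) \<le> F"
    and cauchy_integral_mat_expansion:
      "z \<noteq> 0 \<Longrightarrow> 0 < \<epsilon> \<Longrightarrow> (\<And>k. k \<in> \<Gamma> \<Longrightarrow> \<epsilon> \<le> norm (1 - k / z)) \<Longrightarrow>
       norm (cauchy_integral_mat A J z - (\<Sum>i=1..l. cscale (1 / z ^ i) (\<theta> i)))
         \<le> real CARD('m) * (real CARD('m) * (F / \<epsilon> / norm z ^ (l + 1)))"
proof -
  have m: "(\<lambda>k. J k $ a $ b) \<in> borel_measurable borel" for a b
    using J(1) by (rule borel_measurable_entry)
  have le: "(1 + norm k) ^ l * norm (J k $ a $ b) \<le> (1 + norm k) ^ l * norm (J k)" for k a b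
    by (intro mult_left_mono norm_entry_le) simp
  have le0: "norm (J k $ a $ b) \<le> (1 + norm k) ^ l * norm (J k)" for k a b
  proof -
    have "1 * norm (J k $ a $ b) \<le> (1 + norm k) ^ l * norm (J k)"
      by (intro mult_mono norm_entry_le one_le_power) auto
    then show ?thesis by simp
  qed
  have z0: "AE k in arclength A. k \<notin> \<Gamma> \<longrightarrow> J k $ a $ b = 0" for a b
    using J(2) by eventually_elim simp
  show "norm (cauchy_integral_mat A J z) \<le> real CARD('m) * (real CARD('m) * (F / infdist z \<Gamma>))"
    if "z \<notin> \<Gamma>" for z
    using norm_cauchy_integral_le(2)[OF A \<Gamma> F m le0 z0 that]
    by (intro norm_matrix_le) (simp add: cauchy_integral_mat_def F_def)
  show "isCont (cauchy_integral_mat A J) z" if "z \<notin> \<Gamma>" for z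
    using isCont_cauchy_integral[OF A \<Gamma> F m le0 z0 that]
    unfolding isCont_def cauchy_integral_mat_def by (intro vec_tendstoI) simp
  show "max_norm (\<theta> i) \<le> F" if "i \<in> {1..l}" for i
    using norm_cauchy_moment_le[OF A F m le that]
    by (intro max_norm_le) (simp add: F_def \<theta>_def)
  show "norm (cauchy_integral_mat A J z - (\<Sum>i=1..l. cscale (1 / z ^ i) (\<theta> i)))
      \<le> real CARD('m) * (real CARD('m) * (F / \<epsilon> / norm z ^ (l + 1)))"
    if "z \<noteq> 0" "0 < \<epsilon>" "\<And>k. k \<in> \<Gamma> \<Longrightarrow> \<epsilon> \<le> norm (1 - k / z)" for z \<epsilon>
    using cauchy_integral_expansion[OF A \<Gamma> F m le z0 that]
    by (intro norm_matrix_le) (simp add: cauchy_integral_mat_def cscale_def F_def \<theta>_def)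
qed

subsection \<open>The jump of the quotient\<close>

lemma regular_point_in_contour_iff:
  assumes "regular_point A I \<gamma> t" "B \<subseteq> A"
  shows "\<gamma> t \<in> contour B \<longleftrightarrow> (I, \<gamma>) \<in> B"
proof
  assume "\<gamma> t \<in> contour B"
  then obtain b where b: "b \<in> B" "\<gamma> t \<in> arc_trace b" by (auto simp: contour_def)
  then have "b = (I, \<gamma>)" using assms unfolding regular_point_def by (metis subsetD)
  then show "(I, \<gamma>) \<in> B" using b(1) by simp
next
  assume "(I, \<gamma>) \<in> B"
  moreover have "t \<in> I" using assms(1) interior_subset by (auto simp: regular_point_def)
  ultimately show "\<gamma> t \<in> contour B" by (force simp: contour_def arc_trace_def)
qed

lemma isCont_matrix_holomorphic:
  fixes N :: "complex \<Rightarrow> complex^'m^'m"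
  assumes "\<forall>i j. (\<lambda>z. N z $ i $ j) holomorphic_on U" "open U" "z \<in> U"
  shows "isCont N z"
  unfolding isCont_def
proof (intro vec_tendstoI)
  fix i j
  have "continuous_on U (\<lambda>z. N z $ i $ j)"
    using assms(1) by (blast intro: holomorphic_on_imp_continuous_on)
  then have "isCont (\<lambda>z. N z $ i $ j) z"
    using assms(2,3) by (simp add: continuous_on_eq_continuous_at)
  then show "((\<lambda>w. N w $ i $ j) \<longlongrightarrow> N z $ i $ j) (at z)" by (simp add: isCont_def)
qed

text \<open>At almost every point, which is regular and outside \<open>K\<close>, the cases are
  whether its arc belongs to \<open>B\<close>: if so, the common jump cancels; if not, N is
  holomorphic nearby and continuous.\<close>

lemma AE_quotient_jump:
  fixes S N :: "complex \<Rightarrow> complex^'m^'m"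
  assumes A: "oriented_contour A" and B: "B \<subseteq> A"
    and S: "RH_solution A v S" and N: "RH_solution B u N"
    and det: "\<And>z. z \<notin> contour B \<Longrightarrow> det (N z) = 1"
    and K: "finite K"
    and bdd: "\<And>\<rho>. 0 < \<rho> \<Longrightarrow> \<exists>b. \<forall>z. z \<notin> contour B \<longrightarrow> (\<forall>\<kappa>\<in>K. \<rho> \<le> dist z \<kappa>) \<longrightarrow>
      norm (matrix_inv (N z)) \<le> b"
    and uv: "AE k in arclength A. k \<in> contour B \<longrightarrow> u k = v k"
  shows "AE k in arclength A.
    (k \<in> contour B \<longrightarrow> bdry_plus A (\<lambda>z. S z ** matrix_inv (N z)) k
        = bdry_minus A (\<lambda>z. S z ** matrix_inv (N z)) k) \<and>
    (k \<notin> contour B \<longrightarrow> bdry_plus A (\<lambda>z. S z ** matrix_inv (N z)) k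
        - bdry_minus A (\<lambda>z. S z ** matrix_inv (N z)) k
      = bdry_minus A S k ** (v k - mat 1) ** matrix_inv (N k))"
proof -
  have "AE k in arclength A. has_bdry_values A S k \<and> bdry_plus A S k = bdry_minus A S k ** v k"
    using S by (simp add: RH_solution_def)
  moreover have "AE k in arclength A. k \<in> contour B \<longrightarrow>
      has_bdry_values B N k \<and> bdry_plus B N k = bdry_minus B N k ** u k"
    using N unfolding RH_solution_def AE_arclength_subset_iff[OF A B] by blast
  ultimately show ?thesis
    using AE_regular_point[OF A] AE_arclength_not_in_finite[OF A K] uv
  proof eventually_elim
    case (elim k)
    then obtain I \<gamma> t where reg: "regular_point A I \<gamma> t" and k: "k = \<gamma> t" by blast
    \<comment> \<open>Finiteness of \<open>K\<close> gives a disc around k that stays at distance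
      d/2 from \<open>K\<close>, where the inverse of N is bounded; this makes the inverses converge
      at k.\<close>
    obtain d where d: "0 < d" "\<And>\<kappa>. \<kappa> \<in> K \<Longrightarrow> \<kappa> \<noteq> k \<Longrightarrow> d \<le> dist k \<kappa>"
      using finite_set_avoid[OF K, of k] by blast
    obtain b where b: "\<And>z. z \<notin> contour B \<Longrightarrow> (\<forall>\<kappa>\<in>K. d / 2 \<le> dist z \<kappa>) \<Longrightarrow> norm (matrix_inv (N z)) \<le> b"
      using bdd[of "d / 2"] d(1) by auto
    have "\<forall>\<^sub>F z in at k. dist z k < d / 2"
      using d(1) by (auto simp: eventually_at intro!: exI[of _ "d / 2"])
    then have bdd': "\<forall>\<^sub>F z in at k. z \<notin> contour B \<longrightarrow> norm (matrix_inv (N z)) \<le> b"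
    proof eventually_elim
      case (elim z)
      have "d / 2 \<le> dist z \<kappa>" if "\<kappa> \<in> K" for \<kappa>
      proof -
        have "d \<le> dist k \<kappa>" using d(2)[OF that] \<open>k \<notin> K\<close> that by blast
        then show ?thesis using elim dist_triangle[of k \<kappa> z] by (simp add: dist_commute)
      qed
      then show ?case using b by blast
    qed
    have det': "\<forall>z. z \<notin> contour B \<longrightarrow> det (N z) = 1" using det by blast
    show ?case
    proof (cases "(I, \<gamma>) \<in> B")
      case True
      then have kB: "k \<in> contour B" using regular_point_in_contour_iff[OF reg B] k by simp
      have "bdry_plus A (\<lambda>z. S z ** matrix_inv (N z)) (\<gamma> t)
          = bdry_minus A (\<lambda>z. S z ** matrix_inv (N z)) (\<gamma> t)"
        by (rule quotient_jump_model[OF reg _ B True _ det' bdd'[unfolded k], where v = "v k"])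
          (use elim kB k in auto)
      then show ?thesis using kB k by simp
    next
      case False
      then have kB: "k \<notin> contour B" using regular_point_in_contour_iff[OF reg B] k by simp
      have "open (- contour B)"
        using closed_contour[OF oriented_contour_subset[OF A B]] by (simp add: open_Compl)
      then have "isCont N k"
        using N kB by (intro isCont_matrix_holomorphic[of N "- contour B"]) (auto simp: RH_solution_def)
      then have "bdry_plus A (\<lambda>z. S z ** matrix_inv (N z)) (\<gamma> t)
          - bdry_minus A (\<lambda>z. S z ** matrix_inv (N z)) (\<gamma> t)
          = bdry_minus A S (\<gamma> t) ** (v k - mat 1) ** matrix_inv (N (\<gamma> t))"
        by (intro quotient_jump_continuous[OF reg _ B _ det' bdd'[unfolded k]]) (use elim k in auto)
      then show ?thesis using kB k by simp
    qed
  qed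
qed

lemma AE_bdry_product:
  fixes S N E :: "complex \<Rightarrow> complex^'m^'m"
  assumes A: "oriented_contour A" and B: "B \<subseteq> A" and N: "RH_solution B u N"
    and E: "\<And>z. z \<notin> \<Gamma> \<Longrightarrow> isCont E z" and S: "\<And>z. z \<notin> contour A \<Longrightarrow> S z = E z ** N z"
  shows "AE k in arclength B. k \<notin> \<Gamma> \<longrightarrow>
    bdry_plus A S k = E k ** bdry_plus B N k \<and> bdry_minus A S k = E k ** bdry_minus B N k"
proof -
  have "AE k in arclength A. k \<in> contour B \<longrightarrow> has_bdry_values B N k"
  proof -
    have "AE k in arclength B. has_bdry_values B N k"
      using N unfolding RH_solution_def by (auto elim: eventually_mono)
    then show ?thesis by (simp add: AE_arclength_subset_iff[OF A B])
  qed
  then have "AE k in arclength A. k \<in> contour B \<longrightarrow> (k \<notin> \<Gamma> \<longrightarrow>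
    bdry_plus A S k = E k ** bdry_plus B N k \<and> bdry_minus A S k = E k ** bdry_minus B N k)"
    using AE_regular_point[OF A]
  proof eventually_elim
    case (elim k)
    then obtain I \<gamma> t where reg: "regular_point A I \<gamma> t" and k: "k = \<gamma> t" by blast
    show ?case
    proof (intro impI)
      assume kB: "k \<in> contour B" and "k \<notin> \<Gamma>"
      then have "(I, \<gamma>) \<in> B" "has_bdry_values B N (\<gamma> t)" "isCont E (\<gamma> t)"
        using regular_point_in_contour_iff[OF reg B] k elim E by auto
      from bdry_product[OF reg B this S] show "bdry_plus A S k = E k ** bdry_plus B N k \<and>
          bdry_minus A S k = E k ** bdry_minus B N k"
        unfolding k by blast
    qed
  qed
  then show ?thesis by (simp add: AE_arclength_subset_iff[OF A B])
qed

text \<open>A single function \<open>E\<close> serves all claims. On the part of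
  \<open>contour Amod\<close> off \<open>contour Aexp\<close> the factorization is asserted for both
  boundary values, since S and N have no intrinsic values there. In the expansion \<open>C\<close>
  and \<open>Z\<close> are chosen before n, so the remainder is uniform in all large n.\<close>

theorem theorem3p1:
  fixes A Amod Aexp :: "oriented_arc set"
    and vS :: "nat \<Rightarrow> complex \<Rightarrow> complex^'m^'m"
    and vN :: "complex \<Rightarrow> complex^'m^'m"
    and S R :: "nat \<Rightarrow> complex \<Rightarrow> complex^'m^'m"
    and N :: "complex \<Rightarrow> complex^'m^'m"
    and K :: "complex set"
    and c chi p0 q r s :: real and p :: ennreal and l :: nat
  assumes contour_A: "oriented_contour A" and A_eq: "A = Amod \<union> Aexp"
    and cauchy: "cauchy_operators_bounded A"
    and S_sol: "\<And>n. RH_solution A (vS n) (S n)"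
    and N_sol: "RH_solution Amod vN N"
    and vN_bdd: "\<exists>B. AE k in arclength A. norm (vN k) \<le> B"
    and det_vS: "\<And>n. AE k in arclength A. det (vS n k) = 1"
    and det_vN: "AE k in arclength A. det (vN k) = 1"
    and det_S: "\<And>n z. z \<notin> contour A \<Longrightarrow> det (S n z) = 1"
    and det_N: "\<And>z. z \<notin> contour Amod \<Longrightarrow> det (N z) = 1"
    and K: "finite K" "K \<subseteq> contour Aexp"
    and vS_exp: "exp_small_away 0 Aexp K (\<lambda>n k. vS n k - mat 1)"
    and vS_exp_unbounded: "\<not> bounded (contour Aexp) \<Longrightarrow>
          exp_small_away (l + 2) Aexp K (\<lambda>n k. vS n k - mat 1)"
    and N_bdd: "\<And>\<rho>. 0 < \<rho> \<Longrightarrow> \<exists>B. \<forall>z. z \<notin> contour Amod \<longrightarrow> (\<forall>\<kappa>\<in>K. \<rho> \<le> dist z \<kappa>) \<longrightarrow>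
          norm (N z) \<le> B \<and> norm (matrix_inv (N z)) \<le> B"
    and R_eq: "R = (\<lambda>n z. S n z ** matrix_inv (N z))"
    and p0: "1 < p0"
    and R_Lp: "\<And>n. in_Lp (ennreal p0) (arclength A) (\<lambda>k. bdry_plus A (R n) k - mat 1)"
              "\<And>n. in_Lp (ennreal p0) (arclength A) (\<lambda>k. bdry_minus A (R n) k - mat 1)"
    and R_cauchy: "\<And>n z. z \<notin> contour A \<Longrightarrow>
          R n z = mat 1 + cauchy_integral_mat A (\<lambda>k. bdry_plus A (R n) k - bdry_minus A (R n) k) z"
    and cond1: "\<And>n. AE k in arclength A. k \<in> contour Amod \<longrightarrow> vN k = vS n k"
               "AE k in arclength A. k \<in> contour Aexp - contour Amod \<longrightarrow> vN k = mat 1"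
    and cond2: "0 < c" "0 < chi"
               "\<And>\<kappa>. \<kappa> \<in> K \<Longrightarrow> \<exists>C. \<exists>\<rho>>0. \<forall>\<^sub>F n in sequentially. AE k in arclength Aexp.
                  dist k \<kappa> < \<rho> \<longrightarrow>
                  norm (vS n k - mat 1) \<le> C * exp (- c * real n * norm (k - \<kappa>) powr chi)"
    and cond3: "\<And>\<kappa>. \<kappa> \<in> K \<Longrightarrow> \<exists>C. \<exists>\<rho>>0. \<forall>z. z \<notin> contour Amod \<longrightarrow> z \<noteq> \<kappa> \<longrightarrow> dist z \<kappa> < \<rho> \<longrightarrow>
                  norm (N z) \<le> C * norm (z - \<kappa>) powr (-1/4) \<and>
                  norm (matrix_inv (N z)) \<le> C * norm (z - \<kappa>) powr (-1/4)"
    and q: "1 \<le> q" "q < 4"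
    and p: "4/3 < p" "1 / p + 1 / ennreal q = 1"
    and S_minus: "\<forall>\<^sub>F n in sequentially. in_Lp p (arclength Aexp) (bdry_minus A (S n))"
                 "(\<lambda>n. Lp_norm p (arclength Aexp) (bdry_minus A (S n))) \<in> O(\<lambda>n. real n powr r)"
    and r: "r < 1 / (q * chi) - 1 / (4 * chi)"
    and s: "s = 1 / (q * chi) - 1 / (4 * chi) - r"
  shows "\<exists>E :: nat \<Rightarrow> complex \<Rightarrow> complex^'m^'m.
      (\<forall>\<^sub>F n in sequentially.
         (\<forall>z. z \<notin> contour A \<longrightarrow> S n z = (mat 1 + E n z) ** N z) \<and>
         (AE k in arclength Amod. k \<notin> contour Aexp \<longrightarrow>
            bdry_plus A (S n) k = (mat 1 + E n k) ** bdry_plus Amod N k \<and>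
            bdry_minus A (S n) k = (mat 1 + E n k) ** bdry_minus Amod N k)) \<and>
      (\<exists>C. \<forall>\<^sub>F n in sequentially. \<forall>z. z \<notin> contour Aexp \<longrightarrow>
         norm (E n z) \<le> C * (real n powr (- s) / infdist z (contour Aexp))) \<and>
      (\<exists>\<theta> :: nat \<Rightarrow> nat \<Rightarrow> complex^'m^'m.
         (\<forall>i\<in>{1..l}. (\<lambda>n. max_norm (\<theta> i n)) \<in> O(\<lambda>n. real n powr (- s))) \<and>
         (\<forall>\<epsilon>>0. \<exists>C Z. \<forall>\<^sub>F n in sequentially. \<forall>z.
            Z \<le> norm z \<longrightarrow> (\<forall>k\<in>contour Aexp. \<epsilon> \<le> norm (1 - k / z)) \<longrightarrow>
            norm (E n z - (\<Sum>i=1..l. cscale (1 / z ^ i) (\<theta> i n))) \<le> C / norm z ^ (l + 1)))"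
proof -
  have Amod: "Amod \<subseteq> A" and Aexp: "Aexp \<subseteq> A" using A_eq by auto
  have c_exp: "oriented_contour Aexp" using oriented_contour_subset[OF contour_A Aexp] .
  have cl: "closed (contour Aexp)" using closed_contour[OF c_exp] .
  define J where "J n k = bdry_plus A (R n) k - bdry_minus A (R n) k" for n k
  define E where "E n = cauchy_integral_mat A (J n)" for n
  define F where "F n = (LINT k|arclength A. (1 + norm k) ^ l * norm (J n k))" for n
  define \<theta> where "\<theta> i n = (\<chi> a b. cauchy_moment A (\<lambda>k. J n k $ a $ b) i)" for i n
  have s_eq: "r - (1 / (q * chi) - 1 / (4 * chi)) = - s" and s_pos: "0 < s"
    using r s by simp_all
  have R_n: "R n = (\<lambda>z. S n z ** matrix_inv (N z))" for n by (simp add: R_eq)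
  have N_inv_far: "\<exists>b. \<forall>z. z \<notin> contour Amod \<longrightarrow> (\<forall>\<kappa>\<in>K. \<rho> \<le> dist z \<kappa>) \<longrightarrow> norm (matrix_inv (N z)) \<le> b"
    if "0 < \<rho>" for \<rho>
    using N_bdd[OF that] by meson
  have N_inv_near: "\<exists>C. \<exists>\<rho>>0. \<forall>z. z \<notin> contour Amod \<longrightarrow> z \<noteq> \<kappa> \<longrightarrow> dist z \<kappa> < \<rho> \<longrightarrow>
      norm (matrix_inv (N z)) \<le> C * norm (z - \<kappa>) powr (-1/4)" if "\<kappa> \<in> K" for \<kappa>
    using cond3[OF that] by meson
  have jump: "AE k in arclength A. (k \<in> contour Amod \<longrightarrow> J n k = 0) \<and> (k \<notin> contour Amod \<longrightarrow>
      J n k = bdry_minus A (S n) k ** (vS n k - mat 1) ** matrix_inv (N k))" for n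
  proof -
    have "AE k in arclength A.
        (k \<in> contour Amod \<longrightarrow> bdry_plus A (R n) k = bdry_minus A (R n) k) \<and>
        (k \<notin> contour Amod \<longrightarrow> bdry_plus A (R n) k - bdry_minus A (R n) k
          = bdry_minus A (S n) k ** (vS n k - mat 1) ** matrix_inv (N k))"
      unfolding R_n
      by (rule AE_quotient_jump[OF contour_A Amod S_sol N_sol _ K(1) _ cond1(1)])
        (fact det_N N_inv_far)+
    then show ?thesis by eventually_elim (simp add: J_def)
  qed
  \<comment> \<open>A point of the contour off \<open>contour Aexp\<close> lies on
    \<open>contour Amod\<close>, where the jump vanishes almost everywhere.\<close>
  have J_zero: "AE k in arclength A. k \<notin> contour Aexp \<longrightarrow> J n k = 0" for n
    using jump[of n] AE_arclength_regular[OF contour_A]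
    by eventually_elim (auto simp: contour_def A_eq)
  \<comment> \<open>Measurability of the boundary values of R is part of their membership in L^p0,
    and the measurable sets of \<open>arclength A\<close> are the Borel sets.\<close>
  have J_meas: "J n \<in> borel_measurable borel" for n
  proof -
    have "(\<lambda>k. bdry_plus A (R n) k - mat 1) \<in> borel_measurable (arclength A)"
      "(\<lambda>k. bdry_minus A (R n) k - mat 1) \<in> borel_measurable (arclength A)"
      using R_Lp[of n] unfolding in_Lp_def by blast+
    from borel_measurable_diff[OF this] show ?thesis by (simp add: J_def[abs_def])
  qed
  \<comment> \<open>On a bounded contour the weight is itself bounded, so the unweighted smallness
    suffices; otherwise the weighted one is a hypothesis.\<close>
  have small: "exp_small_away (l + 2) Aexp K (\<lambda>n k. vS n k - mat 1)"
    using exp_small_away_bounded[OF c_exp _ vS_exp] vS_exp_unbounded by blast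
  obtain C d where C: "0 \<le> C" and d: "0 < d" and prod: "\<forall>\<^sub>F n in sequentially. AE k in arclength Aexp.
      k \<notin> contour Amod \<longrightarrow> (1 + norm k) ^ l * (norm (vS n k - mat 1) * norm (matrix_inv (N k)))
      \<le> C * ((\<Sum>\<kappa>\<in>K. exp (- c * real n * norm (k - \<kappa>) powr chi) * norm (k - \<kappa>) powr (-1/4))
        + exp (- d * real n) * (1 + norm k) powr - 2)"
    by (rule weighted_product_bound[OF c_exp K(1) small cond2(3) N_inv_far N_inv_near]) (assumption | rule that)+
  obtain \<mu> where \<mu>: "0 < \<mu>"
    "\<And>(P :: complex^'m^'m) (Q :: complex^'m^'m). norm (P ** Q) \<le> \<mu> * norm P * norm Q"
    by (rule norm_matrix_mult_le) (rule that)
  have bound: "\<forall>\<^sub>F n in sequentially. AE k in arclength Aexp. (1 + norm k) ^ l * norm (J n k)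
      \<le> \<mu> * \<mu> * C * (norm (bdry_minus A (S n) k) *
        ((\<Sum>\<kappa>\<in>K. exp (- c * real n * norm (k - \<kappa>) powr chi) * norm (k - \<kappa>) powr (-1/4))
          + exp (- d * real n) * (1 + norm k) powr - 2))"
    using prod
  proof eventually_elim
    case (elim n)
    have "AE k in arclength Aexp. (k \<in> contour Amod \<longrightarrow> J n k = 0) \<and> (k \<notin> contour Amod \<longrightarrow>
        J n k = bdry_minus A (S n) k ** (vS n k - mat 1) ** matrix_inv (N k))"
      unfolding AE_arclength_subset_iff[OF contour_A Aexp]
      using jump[of n] by eventually_elim blast
    with elim show ?case
    proof eventually_elim
      case (elim k)
      let ?h = "(\<Sum>\<kappa>\<in>K. exp (- c * real n * norm (k - \<kappa>) powr chi) * norm (k - \<kappa>) powr (-1/4))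
          + exp (- d * real n) * (1 + norm k) powr - 2"
      let ?m = "norm (bdry_minus A (S n) k)" and ?w = "norm (vS n k - mat 1)" and ?Y = "norm (matrix_inv (N k))"
      have h: "0 \<le> ?h" by (intro add_nonneg_nonneg sum_nonneg) auto
      show ?case
      proof (cases "k \<in> contour Amod")
        case True
        then have "J n k = 0" using elim(2) by blast
        then show ?thesis using h C \<mu>(1) by simp
      next
        case False
        then have "norm (J n k) = norm (bdry_minus A (S n) k ** (vS n k - mat 1) ** matrix_inv (N k))"
          using elim(2) by simp
        also have "\<dots> \<le> \<mu> * norm (bdry_minus A (S n) k ** (vS n k - mat 1)) * ?Y" by (rule \<mu>(2))
        also have "\<dots> \<le> \<mu> * (\<mu> * ?m * ?w) * ?Y"
          using \<mu>(1) by (intro mult_right_mono mult_left_mono \<mu>(2)) auto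
        finally have "(1 + norm k) ^ l * norm (J n k) \<le> (1 + norm k) ^ l * (\<mu> * (\<mu> * ?m * ?w) * ?Y)"
          by (intro mult_left_mono) auto
        also have "\<dots> = \<mu> * \<mu> * ?m * ((1 + norm k) ^ l * (?w * ?Y))" by (simp only: mult_ac)
        also have "\<dots> \<le> \<mu> * \<mu> * ?m * (C * ?h)"
          using elim(1) False \<mu>(1) by (intro mult_left_mono) auto
        finally show ?thesis by (simp only: mult_ac)
      qed
    qed
  qed
  have "0 \<le> \<mu> * \<mu> * C" using \<mu>(1) C by simp
  from weighted_integral_rate[OF c_exp K(1) q p(2) S_minus cond2(1,2) d this bound]
  obtain D where D: "0 \<le> D" "\<forall>\<^sub>F n in sequentially.
      (\<integral>\<^sup>+k. ennreal ((1 + norm k) ^ l * norm (J n k)) \<partial>arclength Aexp) \<le> ennreal (D * real n powr - s)"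
    unfolding s_eq by blast
  \<comment> \<open>Integrability must accompany the bound on \<open>F n\<close>: the integral of a
    nonintegrable function is 0 by convention, and the bound alone would say nothing.\<close>
  have rate: "\<forall>\<^sub>F n in sequentially. integrable (arclength A) (\<lambda>k. (1 + norm k) ^ l * norm (J n k))
      \<and> F n \<le> D * real n powr - s"
    using D(2)
  proof eventually_elim
    case (elim n)
    have m: "(\<lambda>k. (1 + norm k) ^ l * norm (J n k)) \<in> borel_measurable borel"
      using J_meas[of n] by measurable
    have "(\<integral>\<^sup>+k. ennreal ((1 + norm k) ^ l * norm (J n k)) \<partial>arclength A)
        = (\<integral>\<^sup>+k. ennreal ((1 + norm k) ^ l * norm (J n k)) * indicator (contour Aexp) k \<partial>arclength A)"
    proof (rule nn_integral_cong_AE)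
      from J_zero[of n] show "AE k in arclength A. ennreal ((1 + norm k) ^ l * norm (J n k))
          = ennreal ((1 + norm k) ^ l * norm (J n k)) * indicator (contour Aexp) k"
        by eventually_elim (auto simp: indicator_def)
    qed
    also have "\<dots> = (\<integral>\<^sup>+k. ennreal ((1 + norm k) ^ l * norm (J n k)) \<partial>arclength Aexp)"
      using nn_integral_arclength_subset[OF contour_A Aexp measurable_compose[OF m measurable_ennreal]]
      by simp
    finally have le: "(\<integral>\<^sup>+k. ennreal ((1 + norm k) ^ l * norm (J n k)) \<partial>arclength A) \<le> ennreal (D * real n powr - s)"
      using elim by simp
    have int: "integrable (arclength A) (\<lambda>k. (1 + norm k) ^ l * norm (J n k))"
    proof (rule integrableI_bounded)
      have "(\<integral>\<^sup>+k. ennreal (norm ((1 + norm k) ^ l * norm (J n k))) \<partial>arclength A)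
          = (\<integral>\<^sup>+k. ennreal ((1 + norm k) ^ l * norm (J n k)) \<partial>arclength A)"
        by (simp add: abs_mult)
      then show "(\<integral>\<^sup>+k. ennreal (norm ((1 + norm k) ^ l * norm (J n k))) \<partial>arclength A) < \<infinity>"
        using le_less_trans[OF le ennreal_less_top] by simp
    qed (use m in simp)
    have "ennreal (F n) \<le> ennreal (D * real n powr - s)"
      using le nn_integral_eq_integral[OF int] by (simp add: F_def)
    then have "F n \<le> D * real n powr - s" using D(1) by (simp add: ennreal_le_iff)
    with int show ?case by blast
  qed
  note est = norm_cauchy_integral_mat_le[OF contour_A cl J_meas J_zero]
    isCont_cauchy_integral_mat[OF contour_A cl J_meas J_zero]
    max_norm_cauchy_moment_le[OF contour_A cl J_meas J_zero]
    cauchy_integral_mat_expansion[OF contour_A cl J_meas J_zero]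
  let ?c = "real CARD('m) * real CARD('m)"
  have product: "S n z = (mat 1 + E n z) ** N z" if z: "z \<notin> contour A" for n z
  proof -
    have "z \<notin> contour Amod" using z contour_mono[OF Amod] by blast
    then have "R n z ** N z = S n z"
      using matrix_inv_left_det1[OF det_N, of z] by (simp add: R_n flip: matrix_mul_assoc)
    moreover have "R n z = mat 1 + E n z"
      using R_cauchy[OF z, of n] by (simp add: E_def J_def[abs_def])
    ultimately show ?thesis by simp
  qed
  have boundary: "\<forall>\<^sub>F n in sequentially. AE k in arclength Amod. k \<notin> contour Aexp \<longrightarrow>
      bdry_plus A (S n) k = (mat 1 + E n k) ** bdry_plus Amod N k \<and>
      bdry_minus A (S n) k = (mat 1 + E n k) ** bdry_minus Amod N k"
    using rate
  proof eventually_elim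
    case (elim n)
    \<comment> \<open>The density of \<open>E n\<close> is supported on \<open>contour Aexp\<close>,
      so the error factor is continuous across the rest of the model contour.\<close>
    have "isCont (\<lambda>z. mat 1 + E n z) z" if "z \<notin> contour Aexp" for z
      unfolding E_def using est(2)[OF conjunct1[OF elim] that] by (intro continuous_intros)
    then show ?case by (rule AE_bdry_product[OF contour_A Amod N_sol _ product])
  qed
  have decay: "\<forall>\<^sub>F n in sequentially. \<forall>z. z \<notin> contour Aexp \<longrightarrow>
      norm (E n z) \<le> ?c * D * (real n powr - s / infdist z (contour Aexp))"
    using rate
  proof eventually_elim
    case (elim n)
    show ?case
    proof (intro allI impI)
      fix z assume z: "z \<notin> contour Aexp"
      have "norm (E n z) \<le> ?c * (F n / infdist z (contour Aexp))"
        using est(1)[OF conjunct1[OF elim] z] by (simp add: E_def F_def mult.assoc)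
      also have "\<dots> \<le> ?c * (D * real n powr - s / infdist z (contour Aexp))"
        using elim by (intro mult_left_mono divide_right_mono infdist_nonneg) auto
      finally show "norm (E n z) \<le> ?c * D * (real n powr - s / infdist z (contour Aexp))"
        by (simp add: mult.assoc)
    qed
  qed
  have moments: "(\<lambda>n. max_norm (\<theta> i n)) \<in> O(\<lambda>n. real n powr - s)" if i: "i \<in> {1..l}" for i
  \<comment> \<open>Only D \<ge> 0 is known, while the constant in a Landau bound must be
    positive.\<close>
  proof (rule landau_o.bigI[of "D + 1"])
    show "\<forall>\<^sub>F n in sequentially. norm (max_norm (\<theta> i n)) \<le> (D + 1) * norm (real n powr - s)"
      using rate
    proof eventually_elim
      case (elim n)
      have "max_norm (\<theta> i n) \<le> F n"
        using est(3)[OF conjunct1[OF elim] i] by (simp add: F_def \<theta>_def)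
      also have "\<dots> \<le> (D + 1) * real n powr - s"
        using elim by (simp add: distrib_right add_increasing2)
      finally show ?case using max_norm_nonneg[of "\<theta> i n"] by simp
    qed
  qed (use D(1) in simp)
  have expansion: "\<exists>C Z. \<forall>\<^sub>F n in sequentially. \<forall>z. Z \<le> norm z \<longrightarrow>
      (\<forall>k\<in>contour Aexp. \<epsilon> \<le> norm (1 - k / z)) \<longrightarrow>
      norm (E n z - (\<Sum>i=1..l. cscale (1 / z ^ i) (\<theta> i n))) \<le> C / norm z ^ (l + 1)"
    if \<epsilon>: "0 < \<epsilon>" for \<epsilon>
  \<comment> \<open>The threshold Z = 1 only serves to keep z away from 0; the constant depends on
    \<epsilon> through D/\<epsilon>.\<close>
  proof (intro exI)
    show "\<forall>\<^sub>F n in sequentially. \<forall>z. 1 \<le> norm z \<longrightarrow>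
      (\<forall>k\<in>contour Aexp. \<epsilon> \<le> norm (1 - k / z)) \<longrightarrow>
      norm (E n z - (\<Sum>i=1..l. cscale (1 / z ^ i) (\<theta> i n))) \<le> ?c * (D / \<epsilon>) / norm z ^ (l + 1)"
      using rate eventually_gt_at_top[of 0]
    proof eventually_elim
      case (elim n)
      show ?case
      proof (intro allI impI)
        fix z :: complex assume z: "1 \<le> norm z" "\<forall>k\<in>contour Aexp. \<epsilon> \<le> norm (1 - k / z)"
        \<comment> \<open>As s > 0, the decaying factor is at most 1 for n \<ge> 1; discarding it
          makes the remainder constant independent of n.\<close>
        have "real n powr - s \<le> real n powr 0" using elim(2) s_pos by (intro powr_mono) auto
        then have "D * real n powr - s \<le> D * 1" using D(1) elim(2) by (intro mult_left_mono) auto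
        then have F: "F n \<le> D" using elim(1) by simp
        have "z \<noteq> 0" using z(1) by auto
        then have "norm (E n z - (\<Sum>i=1..l. cscale (1 / z ^ i) (\<theta> i n))) \<le> ?c * (F n / \<epsilon> / norm z ^ (l + 1))"
          using est(4)[OF conjunct1[OF elim(1)] _ \<epsilon>, of z] z(2) by (auto simp: E_def F_def \<theta>_def mult.assoc)
        also have "\<dots> \<le> ?c * (D / \<epsilon> / norm z ^ (l + 1))"
          using F \<epsilon> by (intro mult_left_mono divide_right_mono) auto
        finally show "norm (E n z - (\<Sum>i=1..l. cscale (1 / z ^ i) (\<theta> i n))) \<le> ?c * (D / \<epsilon>) / norm z ^ (l + 1)"
          by simp
      qed
    qed
  qed
  show ?thesis
  proof (intro exI[of _ E] conjI)
    show "\<forall>\<^sub>F n in sequentially. (\<forall>z. z \<notin> contour A \<longrightarrow> S n z = (mat 1 + E n z) ** N z) \<and>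
        (AE k in arclength Amod. k \<notin> contour Aexp \<longrightarrow>
          bdry_plus A (S n) k = (mat 1 + E n k) ** bdry_plus Amod N k \<and>
          bdry_minus A (S n) k = (mat 1 + E n k) ** bdry_minus Amod N k)"
      using boundary by eventually_elim (use product in blast)
  qed (use decay moments expansion in blast)+
qed

end
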